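(* Let $M=\Gamma\backslash\mathbf{H}^n$ be a non-compact hyperbolic manifold, let $C$ be the maximal representative of a cusp of $M$, and let $P\in M$ be a point of tangency of $C$ with itself, i.e. the image in $M$ of a point of tangency between two distinct horoballs of the preimage of $C$ in $\mathbf{H}^n$. Then $$\mathsf{R}(M)\;\ge\;\mathsf{r}_{inj}(P)\;\ge\;\mathrm{arccosh}(\sqrt5/2).$$ Moreover, when $M$ is the Gieseking manifold, equality holds between these quantities: $\mathsf{R}(M)=\mathsf{r}_{inj}(P)=\mathrm{arccosh}(\sqrt5/2)$.
   Context: A hyperbolic manifold is a manifold without boundary (not necessarily orientable) with a complete metric of constant curvature $-1$ and finite volume; $M=\Gamma\backslash\mathbf{H}^n$ with $\Gamma$ a discrete torsion-free group of isometries. $\mathsf{R}(M)$ is the radius of the largest embedded metric ball in $M$ (the maximum of the injectivity radius), and $\mathsf{r}_{inj}(P)$ is the injectivity radius at $P$. For $x\in\partial\mathbf{H}^n$ let $\Gamma_x$ be its stabilizer in $\Gamma$. A cusp region is a subset $\Gamma_x\backslash B_x\subset M$ where $B_x$ is an open horoball centered at a parabolic fixed point $x$ such that no $\gamma\in\Gamma\setminus\Gamma_x$ identifies two points of $B_x$. A cusp is an equivalence class of cusp regions for the relation "one contains the other"; its maximal representative is the union of its elements. The Gieseking manifold is $\Gamma\backslash\mathbf{H}^3$ with $\Gamma$ generated (in the upper half-space model, $\omega=e^{i\pi/3}$) by the orientation-reversing isometries extending $z\mapsto(\bar z-1)/(-\omega)$ and $z\mapsto\omega\bar z/(\bar z+\omega)$;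 it is obtained by gluing the faces of a regular ideal tetrahedron in pairs and has a single cusp. *)

theory Defs
  imports "HOL-Analysis.Analysis"
begin

text \<open>A point of H^n is a pair (x, t) with x in 'a (a Euclidean space of dimension
  n-1 >= 1) and height t > 0. Hence n = DIM('a) + 1 >= 2.\<close>

definition hspace :: "('a::euclidean_space \<times> real) set" where
  "hspace = {p. snd p > 0}"

definition hdist :: "'a::euclidean_space \<times> real \<Rightarrow> 'a \<times> real \<Rightarrow> real" where
  "hdist p q = arcosh (1 + ((norm (fst p - fst q))\<^sup>2 + (snd p - snd q)\<^sup>2)
                             / (2 * snd p * snd q))"

definition hball :: "'a::euclidean_space \<times> real \<Rightarrow> real \<Rightarrow> ('a \<times> real) set" where
  "hball p r = {q \<in> hspace. hdist p q < r}"

definition hyp_isom :: "('a::euclidean_space \<times> real \<Rightarrow> 'a \<times> real) \<Rightarrow> bool" where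
  "hyp_isom f \<longleftrightarrow> bij_betw f hspace hspace
     \<and> (\<forall>p\<in>hspace. \<forall>q\<in>hspace. hdist (f p) (f q) = hdist p q)
     \<and> (\<forall>p. p \<notin> hspace \<longrightarrow> f p = p)"

definition isom_group :: "('a::euclidean_space \<times> real \<Rightarrow> 'a \<times> real) set \<Rightarrow> bool" where
  "isom_group \<Gamma> \<longleftrightarrow> (\<forall>f\<in>\<Gamma>. hyp_isom f) \<and> id \<in> \<Gamma>
     \<and> (\<forall>f\<in>\<Gamma>. \<forall>g\<in>\<Gamma>. f \<circ> g \<in> \<Gamma>) \<and> (\<forall>f\<in>\<Gamma>. inv f \<in> \<Gamma>)"

definition discrete_group :: "('a::euclidean_space \<times> real \<Rightarrow> 'a \<times> real) set \<Rightarrow> bool" where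
  "discrete_group \<Gamma> \<longleftrightarrow> (\<forall>p\<in>hspace. \<forall>r. finite {\<gamma>\<in>\<Gamma>. hdist p (\<gamma> p) \<le> r})"

definition torsion_free :: "('a \<Rightarrow> 'a) set \<Rightarrow> bool" where
  "torsion_free \<Gamma> \<longleftrightarrow> (\<forall>\<gamma>\<in>\<Gamma>. \<forall>k::nat. k > 0 \<and> \<gamma> ^^ k = id \<longrightarrow> \<gamma> = id)"

definition hyp_vol :: "('a::euclidean_space \<times> real) set \<Rightarrow> ennreal" where
  "hyp_vol A = (\<integral>\<^sup>+ p. indicator A p * ennreal (1 / snd p ^ (DIM('a) + 1)) \<partial>lborel)"

definition orbit :: "('b \<Rightarrow> 'b) set \<Rightarrow> 'b \<Rightarrow> 'b set" where
  "orbit \<Gamma> p = (\<lambda>\<gamma>. \<gamma> p) ` \<Gamma>"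

definition finite_volume :: "('a::euclidean_space \<times> real \<Rightarrow> 'a \<times> real) set \<Rightarrow> bool" where
  "finite_volume \<Gamma> \<longleftrightarrow> (\<exists>F. F \<in> sets lborel \<and> F \<subseteq> hspace
      \<and> (\<forall>p\<in>hspace. \<exists>!q. q \<in> F \<and> q \<in> orbit \<Gamma> p) \<and> hyp_vol F < \<infinity>)"

definition hyperbolic_group :: "('a::euclidean_space \<times> real \<Rightarrow> 'a \<times> real) set \<Rightarrow> bool" where
  "hyperbolic_group \<Gamma> \<longleftrightarrow> isom_group \<Gamma> \<and> discrete_group \<Gamma> \<and> torsion_free \<Gamma> \<and> finite_volume \<Gamma>"

definition quotient_compact :: "('a::euclidean_space \<times> real \<Rightarrow> 'a \<times> real) set \<Rightarrow> bool" where
  "quotient_compact \<Gamma> \<longleftrightarrow> (\<exists>K. compact K \<and> K \<subseteq> hspace \<and> (\<Union>\<gamma>\<in>\<Gamma>. \<gamma> ` K) = hspace)"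

text \<open>Boundary point: None = \<infinity>, Some a = (a, 0).\<close>
definition horoball :: "'a::euclidean_space option \<Rightarrow> ('a \<times> real) set \<Rightarrow> bool" where
  "horoball x B = (case x of
      None \<Rightarrow> (\<exists>t>0. B = {p. snd p > t})
    | Some a \<Rightarrow> (\<exists>r>0. B = {p. snd p > 0 \<and> dist p (a, r) < r}))"

definition fixes_bdry :: "('a::euclidean_space \<times> real \<Rightarrow> 'a \<times> real) \<Rightarrow> 'a option \<Rightarrow> bool" where
  "fixes_bdry \<gamma> x \<longleftrightarrow> (\<forall>B. horoball x B \<longrightarrow> horoball x (\<gamma> ` B))"

definition stabilizer :: "('a::euclidean_space \<times> real \<Rightarrow> 'a \<times> real) set \<Rightarrow> 'a option
     \<Rightarrow> ('a \<times> real \<Rightarrow> 'a \<times> real) set" where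
  "stabilizer \<Gamma> x = {\<gamma>\<in>\<Gamma>. fixes_bdry \<gamma> x}"

definition parabolic :: "('a::euclidean_space \<times> real \<Rightarrow> 'a \<times> real) \<Rightarrow> bool" where
  "parabolic \<gamma> \<longleftrightarrow> (\<forall>p\<in>hspace. \<gamma> p \<noteq> p) \<and> (\<exists>!x. fixes_bdry \<gamma> x)"

definition parabolic_fixed_point :: "('a::euclidean_space \<times> real \<Rightarrow> 'a \<times> real) set \<Rightarrow> 'a option \<Rightarrow> bool" where
  "parabolic_fixed_point \<Gamma> x \<longleftrightarrow> (\<exists>\<gamma>\<in>\<Gamma>. parabolic \<gamma> \<and> fixes_bdry \<gamma> x)"

definition cusp_horoball :: "('a::euclidean_space \<times> real \<Rightarrow> 'a \<times> real) set \<Rightarrow> 'a option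
     \<Rightarrow> ('a \<times> real) set \<Rightarrow> bool" where
  "cusp_horoball \<Gamma> x B \<longleftrightarrow> parabolic_fixed_point \<Gamma> x \<and> horoball x B
     \<and> (\<forall>\<gamma>\<in>\<Gamma> - stabilizer \<Gamma> x. \<forall>p\<in>B. \<forall>q\<in>B. \<gamma> p \<noteq> q)"

text \<open>Points of M = Gamma\H^n are orbits; subsets of M are sets of orbits.
  A cusp region is the image Gamma_x\B_x of an admissible horoball B_x.\<close>
definition cusp_region :: "('a::euclidean_space \<times> real \<Rightarrow> 'a \<times> real) set \<Rightarrow> ('a \<times> real) set set \<Rightarrow> bool" where
  "cusp_region \<Gamma> S \<longleftrightarrow> (\<exists>x B. cusp_horoball \<Gamma> x B \<and> S = orbit \<Gamma> ` B)"

definition cusp_comparable :: "('a::euclidean_space \<times> real \<Rightarrow> 'a \<times> real) set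
     \<Rightarrow> ('a \<times> real) set set \<Rightarrow> ('a \<times> real) set set \<Rightarrow> bool" where
  "cusp_comparable \<Gamma> S T \<longleftrightarrow> cusp_region \<Gamma> S \<and> cusp_region \<Gamma> T \<and> (S \<subseteq> T \<or> T \<subseteq> S)"

definition max_cusp :: "('a::euclidean_space \<times> real \<Rightarrow> 'a \<times> real) set \<Rightarrow> ('a \<times> real) set set \<Rightarrow> bool" where
  "max_cusp \<Gamma> C \<longleftrightarrow> (\<exists>S0. cusp_region \<Gamma> S0
       \<and> C = \<Union>{S. (cusp_comparable \<Gamma>)\<^sup>*\<^sup>* S0 S})"

definition preimage_in_H :: "('a::euclidean_space \<times> real \<Rightarrow> 'a \<times> real) set \<Rightarrow> ('a \<times> real) set set \<Rightarrow> ('a \<times> real) set" where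
  "preimage_in_H \<Gamma> C = {p\<in>hspace. orbit \<Gamma> p \<in> C}"

text \<open>p (a lift of P in H^n) is a point of tangency between two distinct horoballs of
  the preimage of C (the horoballs of the preimage being its connected components).\<close>
definition self_tangency :: "('a::euclidean_space \<times> real \<Rightarrow> 'a \<times> real) set \<Rightarrow> ('a \<times> real) set set
     \<Rightarrow> 'a \<times> real \<Rightarrow> bool" where
  "self_tangency \<Gamma> C p \<longleftrightarrow> p \<in> hspace \<and> (\<exists>B1 B2.
      B1 \<in> components (preimage_in_H \<Gamma> C) \<and> B2 \<in> components (preimage_in_H \<Gamma> C)
      \<and> (\<exists>x. horoball x B1) \<and> (\<exists>y. horoball y B2) \<and> B1 \<noteq> B2
      \<and> p \<in> closure B1 \<and> p \<in> closure B2)"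

definition r_inj :: "('a::euclidean_space \<times> real \<Rightarrow> 'a \<times> real) set \<Rightarrow> 'a \<times> real \<Rightarrow> real" where
  "r_inj \<Gamma> p = Sup {r. r > 0 \<and> (\<forall>\<gamma>\<in>\<Gamma>. \<gamma> \<noteq> id \<longrightarrow> \<gamma> ` hball p r \<inter> hball p r = {})}"

definition R_max :: "('a::euclidean_space \<times> real \<Rightarrow> 'a \<times> real) set \<Rightarrow> real" where
  "R_max \<Gamma> = Sup (r_inj \<Gamma> ` hspace)"

definition omega :: complex where "omega = cis (pi / 3)"

text \<open>Poincare extensions to H^3 (points (z,t), z complex, t > 0) of
  z \<mapsto> (conj z - 1)/(-omega) and z \<mapsto> omega conj z/(conj z + omega).
  The latter is w \<mapsto> w/(conj omega * w + 1) after w = conj z, a Moebius map with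
  matrix [[1,0],[conj omega,1]] of determinant 1, extended by the standard formula.\<close>
definition gies_g1 :: "complex \<times> real \<Rightarrow> complex \<times> real" where
  "gies_g1 p = (if snd p > 0 then ((cnj (fst p) - 1) / (- omega), snd p) else p)"

definition gies_g2 :: "complex \<times> real \<Rightarrow> complex \<times> real" where
  "gies_g2 p = (if snd p > 0 then
     (let w = cnj (fst p); t = snd p; d = (cmod (cnj omega * w + 1))\<^sup>2 + t\<^sup>2
      in ((w * cnj (cnj omega * w + 1) + omega * complex_of_real (t\<^sup>2)) / complex_of_real d, t / d))
     else p)"

inductive_set generated_group :: "('b \<Rightarrow> 'b) set \<Rightarrow> ('b \<Rightarrow> 'b) set" for G where
  gen: "g \<in> G \<Longrightarrow> g \<in> generated_group G"
| ident: "id \<in> generated_group G"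
| comp: "f \<in> generated_group G \<Longrightarrow> g \<in> generated_group G \<Longrightarrow> f \<circ> g \<in> generated_group G"
| inverse: "f \<in> generated_group G \<Longrightarrow> inv f \<in> generated_group G"

definition Gieseking :: "(complex \<times> real \<Rightarrow> complex \<times> real) set" where
  "Gieseking = generated_group {gies_g1, gies_g2}"

end

theory Submission
  imports Defs "HOL-Number_Theory.Cong"
begin

text \<open>
  Let \<open>p\<close> be the point of tangency of two horoballs \<open>B\<^sub>1, B\<^sub>2\<close> of the preimage of the cusp, with
  exponentiated Busemann functions \<open>b\<^sub>1, b\<^sub>2\<close> equal to \<open>1\<close> on the horospheres. Then
  \<open>2 cosh d(p, q) = b\<^sub>1 q + b\<^sub>2 q\<close> for all \<open>q\<close>. For \<open>q = \<gamma> p\<close> each \<open>b\<^sub>i q\<close> is either at least \<open>2\<close>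
  (if \<open>\<gamma>\<^sup>-\<^sup>1 B\<^sub>i\<close> is disjoint from \<open>B\<^sub>1\<close> and \<open>B\<^sub>2\<close>) or equal to \<open>1\<close>, and both are \<open>1\<close> only for
  \<open>q = p\<close>. Hence \<open>cosh d(p, \<gamma> p) \<ge> 3/2 = cosh (2 arcosh (\<surd>5/2))\<close>. Finite volume makes the
  injectivity radius bounded, so that its supremum is meaningful.

  For the Gieseking group, elements are represented by matrices of determinant \<open>1\<close> over the Eisenstein
  integers, which gives discreteness. A fixed point can be moved to a point of height at least
  \<open>1/\<surd>3\<close>; there the trace and the lower left entry of the matrix are so small that a congruence
  modulo \<open>4\<close> forces the identity. The Dirichlet domain of the centre of the ideal tetrahedron lies in
  the tetrahedron, and on it one of the four elements \<open>a, b, a b\<^sup>-\<^sup>1, a\<^sup>-\<^sup>1 b\<close> displaces each point by at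
  most \<open>2 arcosh (\<surd>5/2)\<close>.
\<close>

section \<open>Hyperbolic distance and isometries\<close>

text \<open>Isometries are given only as distance-preserving bijections, not as linear, Moebius or
  smooth maps, and this shapes the first half. In the hyperboloid model a horoball is a null vector
  l with b(q) = -<l, q>. A tangency point is p = (l_1 + l_2)/2, whence the linear identity for 2
  cosh d(p, q); disjoint horoballs satisfy -<l, l'> >= 2, which is where the value 2 comes from. As
  \<gamma> is not known to map horoballs to horoballs, the same bound is reached metrically, by
  filling a horoball with large balls. Continuity of isometries and a crude volume estimate are
  likewise extracted from distances. Computing with \<open>coshd\<close> instead of
  \<open>hdist\<close> keeps everything rational in the coordinates. For the Gieseking group,
  integrality of the matrices gives discreteness but not freeness: determinant-one Eisenstein
  matrices of trace 0 or +-1 are torsion modulo sign, so an invariant of the subgroup is needed. Its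
  radii are bounded by the displacement estimate rather than by volume.\<close>

definition coshd :: "'a::euclidean_space \<times> real \<Rightarrow> 'a \<times> real \<Rightarrow> real" where
  "coshd p q = 1 + ((norm (fst p - fst q))\<^sup>2 + (snd p - snd q)\<^sup>2) / (2 * snd p * snd q)"

lemma hdist_ch: "hdist p q = arcosh (coshd p q)"
  by (simp add: hdist_def coshd_def)

lemma coshd_eq:
  assumes "snd p > 0" "snd q > 0"
  shows "coshd p q = ((norm (fst p - fst q))\<^sup>2 + (snd p)\<^sup>2 + (snd q)\<^sup>2) / (2 * snd p * snd q)"
  using assms by (simp add: coshd_def field_simps power2_eq_square)

lemma coshd_commute: "coshd p q = coshd q p"
  by (simp add: coshd_def norm_minus_commute power2_commute mult.commute mult.left_commute)

lemma coshd_ge_1: "p \<in> hspace \<Longrightarrow> q \<in> hspace \<Longrightarrow> coshd p q \<ge> 1"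
  by (simp add: coshd_def hspace_def)

lemma coshd_self [simp]: "coshd p p = 1"
  by (simp add: coshd_def)

lemma coshd_eq_1_iff: "p \<in> hspace \<Longrightarrow> q \<in> hspace \<Longrightarrow> coshd p q = 1 \<longleftrightarrow> p = q"
  by (auto simp: coshd_def hspace_def prod_eq_iff add_nonneg_eq_0_iff)

lemma cosh_hdist: "p \<in> hspace \<Longrightarrow> q \<in> hspace \<Longrightarrow> cosh (hdist p q) = coshd p q"
  by (simp add: hdist_ch coshd_ge_1 cosh_arcosh_real)

lemma hdist_nonneg: "p \<in> hspace \<Longrightarrow> q \<in> hspace \<Longrightarrow> hdist p q \<ge> 0"
  by (simp add: hdist_ch coshd_ge_1 arcosh_nonneg_real)

lemma hdist_commute: "hdist p q = hdist q p"
  by (simp add: hdist_ch coshd_commute)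

lemma hdist_less_iff:
  assumes "p \<in> hspace" "q \<in> hspace" "r \<ge> 0"
  shows "hdist p q < r \<longleftrightarrow> coshd p q < cosh r"
  using assms cosh_real_nonneg_less_iff[of "hdist p q" r] by (simp add: cosh_hdist hdist_nonneg)

lemma hdist_le_iff:
  assumes "p \<in> hspace" "q \<in> hspace" "r \<ge> 0"
  shows "hdist p q \<le> r \<longleftrightarrow> coshd p q \<le> cosh r"
  using assms cosh_real_nonneg_le_iff[of "hdist p q" r] by (simp add: cosh_hdist hdist_nonneg)

lemma hdist_eq_0_iff: "p \<in> hspace \<Longrightarrow> q \<in> hspace \<Longrightarrow> hdist p q = 0 \<longleftrightarrow> p = q"
  using hdist_le_iff[of p q 0] coshd_ge_1[of p q] hdist_nonneg[of p q] coshd_eq_1_iff[of p q] by force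

lemma hdist_triangle:
  fixes p m q :: "'a::euclidean_space \<times> real"
  assumes p: "p \<in> hspace" and m: "m \<in> hspace" and q: "q \<in> hspace"
  shows "hdist p q \<le> hdist p m + hdist m q"
proof -
  \<comment> \<open>In the hyperboloid model, write a point as its component along \<open>m\<close> plus a
    component in the positive definite orthogonal complement of \<open>m\<close>; \<open>U\<close> is the latter.\<close>
  define s where "s = snd m"
  define U where "U = (\<lambda>x::'a \<times> real. (inverse (snd x) *\<^sub>R (fst x - fst m),
      ((norm (fst x - fst m))\<^sup>2 + (snd x)\<^sup>2 - s\<^sup>2) / (2 * snd x * s)))"
  have s: "s > 0" using m by (simp add: s_def hspace_def)
  have U: "(norm (U x))\<^sup>2 = (coshd x m)\<^sup>2 - 1" if "x \<in> hspace" for x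
  proof -
    have t: "snd x > 0" using that by (simp add: hspace_def)
    have "(norm (U x))\<^sup>2 = (norm (inverse (snd x) *\<^sub>R (fst x - fst m)))\<^sup>2
        + (((norm (fst x - fst m))\<^sup>2 + (snd x)\<^sup>2 - s\<^sup>2) / (2 * snd x * s))\<^sup>2"
      by (simp add: U_def norm_Pair del: abs_divide norm_divide)
    also have "(norm (inverse (snd x) *\<^sub>R (fst x - fst m)))\<^sup>2 = (norm (fst x - fst m))\<^sup>2 / (snd x)\<^sup>2"
      by (simp add: power_mult_distrib power_divide divide_inverse mult.commute power_inverse)
    also have "(norm (fst x - fst m))\<^sup>2 / (snd x)\<^sup>2
        + (((norm (fst x - fst m))\<^sup>2 + (snd x)\<^sup>2 - s\<^sup>2) / (2 * snd x * s))\<^sup>2 = (coshd x m)\<^sup>2 - 1"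
    proof -
      have "n / t\<^sup>2 + ((n + t\<^sup>2 - s\<^sup>2) / (2 * t * s))\<^sup>2 = ((n + t\<^sup>2 + s\<^sup>2) / (2 * t * s))\<^sup>2 - 1"
        if "t > 0" for n t :: real
        using that s by (simp add: power_divide power_mult_distrib divide_simps)
          (simp add: power2_eq_square algebra_simps)
      note alg = this[OF t]
      have c: "coshd x m = ((norm (fst x - fst m))\<^sup>2 + (snd x)\<^sup>2 + s\<^sup>2) / (2 * snd x * s)"
        using t s by (simp add: coshd_eq s_def[symmetric])
      show ?thesis unfolding c by (rule alg)
    qed
    finally show ?thesis .
  qed
  have *: "coshd p q = coshd p m * coshd m q - U p \<bullet> U q"
  proof -
    have t: "snd p > 0" "snd q > 0" using p q by (auto simp: hspace_def)
    have n: "(norm (fst p - fst q))\<^sup>2 = (norm (fst p - fst m))\<^sup>2 + (norm (fst q - fst m))\<^sup>2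
        - 2 * ((fst p - fst m) \<bullet> (fst q - fst m))"
      by (simp add: power2_norm_eq_inner inner_diff_left inner_diff_right inner_commute algebra_simps)
    have "coshd m q = coshd q m" by (rule coshd_commute)
    then show ?thesis using t s
      by (simp add: coshd_eq s_def[symmetric] U_def n) (simp add: field_simps power2_eq_square)
  qed
  have sq: "norm (U x) = sinh (hdist x m)" if "x \<in> hspace" for x
  proof -
    have "(norm (U x))\<^sup>2 = (sinh (hdist x m))\<^sup>2"
      using U[OF that] by (simp add: sinh_square_eq cosh_hdist that m)
    then show ?thesis
      using hdist_nonneg[OF that m] by (simp add: power2_eq_iff_nonneg)
  qed
  \<comment> \<open>Cauchy-Schwarz on the components orthogonal to \<open>m\<close> yields the
    addition formula for cosh.\<close>
  have "coshd p q \<le> coshd p m * coshd m q + norm (U p) * norm (U q)"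
    using * Cauchy_Schwarz_ineq2[of "U p" "U q"] by linarith
  also have "\<dots> = cosh (hdist p m + hdist m q)"
    using p m q by (simp add: sq cosh_add cosh_hdist hdist_commute[of m q] coshd_commute[of m q])
  finally show ?thesis
    using p m q by (simp add: hdist_le_iff hdist_nonneg)
qed

text \<open>In the hyperboloid model \<open>1/t\<close> and \<open>x/t\<close> are linear
  coordinates, and the midpoint is the sum of the two points divided by its Lorentzian length
  \<open>k\<close>. It will serve as a common point of a ball and its translate.\<close>

lemma hyperbolic_midpoint:
  fixes p q :: "'a::euclidean_space \<times> real"
  assumes p: "p \<in> hspace" and q: "q \<in> hspace"
  obtains m where "m \<in> hspace" "coshd p m = sqrt ((1 + coshd p q) / 2)" "coshd q m = sqrt ((1 + coshd p q) / 2)"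
proof -
  define t s where "t = snd p" and "s = snd q"
  define k where "k = sqrt (2 + 2 * coshd p q)"
  define m where "m = (inverse (s + t) *\<^sub>R (s *\<^sub>R fst p + t *\<^sub>R fst q), k * t * s / (s + t))"
  have ts: "t > 0" "s > 0" using p q by (auto simp: t_def s_def hspace_def)
  have k2: "k\<^sup>2 = 2 + 2 * coshd p q" using coshd_ge_1[OF p q] by (simp add: k_def)
  have k: "k > 0" using coshd_ge_1[OF p q] by (simp add: k_def)
  have n: "(norm (fst p - fst q))\<^sup>2 = t * s * (k\<^sup>2 - 2) - s\<^sup>2 - t\<^sup>2"
    using ts unfolding k2 by (simp add: coshd_eq t_def[symmetric] s_def[symmetric] power2_eq_square field_simps)
  have m: "m \<in> hspace" using ts k by (simp add: m_def hspace_def)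
  have k': "sqrt ((1 + coshd p q) / 2) = k / 2"
    using k2 by (intro real_sqrt_unique) (use k in \<open>auto simp: power_divide\<close>)
  have d1: "fst p - fst m = (t / (s + t)) *\<^sub>R (fst p - fst q)"
  proof -
    have "(s + t) *\<^sub>R fst m = s *\<^sub>R fst p + t *\<^sub>R fst q"
      using ts by (simp add: m_def)
    then have "(s + t) *\<^sub>R (fst p - fst m) = t *\<^sub>R (fst p - fst q)"
      by (simp add: scaleR_diff_right scaleR_add_left)
    then have "inverse (s + t) *\<^sub>R ((s + t) *\<^sub>R (fst p - fst m)) = inverse (s + t) *\<^sub>R (t *\<^sub>R (fst p - fst q))"
      by simp
    then show ?thesis using ts by (simp add: divide_inverse_commute)
  qed
  have d2: "fst q - fst m = (s / (s + t)) *\<^sub>R (fst q - fst p)"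
  proof -
    have "(s + t) *\<^sub>R fst m = s *\<^sub>R fst p + t *\<^sub>R fst q"
      using ts by (simp add: m_def)
    then have "(s + t) *\<^sub>R (fst q - fst m) = s *\<^sub>R (fst q - fst p)"
      by (simp add: scaleR_diff_right scaleR_add_left)
    then have "inverse (s + t) *\<^sub>R ((s + t) *\<^sub>R (fst q - fst m)) = inverse (s + t) *\<^sub>R (s *\<^sub>R (fst q - fst p))"
      by simp
    then show ?thesis using ts by (simp add: divide_inverse_commute)
  qed
  have sm: "snd m = k * t * s / (s + t)" by (simp add: m_def)
  have st: "s + t > 0" using ts by simp
  \<comment> \<open>Stated for fresh \<open>t\<close> and \<open>s\<close>, so that it serves both
    endpoints with the roles exchanged.\<close>
  have alg: "((t / (s + t))\<^sup>2 * (t * s * (k\<^sup>2 - 2) - s\<^sup>2 - t\<^sup>2) + t\<^sup>2 + (k * t * s / (s + t))\<^sup>2)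
      = k / 2 * (2 * t * (k * t * s / (s + t)))" if "t > 0" "s > 0" for t s :: real
  proof -
    have "s + t \<noteq> 0" using that by simp
    then have "(s+t)\<^sup>2 * ((t / (s + t))\<^sup>2 * (t * s * (k\<^sup>2 - 2) - s\<^sup>2 - t\<^sup>2) + t\<^sup>2 + (k * t * s / (s + t))\<^sup>2)
       = t\<^sup>2 * (t * s * (k\<^sup>2 - 2) - s\<^sup>2 - t\<^sup>2) + (s+t)\<^sup>2 * t\<^sup>2 + (k * t * s)\<^sup>2"
      by (simp add: power_divide distrib_left)
    also have "\<dots> = (s + t) * (k\<^sup>2 * t\<^sup>2 * s)" by (simp add: power2_eq_square algebra_simps)
    also have "\<dots> = (s+t)\<^sup>2 * (k / 2 * (2 * t * (k * t * s / (s + t))))"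
      using \<open>s + t \<noteq> 0\<close> by (simp add: power2_eq_square)
    finally have eq: "(s+t)\<^sup>2 * ((t / (s + t))\<^sup>2 * (t * s * (k\<^sup>2 - 2) - s\<^sup>2 - t\<^sup>2) + t\<^sup>2 + (k * t * s / (s + t))\<^sup>2)
       = (s+t)\<^sup>2 * (k / 2 * (2 * t * (k * t * s / (s + t))))" .
    show ?thesis by (rule iffD1[OF mult_left_cancel eq]) (use \<open>s + t \<noteq> 0\<close> in simp)
  qed
  have "(norm (fst p - fst m))\<^sup>2 = (t / (s + t))\<^sup>2 * (t * s * (k\<^sup>2 - 2) - s\<^sup>2 - t\<^sup>2)"
    unfolding n[symmetric] d1 by (simp add: power_mult_distrib power_divide)
  then have "coshd p m = k / 2"
    using ts k st alg[OF ts] by (subst coshd_eq) (simp_all add: sm t_def[symmetric])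
  moreover have "(norm (fst q - fst m))\<^sup>2 = (s / (t + s))\<^sup>2 * (s * t * (k\<^sup>2 - 2) - t\<^sup>2 - s\<^sup>2)"
  proof -
    have "s * t * (k\<^sup>2 - 2) - t\<^sup>2 - s\<^sup>2 = (norm (fst q - fst p))\<^sup>2"
      unfolding norm_minus_commute[of "fst q"] n by (simp add: mult.commute)
    then show ?thesis
      unfolding d2 by (simp add: power_mult_distrib power_divide add.commute)
  qed
  then have "coshd q m = k / 2"
    using ts k st alg[OF ts(2,1)] by (subst coshd_eq) (simp_all add: sm s_def[symmetric] ac_simps)
  ultimately show ?thesis using that m k' by metis
qed


lemma hyp_isom_in: "hyp_isom f \<Longrightarrow> p \<in> hspace \<Longrightarrow> f p \<in> hspace"
  by (auto simp: hyp_isom_def bij_betw_def)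

lemma hyp_isom_hdist: "hyp_isom f \<Longrightarrow> p \<in> hspace \<Longrightarrow> q \<in> hspace \<Longrightarrow> hdist (f p) (f q) = hdist p q"
  by (simp add: hyp_isom_def)

lemma hyp_isom_ch: "hyp_isom f \<Longrightarrow> p \<in> hspace \<Longrightarrow> q \<in> hspace \<Longrightarrow> coshd (f p) (f q) = coshd p q"
  by (metis cosh_hdist hyp_isom_hdist hyp_isom_in)

lemma hyp_isomI:
  assumes "\<And>p. p \<in> hspace \<Longrightarrow> f p \<in> hspace" "\<And>p. p \<in> hspace \<Longrightarrow> g p \<in> hspace"
    and "\<And>p. p \<in> hspace \<Longrightarrow> g (f p) = p" "\<And>p. p \<in> hspace \<Longrightarrow> f (g p) = p"
    and "\<And>p q. p \<in> hspace \<Longrightarrow> q \<in> hspace \<Longrightarrow> coshd (f p) (f q) = coshd p q"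
    and "\<And>p. p \<notin> hspace \<Longrightarrow> f p = p"
  shows "hyp_isom f"
  unfolding hyp_isom_def using assms
  by (auto simp: hdist_ch intro!: bij_betw_byWitness[where f' = g])

lemma hyp_isom_notin: "hyp_isom f \<Longrightarrow> p \<notin> hspace \<Longrightarrow> f p = p"
  unfolding hyp_isom_def by blast

text \<open>Being the identity off \<open>hspace\<close> makes an isometry bijective on the whole
  type, so \<open>inv\<close> is a genuine two-sided inverse.\<close>

lemma hyp_isom_bij: "hyp_isom f \<Longrightarrow> bij f"
proof -
  assume f: "hyp_isom f"
  have "bij_betw f (hspace \<union> - hspace) (hspace \<union> - hspace)"
  proof (rule bij_betw_combine)
    show "bij_betw f (- hspace) (- hspace)"
      using bij_betw_cong[of "- hspace" f id] f by (simp add: hyp_isom_notin)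
  qed (use f in \<open>auto simp: hyp_isom_def\<close>)
  then show ?thesis by simp
qed

lemma hyp_isom_inv_apply [simp]:
  assumes "hyp_isom f" shows "inv f (f p) = p" "f (inv f p) = p"
  using hyp_isom_bij[OF assms] by (auto simp: bij_is_inj bij_is_surj surj_f_inv_f)

lemma hyp_isom_id: "hyp_isom id"
  by (simp add: hyp_isom_def)

lemma hyp_isom_comp: "hyp_isom f \<Longrightarrow> hyp_isom g \<Longrightarrow> hyp_isom (f \<circ> g)"
  by (auto simp: hyp_isom_def bij_betw_trans intro: bij_betw_apply) (metis bij_betw_apply)+

lemma hyp_isom_inv:
  assumes f: "hyp_isom f" shows "hyp_isom (inv f)"
proof -
  have m: "inv f p \<in> hspace" if "p \<in> hspace" for p
    using f that by (metis hyp_isom_inv_apply(2) hyp_isom_notin)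
  show ?thesis
  proof (rule hyp_isomI[where g = f])
    show "coshd (inv f p) (inv f q) = coshd p q" if "p \<in> hspace" "q \<in> hspace" for p q
      using f m that hyp_isom_ch[OF f, of "inv f p" "inv f q"] by simp
    show "inv f p = p" if "p \<notin> hspace" for p
      using f that by (metis hyp_isom_inv_apply(1) hyp_isom_notin)
  qed (use f m in \<open>auto simp: hyp_isom_in\<close>)
qed

lemma hyp_isom_hball:
  assumes f: "hyp_isom f" and p: "p \<in> hspace"
  shows "f ` hball p r = hball (f p) r"
proof (intro equalityI subsetI)
  fix y assume "y \<in> hball (f p) r"
  then have y: "y \<in> hspace" "hdist (f p) y < r" by (auto simp: hball_def)
  have i: "inv f y \<in> hspace" using f y(1) by (simp add: hyp_isom_in hyp_isom_inv)
  have "hdist p (inv f y) = hdist (f p) y"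
    using hyp_isom_hdist[OF f p i] f by simp
  then have "inv f y \<in> hball p r" using y i by (simp add: hball_def)
  then show "y \<in> f ` hball p r" using f by (intro image_eqI[of _ _ "inv f y"]) simp_all
qed (use assms in \<open>auto simp: hball_def hyp_isom_in hyp_isom_hdist\<close>)

text \<open>The bound mentions only the height of \<open>p\<close>, because the height of
  \<open>q\<close> is itself controlled by \<open>2 * t * c\<close>. It thus gives Euclidean
  continuity of isometries at \<open>p\<close>.\<close>

lemma dist_le_ch:
  assumes "p \<in> hspace" "q \<in> hspace"
  shows "(dist p q)\<^sup>2 \<le> 4 * (snd p)\<^sup>2 * (coshd p q * (coshd p q - 1))"
proof -
  define t s c where "t = snd p" and "s = snd q" and "c = coshd p q"
  have ts: "t > 0" "s > 0" using assms by (auto simp: t_def s_def hspace_def)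
  have c1: "c \<ge> 1" using coshd_ge_1 assms by (simp add: c_def)
  have d: "(dist p q)\<^sup>2 = (norm (fst p - fst q))\<^sup>2 + (t - s)\<^sup>2"
    by (simp add: dist_prod_def dist_norm t_def s_def)
  have e: "(norm (fst p - fst q))\<^sup>2 + (t - s)\<^sup>2 = 2 * t * s * (c - 1)"
    using ts by (simp add: c_def coshd_def t_def s_def)
  have "(t - s)\<^sup>2 \<le> 2 * t * s * (c - 1)" unfolding e[symmetric] by simp
  then have "s * s \<le> s * (2 * t * c)" using zero_le_power2[of t] unfolding power2_eq_square by argo
  then have "s \<le> 2 * t * c" using ts(2) by (rule mult_left_le_imp_le)
  then have "2 * t * (c - 1) * s \<le> 2 * t * (c - 1) * (2 * t * c)"
    using ts c1 by (intro mult_left_mono) auto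
  then show ?thesis
    unfolding d e t_def[symmetric] c_def[symmetric] by (simp add: power2_eq_square algebra_simps)
qed

lemma continuous_on_ch: "p \<in> hspace \<Longrightarrow> continuous_on hspace (coshd p)"
  unfolding coshd_def hspace_def by (intro continuous_intros) auto

lemma open_hspace: "open (hspace :: ('a::euclidean_space \<times> real) set)"
  unfolding hspace_def by (intro open_Collect_less continuous_intros)

lemma hyp_isom_continuous:
  assumes f: "hyp_isom f" shows "continuous_on hspace f"
proof (rule continuous_on_eq_continuous_at[THEN iffD2, OF open_hspace], rule ballI)
  fix p :: "'a \<times> real" assume p: "p \<in> hspace"
  have "isCont (coshd p) p" using continuous_on_ch[OF p] p open_hspace continuous_on_eq_continuous_at by blast
  then have c: "coshd p \<midarrow>p\<rightarrow> 1" by (simp add: isCont_def)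
  have "((\<lambda>q. sqrt (4 * (snd (f p))\<^sup>2 * (coshd p q * (coshd p q - 1)))) \<longlongrightarrow> sqrt (4 * (snd (f p))\<^sup>2 * (1 * (1 - 1)))) (at p)"
    by (intro tendsto_intros c)
  then have l: "((\<lambda>q. sqrt (4 * (snd (f p))\<^sup>2 * (coshd p q * (coshd p q - 1)))) \<longlongrightarrow> 0) (at p)" by simp
  have ev: "\<forall>\<^sub>F q in at p. dist (f q) (f p) \<le> sqrt (4 * (snd (f p))\<^sup>2 * (coshd p q * (coshd p q - 1)))"
  proof -
    have "\<forall>\<^sub>F q in at p. q \<in> hspace" using open_hspace p by (rule eventually_at_in_open')
    then show ?thesis
    proof eventually_elim
      case (elim q)
      have "(dist (f p) (f q))\<^sup>2 \<le> 4 * (snd (f p))\<^sup>2 * (coshd p q * (coshd p q - 1))"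
        using dist_le_ch[of "f p" "f q"] f p elim by (simp add: hyp_isom_in hyp_isom_ch)
      then show ?case by (simp add: dist_commute real_le_rsqrt)
    qed
  qed
  have "((\<lambda>q. dist (f q) (f p)) \<longlongrightarrow> 0) (at p)"
    by (rule tendsto_sandwich[OF _ ev tendsto_const l]) simp
  then show "isCont f p" unfolding isCont_def using tendsto_dist_iff by blast
qed

lemma isom_groupD:
  assumes "isom_group \<Gamma>"
  shows "f \<in> \<Gamma> \<Longrightarrow> hyp_isom f" "id \<in> \<Gamma>" "f \<in> \<Gamma> \<Longrightarrow> g \<in> \<Gamma> \<Longrightarrow> f \<circ> g \<in> \<Gamma>" "f \<in> \<Gamma> \<Longrightarrow> inv f \<in> \<Gamma>"
  using assms by (auto simp: isom_group_def)

text \<open>The form in which absence of torsion enters the geometry: deduced from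
  \<open>torsion_free\<close> for a general group, and proved directly from matrices for the
  Gieseking group.\<close>

definition acts_freely :: "('a::euclidean_space \<times> real \<Rightarrow> 'a \<times> real) set \<Rightarrow> bool" where
  "acts_freely \<Gamma> \<longleftrightarrow> (\<forall>\<gamma>\<in>\<Gamma>. \<forall>p\<in>hspace. \<gamma> p = p \<longrightarrow> \<gamma> = id)"

text \<open>Discreteness makes the stabilizer of a point finite, so the powers of an element fixing
  a point repeat and the element has finite order.\<close>

lemma torsion_free_imp_acts_freely:
  assumes G: "isom_group \<Gamma>" and D: "discrete_group \<Gamma>" and T: "torsion_free \<Gamma>"
  shows "acts_freely \<Gamma>"
  unfolding acts_freely_def
proof (intro ballI impI)
  fix \<gamma> p assume g: "\<gamma> \<in> \<Gamma>" and p: "p \<in> hspace" and fx: "\<gamma> p = p"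
  have pw: "\<gamma> ^^ k \<in> \<Gamma>" for k
    by (induction k) (simp_all only: funpow.simps isom_groupD(2,3)[OF G] g)
  have fp: "(\<gamma> ^^ k) p = p" for k by (induction k) (auto simp: fx)
  have bij: "bij \<gamma>" using G g by (intro hyp_isom_bij isom_groupD(1))
  have "finite {\<gamma>\<in>\<Gamma>. hdist p (\<gamma> p) \<le> 0}" using D p by (simp add: discrete_group_def)
  then have "finite (range (\<lambda>k. \<gamma> ^^ k))"
    by (rule rev_finite_subset) (use pw fp p hdist_eq_0_iff[OF p p] in auto)
  then have "\<not> inj (\<lambda>k. \<gamma> ^^ k)" using finite_imageD infinite_UNIV_nat by blast
  then obtain i j where ij: "i < j" "\<gamma> ^^ i = \<gamma> ^^ j"
    by (auto simp: inj_def) (metis linorder_neqE_nat)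
  have "\<gamma> ^^ (j - i) = id"
  proof
    fix x
    have "(\<gamma> ^^ i) ((\<gamma> ^^ (j - i)) x) = (\<gamma> ^^ i) x"
      using ij by (metis comp_apply funpow_add less_imp_le_nat le_add_diff_inverse)
    moreover have "inj (\<gamma> ^^ i)" using bij by (simp add: bij_is_inj inj_fn)
    ultimately show "(\<gamma> ^^ (j - i)) x = id x" by (simp add: inj_eq)
  qed
  moreover have "j - i > 0" using ij by simp
  ultimately show "\<gamma> = id" using T g unfolding torsion_free_def by blast
qed

section \<open>Embedded balls and displacements\<close>

definition embedded_radii :: "('a::euclidean_space \<times> real \<Rightarrow> 'a \<times> real) set \<Rightarrow> 'a \<times> real \<Rightarrow> real set" where
  "embedded_radii \<Gamma> p = {r. r > 0 \<and> (\<forall>\<gamma>\<in>\<Gamma>. \<gamma> \<noteq> id \<longrightarrow> \<gamma> ` hball p r \<inter> hball p r = {})}"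

lemma r_inj_eq: "r_inj \<Gamma> p = Sup (embedded_radii \<Gamma> p)"
  by (simp add: r_inj_def embedded_radii_def)

lemma embedded_radiiI:
  assumes G: "isom_group \<Gamma>" and p: "p \<in> hspace" and r: "r > 0"
    and d: "\<And>\<gamma>. \<gamma> \<in> \<Gamma> \<Longrightarrow> \<gamma> \<noteq> id \<Longrightarrow> hdist p (\<gamma> p) \<ge> 2 * r"
  shows "r \<in> embedded_radii \<Gamma> p"
proof -
  have False if g: "\<gamma> \<in> \<Gamma>" "\<gamma> \<noteq> id" and x: "x \<in> \<gamma> ` hball p r" "x \<in> hball p r" for \<gamma> x
  proof -
    have i: "hyp_isom \<gamma>" using G g isom_groupD by blast
    have gp: "\<gamma> p \<in> hspace" using i p by (rule hyp_isom_in)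
    have "x \<in> hspace" "hdist (\<gamma> p) x < r" "hdist p x < r"
      using x hyp_isom_hball[OF i p] by (auto simp: hball_def)
    then show False
      using hdist_triangle[OF p _ gp, of x] d[OF g] by (simp add: hdist_commute)
  qed
  then show ?thesis using r by (auto simp: embedded_radii_def)
qed

lemma cosh_2_rho: "cosh (2 * arcosh (sqrt 5 / 2)) = (3/2 :: real)"
proof -
  have "sqrt 5 / 2 \<ge> (1::real)" by (simp add: real_le_rsqrt)
  then show ?thesis by (simp add: cosh_double_cosh power_divide)
qed

lemma rho_pos: "arcosh (sqrt 5 / 2) > (0::real)"
proof -
  have "sqrt 5 / 2 > (1::real)" by (simp add: real_less_rsqrt)
  then show ?thesis by (simp add: arcosh_real_gt_1_iff)
qed

lemma rho_in_embedded_radii: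
  assumes G: "isom_group \<Gamma>" and p: "p \<in> hspace"
    and d: "\<And>\<gamma>. \<gamma> \<in> \<Gamma> \<Longrightarrow> \<gamma> \<noteq> id \<Longrightarrow> coshd p (\<gamma> p) \<ge> 3/2"
  shows "arcosh (sqrt 5 / 2) \<in> embedded_radii \<Gamma> p"
proof (rule embedded_radiiI[OF G p rho_pos])
  fix \<gamma> assume g: "\<gamma> \<in> \<Gamma>" "\<gamma> \<noteq> id"
  have gp: "\<gamma> p \<in> hspace" using G g p isom_groupD hyp_isom_in by blast
  have "\<not> hdist p (\<gamma> p) < 2 * arcosh (sqrt 5 / 2)"
    using d[OF g] rho_pos hdist_less_iff[OF p gp, of "2 * arcosh (sqrt 5 / 2)"]
    unfolding cosh_2_rho by linarith
  then show "2 * arcosh (sqrt 5 / 2) \<le> hdist p (\<gamma> p)" by simp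
qed

text \<open>A ball with radius above half the displacement contains the midpoint of \<open>p\<close>
  and \<open>\<gamma> p\<close>, and so does its image. The half-argument formula for cosh turns 3/2
  into \<open>sqrt 5 / 2\<close>.\<close>

lemma embedded_radii_le_rho:
  assumes G: "isom_group \<Gamma>" and p: "p \<in> hspace" and g: "\<gamma> \<in> \<Gamma>" "\<gamma> \<noteq> id"
    and d: "coshd p (\<gamma> p) \<le> 3/2" and r: "r \<in> embedded_radii \<Gamma> p"
  shows "r \<le> arcosh (sqrt 5 / 2)"
proof (rule ccontr)
  assume "\<not> ?thesis"
  then have lt: "arcosh (sqrt 5 / 2) < r" by simp
  have i: "hyp_isom \<gamma>" using G g isom_groupD by blast
  have gp: "\<gamma> p \<in> hspace" using i p by (rule hyp_isom_in)
  obtain m where m: "m \<in> hspace" "coshd p m = sqrt ((1 + coshd p (\<gamma> p)) / 2)" "coshd (\<gamma> p) m = sqrt ((1 + coshd p (\<gamma> p)) / 2)"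
    using hyperbolic_midpoint[OF p gp] .
  have s: "sqrt 5 / 2 \<ge> (1::real)" by (simp add: real_le_rsqrt)
  have "sqrt ((1 + coshd p (\<gamma> p)) / 2) \<le> sqrt (5 / 4)" using d by simp
  also have "\<dots> = sqrt 5 / 2" by (simp add: real_sqrt_divide)
  also have "\<dots> = cosh (arcosh (sqrt 5 / 2))" using s by simp
  finally have "coshd p m \<le> cosh (arcosh (sqrt 5 / 2))" "coshd (\<gamma> p) m \<le> cosh (arcosh (sqrt 5 / 2))"
    using m by simp_all
  then have "hdist p m \<le> arcosh (sqrt 5 / 2)" "hdist (\<gamma> p) m \<le> arcosh (sqrt 5 / 2)"
    using p gp m(1) rho_pos by (simp_all add: hdist_le_iff)
  then have "m \<in> hball p r" "m \<in> \<gamma> ` hball p r"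
    using lt m(1) hyp_isom_hball[OF i p] by (auto simp: hball_def)
  then show False using r g by (auto simp: embedded_radii_def)
qed

text \<open>Needed because \<open>Sup\<close> of an empty set of reals carries no information.
  Discreteness leaves finitely many displacements at most 1; inserting 1 into \<open>S\<close>
  covers the larger ones and keeps \<open>Min\<close> defined.\<close>

lemma embedded_radii_nonempty:
  assumes G: "isom_group \<Gamma>" and D: "discrete_group \<Gamma>" and F: "acts_freely \<Gamma>" and p: "p \<in> hspace"
  shows "embedded_radii \<Gamma> p \<noteq> {}"
proof -
  define S where "S = (\<lambda>\<gamma>. hdist p (\<gamma> p)) ` {\<gamma>\<in>\<Gamma> - {id}. hdist p (\<gamma> p) \<le> 1}"
  have "finite {\<gamma>\<in>\<Gamma> - {id}. hdist p (\<gamma> p) \<le> 1}"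
    by (rule finite_subset[of _ "{\<gamma>\<in>\<Gamma>. hdist p (\<gamma> p) \<le> 1}"]) (use D p in \<open>auto simp: discrete_group_def\<close>)
  then have fin: "finite (insert 1 S)" by (simp add: S_def)
  define r where "r = Min (insert 1 S) / 2"
  have gp: "\<gamma> p \<in> hspace" if "\<gamma> \<in> \<Gamma>" for \<gamma> using that G p isom_groupD hyp_isom_in by blast
  have pos: "hdist p (\<gamma> p) > 0" if "\<gamma> \<in> \<Gamma>" "\<gamma> \<noteq> id" for \<gamma>
    using F that p gp[OF that(1)] hdist_nonneg[OF p gp[OF that(1)]] hdist_eq_0_iff[OF p gp[OF that(1)]]
    unfolding acts_freely_def by fastforce
  have "r > 0" unfolding r_def using fin pos by (subst half_gt_zero_iff, subst Min_gr_iff) (auto simp: S_def)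
  moreover have "hdist p (\<gamma> p) \<ge> 2 * r" if "\<gamma> \<in> \<Gamma>" "\<gamma> \<noteq> id" for \<gamma>
  proof (cases "hdist p (\<gamma> p) \<le> 1")
    case True
    then have "hdist p (\<gamma> p) \<in> insert 1 S" using that by (auto simp: S_def)
    then show ?thesis using fin by (simp add: r_def)
  next
    case False
    have "2 * r \<le> 1" using fin by (simp add: r_def)
    then show ?thesis using False by simp
  qed
  ultimately show ?thesis using embedded_radiiI[OF G p] by blast
qed

section \<open>Horoballs and their points of tangency\<close>

text \<open>Inversion in the unit sphere about the boundary point \<open>a\<close>. It exchanges
  \<open>a\<close> with infinity and so reduces horoballs to half-spaces; outside the upper
  half-space it is the identity, as \<open>hyp_isom\<close> demands.\<close>

definition inversion :: "'a::euclidean_space \<Rightarrow> 'a \<times> real \<Rightarrow> 'a \<times> real" where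
  "inversion a p = (if snd p > 0 then (let N = (norm (fst p - a))\<^sup>2 + (snd p)\<^sup>2
     in (a + inverse N *\<^sub>R (fst p - a), snd p / N)) else p)"

lemma inversion_props:
  fixes a :: "'a::euclidean_space"
  assumes p: "p \<in> hspace"
  defines "N \<equiv> (norm (fst p - a))\<^sup>2 + (snd p)\<^sup>2"
  shows "N > 0" "fst (inversion a p) - a = inverse N *\<^sub>R (fst p - a)" "snd (inversion a p) = snd p / N"
    "inversion a p \<in> hspace" "(norm (fst (inversion a p) - a))\<^sup>2 + (snd (inversion a p))\<^sup>2 = inverse N"
proof -
  have t: "snd p > 0" using p by (simp add: hspace_def)
  show N: "N > 0" using t by (auto simp: N_def intro!: add_nonneg_pos)
  show 1: "fst (inversion a p) - a = inverse N *\<^sub>R (fst p - a)" and 2: "snd (inversion a p) = snd p / N"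
    using t by (simp_all add: inversion_def Let_def N_def)
  show "inversion a p \<in> hspace" using t N 2 by (simp add: hspace_def)
  have "(norm (fst (inversion a p) - a))\<^sup>2 + (snd (inversion a p))\<^sup>2
      = (norm (fst p - a))\<^sup>2 / N\<^sup>2 + (snd p)\<^sup>2 / N\<^sup>2"
    unfolding 1 2 using N by (simp add: power_mult_distrib power_divide divide_inverse mult.commute power_inverse)
  also have "\<dots> = N / N\<^sup>2" unfolding N_def by (rule add_divide_distrib[symmetric])
  also have "\<dots> = inverse N" using N by (simp add: power2_eq_square divide_inverse)
  finally show "(norm (fst (inversion a p) - a))\<^sup>2 + (snd (inversion a p))\<^sup>2 = inverse N" .
qed

lemma inversion_involution: assumes p: "p \<in> hspace" shows "inversion a (inversion a p) = p"
proof -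
  note P = inversion_props[OF p, of a]
  note Q = inversion_props[OF P(4), of a]
  define N where "N = (norm (fst p - a))\<^sup>2 + (snd p)\<^sup>2"
  have N: "N > 0" using P(1) by (simp add: N_def)
  have "fst (inversion a (inversion a p)) - a = fst p - a"
    unfolding Q(2)[unfolded P(5)] P(2) N_def[symmetric] using N by simp
  moreover have "snd (inversion a (inversion a p)) = snd p"
    unfolding Q(3)[unfolded P(5)] P(3) N_def[symmetric] using N by simp
  ultimately show ?thesis by (simp add: prod_eq_iff)
qed

lemma inversion_norm:
  fixes u v :: "'a::real_inner"
  assumes "M > 0" "N > 0"
  shows "(norm (inverse M *\<^sub>R u - inverse N *\<^sub>R v))\<^sup>2 * (M * N)
    = (norm (u - v))\<^sup>2 + (norm u)\<^sup>2 * (N / M - 1) + (norm v)\<^sup>2 * (M / N - 1)"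
proof -
  have 1: "(norm (inverse M *\<^sub>R u - inverse N *\<^sub>R v))\<^sup>2
      = (norm u)\<^sup>2 / M\<^sup>2 - 2 * (u \<bullet> v) / (M * N) + (norm v)\<^sup>2 / N\<^sup>2"
    using assms by (simp only: power2_norm_eq_inner inner_diff_left inner_diff_right inner_commute[of v u]
        inner_scaleR_left inner_scaleR_right) (simp add: divide_simps power2_eq_square algebra_simps)
  have 2: "(norm (u - v))\<^sup>2 = (norm u)\<^sup>2 - 2 * (u \<bullet> v) + (norm v)\<^sup>2"
    by (simp add: power2_norm_eq_inner inner_diff_left inner_diff_right inner_commute[of v u])
  show ?thesis unfolding 1 2 using assms
    by (simp add: divide_simps power2_eq_square) (simp add: algebra_simps)
qed

lemma inversion_ch:
  assumes p: "p \<in> hspace" and q: "q \<in> hspace"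
  shows "coshd (inversion a p) (inversion a q) = coshd p q"
proof -
  note P = inversion_props[OF p, of a] and Q = inversion_props[OF q, of a]
  define M N where "M = (norm (fst p - a))\<^sup>2 + (snd p)\<^sup>2" and "N = (norm (fst q - a))\<^sup>2 + (snd q)\<^sup>2"
  have MN: "M > 0" "N > 0" using P(1) Q(1) by (auto simp: M_def N_def)
  have t: "snd p > 0" "snd q > 0" using p q by (auto simp: hspace_def)
  have d: "fst (inversion a p) - fst (inversion a q) = inverse M *\<^sub>R (fst p - a) - inverse N *\<^sub>R (fst q - a)"
    using P(2) Q(2) unfolding M_def N_def by (metis add_diff_cancel_left' diff_add_cancel diff_diff_eq2 diff_right_commute)
  have n: "(norm (fst (inversion a p) - fst (inversion a q)))\<^sup>2 * (M * N)
      = (norm (fst p - fst q))\<^sup>2 + (M - (snd p)\<^sup>2) * (N / M - 1) + (N - (snd q)\<^sup>2) * (M / N - 1)"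
    unfolding d inversion_norm[OF MN] by (simp add: M_def N_def)
  define z where "z = (norm (fst (inversion a p) - fst (inversion a q)))\<^sup>2"
  have n': "(norm (fst p - fst q))\<^sup>2 = z * (M * N) - (M - (snd p)\<^sup>2) * (N / M - 1) - (N - (snd q)\<^sup>2) * (M / N - 1)"
    using n by (simp add: z_def)
  have s: "snd (inversion a p) = snd p / M" "snd (inversion a q) = snd q / N"
    using P(3) Q(3) by (auto simp: M_def N_def)
  have *: "(z + (x / M)\<^sup>2 + (y / N)\<^sup>2) / (2 * (x / M) * (y / N))
     = (z * (M * N) - (M - x\<^sup>2) * (N / M - 1) - (N - y\<^sup>2) * (M / N - 1) + x\<^sup>2 + y\<^sup>2) / (2 * x * y)"
    if "x > 0" "y > 0" for x y :: real
    using that MN by (simp add: divide_simps power2_eq_square) (simp add: algebra_simps)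
  show ?thesis
    using coshd_eq[of "inversion a p" "inversion a q"] coshd_eq[of p q] t MN *[OF t] P(4) Q(4)
    by (simp add: s z_def[symmetric] n' hspace_def)
qed

lemma hyp_isom_inversion: "hyp_isom (inversion a)"
  by (rule hyp_isomI[where g = "inversion a"])
    (auto simp: inversion_props(4) inversion_involution inversion_ch, auto simp: hspace_def inversion_def)

text \<open>The exponential of the Busemann function that is \<open>0\<close> on the horosphere at \<open>x\<close> with parameter \<open>r\<close>.\<close>
fun hfun :: "'a::euclidean_space option \<Rightarrow> real \<Rightarrow> 'a \<times> real \<Rightarrow> real" where
  "hfun None r p = r / snd p"
| "hfun (Some a) r p = ((norm (fst p - a))\<^sup>2 + (snd p)\<^sup>2) / (2 * r * snd p)"

definition hball_at :: "'a::euclidean_space option \<Rightarrow> real \<Rightarrow> ('a \<times> real) set" where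
  "hball_at x r = {p \<in> hspace. hfun x r p < 1}"

lemma horoball_hball_at: "horoball x B \<longleftrightarrow> (\<exists>r>0. B = hball_at x r)"
proof (cases x)
  case None
  have "{p. snd p > t} = hball_at None t" if "t > 0" for t :: real
    using that by (force simp: hball_at_def hspace_def divide_less_eq)
  then show ?thesis using None by (auto simp: horoball_def)
next
  case (Some a)
  have "{p. snd p > 0 \<and> dist p (a, r) < r} = hball_at (Some a) r" if r: "r > 0" for r :: real
  proof -
    have "dist p (a, r) < r \<longleftrightarrow> (norm (fst p - a))\<^sup>2 + (snd p)\<^sup>2 < 2 * r * snd p" for p :: "'a \<times> real"
    proof -
      have "dist p (a, r) < r \<longleftrightarrow> (dist p (a, r))\<^sup>2 < r\<^sup>2"
        using r by (simp add: power_mono_iff flip: not_le)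
      also have "(dist p (a, r))\<^sup>2 = (norm (fst p - a))\<^sup>2 + (snd p - r)\<^sup>2"
        by (simp add: dist_prod_def dist_norm)
      finally show ?thesis by (simp add: power2_eq_square algebra_simps)
    qed
    then show ?thesis using r by (auto simp: hball_at_def hspace_def divide_less_eq mult_less_0_iff)
  qed
  then show ?thesis using Some by (auto simp: horoball_def)
qed

text \<open>The top \<open>(a, 2 * r)\<close> of the horosphere is sent to height
  \<open>1 / (2 * r)\<close>, which explains the new parameter.\<close>

lemma hfun_inversion:
  assumes "p \<in> hspace"
  shows "hfun (Some a) r p = hfun None (1 / (2 * r)) (inversion a p)"
    and "hfun None r p = hfun (Some a) (1 / (2 * r)) (inversion a p)"
proof -
  note P = inversion_props[OF assms, of a]
  show "hfun (Some a) r p = hfun None (1 / (2 * r)) (inversion a p)"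
    using P(1) by (simp add: P(3) field_simps)
  have "snd p > 0" using assms by (simp add: hspace_def)
  then show "hfun None r p = hfun (Some a) (1 / (2 * r)) (inversion a p)"

  proof -
    have "r / t = inverse N / (2 * (1 / (2 * r)) * (t / N))" if "N > 0" "t > 0" for N t :: real
      using that by (cases "r = 0") (simp_all add: field_simps)
    from this[OF P(1) \<open>snd p > 0\<close>] show ?thesis by (simp only: hfun.simps P(5)) (simp only: P(3))
  qed
qed

text \<open>The power of \<open>a\<close> with respect to the sphere tangent at \<open>b\<close> is
  \<open>c\<close>, so inversion divides its radius by \<open>c\<close>.\<close>

lemma hfun_inversion_other:
  fixes a b :: "'a::euclidean_space"
  assumes p: "p \<in> hspace" and ab: "a \<noteq> b"
  defines "c \<equiv> (norm (b - a))\<^sup>2"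
  shows "hfun (Some b) r (inversion a p) = hfun (Some (a + inverse c *\<^sub>R (b - a))) (r / c) p"
proof -
  note P = inversion_props[OF p, of a]
  define N where "N = (norm (fst p - a))\<^sup>2 + (snd p)\<^sup>2"
  have N: "N > 0" using P(1) by (simp add: N_def)
  have c: "c > 0" using ab by (simp add: c_def)
  define u where "u = fst p - a" define v where "v = b - a"
  have nu: "(norm u)\<^sup>2 = N - (snd p)\<^sup>2" and nv: "(norm v)\<^sup>2 = c"
    by (simp_all add: N_def u_def c_def v_def)
  have 1: "fst (inversion a p) - b = inverse N *\<^sub>R u - v"
    using P(2) unfolding N_def u_def v_def by (metis diff_diff_eq2 diff_add_cancel)
  have 2: "fst p - (a + inverse c *\<^sub>R (b - a)) = u - inverse c *\<^sub>R v"
    by (simp add: u_def v_def)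
  have i1: "(norm (inverse N *\<^sub>R u - v))\<^sup>2 = (norm u)\<^sup>2 / N\<^sup>2 - 2 * (u \<bullet> v) / N + (norm v)\<^sup>2"
    using N by (simp only: power2_norm_eq_inner inner_diff_left inner_diff_right inner_commute[of v u]
        inner_scaleR_left inner_scaleR_right) (simp add: divide_simps power2_eq_square algebra_simps)
  have i2: "(norm (u - inverse c *\<^sub>R v))\<^sup>2 = (norm u)\<^sup>2 - 2 * (u \<bullet> v) / c + (norm v)\<^sup>2 / c\<^sup>2"
    using c by (simp only: power2_norm_eq_inner inner_diff_left inner_diff_right inner_commute[of v u]
        inner_scaleR_left inner_scaleR_right) (simp add: divide_simps power2_eq_square algebra_simps)
  have t: "snd p > 0" using p by (simp add: hspace_def)
  have "((N - t\<^sup>2) / N\<^sup>2 - 2 * w / N + c + (t / N)\<^sup>2) / (2 * r * (t / N))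
      = (N - t\<^sup>2 - 2 * w / c + c / c\<^sup>2 + t\<^sup>2) / (2 * (r / c) * t)" if "t > 0" for t w :: real
    using N c that by (cases "r = 0") (simp_all add: divide_simps power2_eq_square, simp_all add: algebra_simps)
  then show ?thesis
    using t unfolding hfun.simps 1 2 i1 i2 nu nv P(3)[folded N_def] by blast
qed


text \<open>Treats both kinds of base point uniformly: up to an involutive isometry, every horoball
  is a half-space above height \<open>T\<close>.\<close>

lemma hfun_reduce:
  assumes r: "r > 0"
  obtains \<iota> T where "hyp_isom \<iota>" "T > 0" "\<And>p. p \<in> hspace \<Longrightarrow> \<iota> (\<iota> p) = p"
    "\<And>p. p \<in> hspace \<Longrightarrow> hfun x r p = T / snd (\<iota> p)"
proof (cases x)
  case None
  show ?thesis by (rule that[of id r]) (use None r in \<open>auto simp: hyp_isom_id\<close>)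
next
  case (Some a)
  show ?thesis
  proof (rule that[of "inversion a" "1 / (2 * r)"])
    show "hfun x r p = 1 / (2 * r) / snd (inversion a p)" if "p \<in> hspace" for p
      using hfun_inversion(1)[OF that, of a r] by (simp add: Some)
  qed (use r in \<open>auto simp: hyp_isom_inversion inversion_involution\<close>)
qed

lemma continuous_on_hfun: "r > 0 \<Longrightarrow> continuous_on hspace (hfun x r)"
  unfolding hspace_def
  by (cases x) (auto intro!: continuous_intros)

lemma open_hball_at: "r > 0 \<Longrightarrow> open (hball_at x r)"
  unfolding hball_at_def
  using continuous_open_preimage[OF continuous_on_hfun open_hspace open_lessThan[of 1], of r x]
  by (simp add: vimage_def Int_def conj_commute)

lemma closure_hball_at:
  assumes r: "r > 0" and p: "p \<in> closure (hball_at x r)" "p \<in> hspace"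
  shows "hfun x r p \<le> 1"
proof (rule ccontr)
  assume "\<not> ?thesis"
  then have "p \<in> hspace \<inter> hfun x r -` {1<..}" using p by simp
  moreover have "open (hspace \<inter> hfun x r -` {1<..})"
    using continuous_open_preimage[OF continuous_on_hfun[OF r] open_hspace open_greaterThan] .
  ultimately obtain q where "q \<in> hball_at x r" "q \<in> hspace \<inter> hfun x r -` {1<..}"
    using p(1) by (meson Int_iff closure_iff_nhds_not_empty disjoint_iff order_refl)
  then show False by (simp add: hball_at_def)
qed

lemma hdist_vertical:
  assumes "t > 0"
  shows "hdist (x, t) (x, t * exp s) = \<bar>s\<bar>"
proof -
  have "coshd (x, t) (x, t * exp s) = cosh s"
  proof -
    have "exp s * exp (-s) = 1" by (simp add: exp_minus)
    then show ?thesis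
      using assms by (simp add: coshd_eq cosh_field_def power_mult_distrib power2_eq_square exp_minus field_simps)
  qed
  then show ?thesis unfolding hdist_ch by (metis abs_ge_zero arcosh_cosh_real cosh_real_abs)
qed

text \<open>Moving a distance \<sigma> towards the base point divides \<open>hfun\<close> by
  \<open>exp \<sigma>\<close>. With a smaller value at the centre, a point of the ball would already
  lie in the horoball.\<close>

lemma hfun_ge_exp:
  assumes r: "r > 0" and c: "c \<in> hspace" and s: "s > 0" and disj: "hball c s \<inter> hball_at x r = {}"
  shows "hfun x r c \<ge> exp s"
proof (rule ccontr)
  obtain \<iota> T where i: "hyp_isom \<iota>" "T > 0" "\<And>p. p \<in> hspace \<Longrightarrow> \<iota> (\<iota> p) = p"
    "\<And>p. p \<in> hspace \<Longrightarrow> hfun x r p = T / snd (\<iota> p)"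
    using hfun_reduce[OF r] by metis
  assume "\<not> ?thesis"
  define d where "d = \<iota> c"
  have d: "d \<in> hspace" using i c by (simp add: d_def hyp_isom_in)
  then have d0: "snd d > 0" by (simp add: hspace_def)
  have "T / snd d < exp s" using \<open>\<not> _\<close> i(4)[OF c] by (simp add: d_def)
  moreover have T: "T / snd d > 0" using i d0 by simp
  ultimately have l: "ln (T / snd d) < s" by (metis exp_gt_zero ln_exp ln_less_cancel_iff)
  \<comment> \<open>Strictly between the distance from \<open>d\<close> to the horosphere and the
    radius \<open>s\<close>; the maximum with 0 covers a centre inside the horoball.\<close>
  define \<sigma> where "\<sigma> = (max (ln (T / snd d)) 0 + s) / 2"
  have \<sigma>: "0 < \<sigma>" "\<sigma> < s" "ln (T / snd d) < \<sigma>" using l s by (auto simp: \<sigma>_def)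
  define y where "y = (fst d, snd d * exp \<sigma>)"
  have y: "y \<in> hspace" using d0 by (simp add: y_def hspace_def)
  then have iy: "\<iota> y \<in> hspace" using i(1) by (simp add: hyp_isom_in)
  have "hdist d y = \<sigma>" using hdist_vertical[OF d0, of "fst d" \<sigma>] \<sigma>(1) by (simp add: y_def)
  then have "hdist c (\<iota> y) = \<sigma>"
    using hyp_isom_hdist[OF i(1) d y] i(3)[OF c] by (simp add: d_def)
  then have "\<iota> y \<in> hball c s" using iy \<sigma>(2) by (simp add: hball_def)
  moreover have "T / snd d < exp \<sigma>" using \<sigma>(3) T by (metis exp_less_cancel_iff exp_ln)
  then have "hfun x r (\<iota> y) < 1"
    using i(4)[OF iy] i(3)[OF y] d0 i(2) by (simp add: y_def divide_less_eq mult.commute)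
  then have "\<iota> y \<in> hball_at x r" using iy by (simp add: hball_at_def)
  ultimately show False using disj by blast
qed

text \<open>The Busemann function as a limit of distances: the horoball is filled by balls of radius
  \<open>s\<close>, and \<open>2 * exp (- s) * coshd\<close> behaves like the exponential of
  distance minus radius.\<close>

lemma hball_at_exhaustion:
  assumes r: "r > 0" and q: "q \<in> hspace"
  obtains c where "\<forall>s>0. c s \<in> hspace \<and> hball (c s) s \<subseteq> hball_at x r"
    "((\<lambda>s. 2 * exp (- s) * coshd (c s) q) \<longlongrightarrow> hfun x r q) at_top"
proof -
  obtain \<iota> T where i: "hyp_isom \<iota>" "T > 0" "\<And>p. p \<in> hspace \<Longrightarrow> \<iota> (\<iota> p) = p"
    "\<And>p. p \<in> hspace \<Longrightarrow> hfun x r p = T / snd (\<iota> p)"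
    using hfun_reduce[OF r] by metis
  \<comment> \<open>This point lies at distance \<open>s\<close> above the horosphere of height
    \<open>T\<close>, so the ball of radius \<open>s\<close> just touches it.\<close>
  define d where "d = (\<lambda>s. (0 :: 'a, T * exp s))"
  have d: "d s \<in> hspace" for s using i by (simp add: d_def hspace_def)
  have iq: "\<iota> q \<in> hspace" using i q by (simp add: hyp_isom_in)
  show ?thesis
  proof (rule that[of "\<lambda>s. \<iota> (d s)"], intro allI impI)
    fix s :: real assume s: "s > 0"
    have "y \<in> hball_at x r" if "y \<in> hball (\<iota> (d s)) s" for y
    proof -
      have y: "y \<in> hspace" "hdist (\<iota> (d s)) y < s" using that by (auto simp: hball_def)
      have iy: "\<iota> y \<in> hspace" using i y by (simp add: hyp_isom_in)
      then have t: "snd (\<iota> y) > 0" by (simp add: hspace_def)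
      have "hdist (d s) (\<iota> y) < s"
        using hyp_isom_hdist[OF i(1) d iy, of s] i(3)[OF y(1)] y(2) by simp
      then have "coshd (d s) (\<iota> y) < cosh s" using s d iy by (simp add: hdist_less_iff)
      moreover have "coshd (d s) (\<iota> y) \<ge> ((T * exp s)\<^sup>2 + (snd (\<iota> y))\<^sup>2) / (2 * (T * exp s) * snd (\<iota> y))"
        using t i(2) by (subst coshd_eq) (auto simp: d_def intro!: divide_right_mono)
      ultimately have "((T * exp s)\<^sup>2 + (snd (\<iota> y))\<^sup>2) / (2 * (T * exp s) * snd (\<iota> y)) < (exp s + inverse (exp s)) / 2"
        unfolding cosh_field_def exp_minus by linarith
      then have "(T * exp s)\<^sup>2 + (snd (\<iota> y))\<^sup>2 < (exp s + inverse (exp s)) * ((T * exp s) * snd (\<iota> y))"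
        using t i(2) by (simp add: divide_less_eq field_simps)
      also have "\<dots> = T * snd (\<iota> y) * ((exp s)\<^sup>2 + 1)"
        by (simp add: algebra_simps power2_eq_square)
      \<comment> \<open>The ball occupies heights strictly between \<open>T\<close> and
        \<open>T * (exp s)\<^sup>2\<close>, the two roots of this quadratic.\<close>
      finally have "(T - snd (\<iota> y)) * (T * (exp s)\<^sup>2 - snd (\<iota> y)) < 0"
        by (simp add: power2_eq_square algebra_simps)
      moreover have "1 * T \<le> (exp s)\<^sup>2 * T" using i(2) s by (intro mult_right_mono) (auto simp: one_le_power)
      ultimately have "T < snd (\<iota> y)"
        by (smt (verit) mult.commute mult_nonneg_nonneg)
      then show ?thesis using y i(4)[OF y(1)] t by (simp add: hball_at_def)
    qed
    then show "\<iota> (d s) \<in> hspace \<and> hball (\<iota> (d s)) s \<subseteq> hball_at x r"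
      using i d by (auto simp: hyp_isom_in)
  next
    define n t where "n = (norm (fst (\<iota> q)))\<^sup>2" and "t = snd (\<iota> q)"
    have t: "t > 0" using iq by (simp add: t_def hspace_def)
    have "2 * exp (- s) * coshd (\<iota> (d s)) q = T / t + (n + t\<^sup>2) / (T * t) * exp (- (2 * s))" for s
    proof -
      have "coshd (\<iota> (d s)) q = coshd (d s) (\<iota> q)"
        using hyp_isom_ch[OF i(1) d iq, of s] i(3)[OF q] by simp
      also have "\<dots> = (n + (T * exp s)\<^sup>2 + t\<^sup>2) / (2 * (T * exp s) * t)"
        using t i(2) unfolding t_def n_def by (subst coshd_eq) (simp_all add: d_def)
      finally have "2 * exp (- s) * coshd (\<iota> (d s)) q = 2 * exp (- s) * ((n + (T * exp s)\<^sup>2 + t\<^sup>2) / (2 * (T * exp s) * t))"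
        by simp
      also have "\<dots> = T / t + (n + t\<^sup>2) / (T * t) * inverse ((exp s)\<^sup>2)"
        using t i(2) by (simp add: exp_minus field_simps power2_eq_square)
      also have "inverse ((exp s)\<^sup>2) = exp (- (2 * s))"
        by (simp add: exp_minus exp_double)
      finally show ?thesis .
    qed
    moreover have "((\<lambda>s. T / t + (n + t\<^sup>2) / (T * t) * exp (- (2 * s))) \<longlongrightarrow> T / t + (n + t\<^sup>2) / (T * t) * 0) at_top"
      by (intro tendsto_intros filterlim_compose[OF exp_at_bot])
         (auto simp: filterlim_uminus_at_bot intro!: filterlim_tendsto_pos_mult_at_top[OF tendsto_const] filterlim_ident)
    ultimately show "((\<lambda>s. 2 * exp (- s) * coshd (\<iota> (d s)) q) \<longlongrightarrow> hfun x r q) at_top"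
      using i(4)[OF q] by (simp add: t_def)
  qed
qed

text \<open>Disjointness keeps the top of the finite horoball below the horizontal horosphere,
  \<open>2 * s \<le> r\<close>; a point in both closures gives the reverse. So \<open>p\<close> is
  the point above \<open>a\<close> at height \<open>r = 2 * s\<close>, and the identity is read off
  from \<open>coshd\<close>.\<close>

lemma tangent_None:
  assumes r: "r > 0" "s > 0" and p: "p \<in> hspace"
    and disj: "hball_at None r \<inter> hball_at y s = {}" and le: "hfun None r p \<le> 1" "hfun y s p \<le> 1"
    and q: "q \<in> hspace"
  shows "2 * coshd p q = hfun None r q + hfun y s q"
proof (cases y)
  case None
  have "(0, 2 * max r s) \<in> hball_at None r \<inter> hball_at y s"
    using r by (auto simp: None hball_at_def hspace_def)
  then show ?thesis using disj by simp
next
  case (Some a)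
  have "\<not> r < 2 * s"
  proof
    assume lt: "r < 2 * s"
    define t where "t = (r + 2 * s) / 2"
    have t: "r < t" "t < 2 * s" using lt by (auto simp: t_def)
    then have "t * t < 2 * s * t" using r by (intro mult_strict_right_mono) auto
    then have "(a, t) \<in> hball_at None r \<inter> hball_at y s"
      using t r by (auto simp: Some hball_at_def hspace_def divide_less_eq power2_eq_square)
    then show False using disj by simp
  qed
  define n t where "n = (norm (fst p - a))\<^sup>2" and "t = snd p"
  have t: "t > 0" using p by (simp add: t_def hspace_def)
  have n: "n \<ge> 0" by (simp add: n_def)
  have 1: "r \<le> t" using le(1) t by (simp add: t_def[symmetric])
  have "n + t\<^sup>2 \<le> 2 * s * t" using le(2) t r by (simp add: Some t_def[symmetric] n_def[symmetric])
  then have 2: "n + t * t \<le> 2 * s * t" by (simp add: power2_eq_square)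
  have 3: "2 * s * t \<le> r * t" using \<open>\<not> _\<close> t by simp
  have 4: "r * t \<le> t * t" using 1 t by simp
  have n0: "n = 0" using 2 3 4 n by linarith
  have "t * t = r * t" "t * t = (2 * s) * t" using 2 3 4 n by linarith+
  then have tt: "t = r" "t = 2 * s" using t by auto
  have a: "fst p = a" using n0 by (simp add: n_def)
  have "snd q > 0" using q by (simp add: hspace_def)
  then show ?thesis using tt r t
    by (simp add: Some coshd_eq t_def[symmetric] a norm_minus_commute[of a]) (simp add: field_simps power2_eq_square)
qed

text \<open>Inversion at the base point of the first horoball reduces to
  \<open>tangent_None\<close>. The second base point is infinity, another finite point, or the same
  point; in the last case the horoballs are nested and cannot be disjoint.\<close>

lemma tangent_hfun:
  assumes r: "r > 0" "s > 0" and p: "p \<in> hspace"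
    and disj: "hball_at x r \<inter> hball_at y s = {}" and le: "hfun x r p \<le> 1" "hfun y s p \<le> 1"
    and q: "q \<in> hspace"
  shows "2 * coshd p q = hfun x r q + hfun y s q"
proof (cases x)
  case None
  then show ?thesis using tangent_None assms by blast
next
  case x: (Some a)
  define \<iota> where "\<iota> = inversion a"
  have I: "\<iota> u \<in> hspace" "\<iota> (\<iota> u) = u" if "u \<in> hspace" for u
    using that by (auto simp: \<iota>_def inversion_props inversion_involution)
  obtain z u where z: "u > 0" "\<And>v. v \<in> hspace \<Longrightarrow> hfun y s (\<iota> v) = hfun z u v"
  proof (cases y)
    case None
    show ?thesis
      by (rule that[of "1 / (2 * s)" "Some a"])
        (use r hfun_inversion(2)[of "\<iota> _" s a] in \<open>auto simp: None I, auto simp: \<iota>_def inversion_props inversion_involution\<close>)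
  next
    case (Some b)
    show ?thesis
    proof (cases "a = b")
      case True
      define t where "t = min r s"
      have "t * t < 2 * r * t" "t * t < 2 * s * t" using r by (intro mult_strict_right_mono; auto simp: t_def)+
      then have "(a, t) \<in> hball_at x r \<inter> hball_at y s"
        using r by (auto simp: x Some True hball_at_def hspace_def divide_less_eq power2_eq_square t_def)
      then show ?thesis using disj by simp
    next
      case False
      show ?thesis
      proof (rule that)
        show "hfun y s (\<iota> v) = hfun (Some (a + inverse ((norm (b - a))\<^sup>2) *\<^sub>R (b - a))) (s / (norm (b - a))\<^sup>2) v"
          if "v \<in> hspace" for v
          using hfun_inversion_other[OF that False, of s] by (simp add: Some \<iota>_def)
      qed (use r False in simp)
    qed
  qed
  have X: "hfun x r (\<iota> v) = hfun None (1 / (2 * r)) v" if "v \<in> hspace" for v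
    using hfun_inversion(1)[of "\<iota> v" a r] that by (simp add: x I) (simp add: \<iota>_def inversion_involution)
  have "2 * coshd (\<iota> p) (\<iota> q) = hfun None (1 / (2 * r)) (\<iota> q) + hfun z u (\<iota> q)"
  proof (rule tangent_None)
    show "hball_at None (1 / (2 * r)) \<inter> hball_at z u = {}"
    proof -
      have "\<iota> v \<in> hball_at x r \<inter> hball_at y s" if "v \<in> hball_at None (1 / (2 * r)) \<inter> hball_at z u" for v
        using that I X z(2) by (auto simp: hball_at_def)
      then show ?thesis using disj by blast
    qed
    show "hfun None (1 / (2 * r)) (\<iota> p) \<le> 1" using X[of "\<iota> p"] I p le by simp
    show "hfun z u (\<iota> p) \<le> 1" using z(2)[of "\<iota> p"] I p le by simp
  qed (use I p q r z in auto)
  then show ?thesis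
    using X[of "\<iota> q"] z(2)[of "\<iota> q"] I p q by (simp add: \<iota>_def inversion_ch)
qed


text \<open>For each \<open>i\<close> the horoball \<open>\<gamma>\<^sup>-\<^sup>1 B\<^sub>i\<close> contains balls of radius \<open>s\<close> disjoint from
  \<open>B\<^sub>1\<close> and \<open>B\<^sub>2\<close>; letting \<open>s\<close> tend to infinity bounds the Busemann function of \<open>B\<^sub>i\<close> at \<open>\<gamma> p\<close>.\<close>
lemma hfun_image_ge_2:
  assumes g: "hyp_isom \<gamma>" and pos: "r > 0" "r1 > 0" "r2 > 0" and p: "p \<in> hspace"
    and tan: "\<And>q. q \<in> hspace \<Longrightarrow> 2 * coshd p q = hfun x1 r1 q + hfun x2 r2 q"
    and disj: "inv \<gamma> ` hball_at x r \<inter> hball_at x1 r1 = {}" "inv \<gamma> ` hball_at x r \<inter> hball_at x2 r2 = {}"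
  shows "hfun x r (\<gamma> p) \<ge> 2"
proof -
  have gp: "\<gamma> p \<in> hspace" using g p by (rule hyp_isom_in)
  have gi: "hyp_isom (inv \<gamma>)" using g by (rule hyp_isom_inv)
  obtain c where c': "\<forall>s>0. c s \<in> hspace \<and> hball (c s) s \<subseteq> hball_at x r"
    and lim: "((\<lambda>s. 2 * exp (- s) * coshd (c s) (\<gamma> p)) \<longlongrightarrow> hfun x r (\<gamma> p)) at_top"
    using hball_at_exhaustion[OF pos(1) gp, where x = x] by metis
  have c: "c s \<in> hspace" "hball (c s) s \<subseteq> hball_at x r" if "s > 0" for s
    using c' that by auto
  have ge: "2 \<le> 2 * exp (- s) * coshd (c s) (\<gamma> p)" if s: "s > 0" for s
  proof -
    define d where "d = inv \<gamma> (c s)"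
    have d: "d \<in> hspace" using c[OF s] gi by (simp add: d_def hyp_isom_in)
    have "hball d s \<subseteq> inv \<gamma> ` hball_at x r"
      using image_mono[OF c(2)[OF s], of "inv \<gamma>"] hyp_isom_hball[OF gi c(1)[OF s], of s] by (simp add: d_def)
    then have "hfun x1 r1 d \<ge> exp s" "hfun x2 r2 d \<ge> exp s"
      using disj by (auto intro!: hfun_ge_exp[OF pos(2) d s] hfun_ge_exp[OF pos(3) d s])
    then have "exp s \<le> coshd p d" using tan[OF d] by simp
    also have "coshd p d = coshd (c s) (\<gamma> p)"
      using hyp_isom_ch[OF g p d] g by (simp add: d_def coshd_commute)
    finally show ?thesis by (simp add: exp_minus field_simps)
  qed
  have "\<forall>\<^sub>F s in at_top. 2 \<le> 2 * exp (- s) * coshd (c s) (\<gamma> p)"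
    using eventually_gt_at_top[of "0::real"] by eventually_elim (rule ge)
  then show ?thesis by (rule tendsto_lowerbound[OF lim]) simp
qed

lemma preimage_in_H_invariant:
  assumes G: "isom_group \<Gamma>" and g: "\<gamma> \<in> \<Gamma>" and q: "q \<in> preimage_in_H \<Gamma> C"
  shows "\<gamma> q \<in> preimage_in_H \<Gamma> C"
proof -
  have i: "hyp_isom \<gamma>" using G g by (rule isom_groupD)
  have "orbit \<Gamma> (\<gamma> q) = orbit \<Gamma> q"
  proof
    show "orbit \<Gamma> (\<gamma> q) \<subseteq> orbit \<Gamma> q"
      using isom_groupD(3)[OF G _ g] by (auto simp: orbit_def intro!: image_eqI[of _ _ "_ \<circ> \<gamma>"])
    show "orbit \<Gamma> q \<subseteq> orbit \<Gamma> (\<gamma> q)"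
      using isom_groupD(3)[OF G _ isom_groupD(4)[OF G g]] i
      by (auto simp: orbit_def intro!: image_eqI[of _ _ "_ \<circ> inv \<gamma>"])
  qed
  then show ?thesis using q i by (simp add: preimage_in_H_def hyp_isom_in)
qed

lemma self_tangency_displacement:
  assumes G: "isom_group \<Gamma>" and F: "acts_freely \<Gamma>" and st: "self_tangency \<Gamma> C p"
    and g: "\<gamma> \<in> \<Gamma>" "\<gamma> \<noteq> id"
  shows "coshd p (\<gamma> p) \<ge> 3/2"
proof -
  define U where "U = preimage_in_H \<Gamma> C"
  have i: "hyp_isom \<gamma>" and gi: "hyp_isom (inv \<gamma>)" using isom_groupD[OF G] g by auto
  obtain B1 B2 x1 x2 where B: "B1 \<in> components U" "B2 \<in> components U" "B1 \<noteq> B2"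
      "horoball x1 B1" "horoball x2 B2" and cl: "p \<in> closure B1" "p \<in> closure B2" and p: "p \<in> hspace"
    using st unfolding self_tangency_def U_def by metis
  obtain r1 r2 where r: "r1 > 0" "r2 > 0" "B1 = hball_at x1 r1" "B2 = hball_at x2 r2"
    using B(4,5) by (auto simp: horoball_hball_at)
  have disj: "B1 \<inter> B2 = {}" using components_nonoverlap B(1-3) by blast
  have le1: "hfun x1 r1 p \<le> 1" "hfun x2 r2 p \<le> 1"
    using closure_hball_at p cl r by blast+
  have tan: "2 * coshd p q = hfun x1 r1 q + hfun x2 r2 q" if "q \<in> hspace" for q
    using tangent_hfun[OF r(1,2) p _ le1 that] disj r(3,4) by simp
  have UH: "U \<subseteq> hspace" by (auto simp: U_def preimage_in_H_def)
  have inv1: "\<gamma> ` A \<subseteq> U" "inv \<gamma> ` A \<subseteq> U" if "A \<subseteq> U" for A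
    using that preimage_in_H_invariant[OF G] g isom_groupD(4)[OF G] unfolding U_def by blast+
  have conn: "connected (f ` A)" if "A \<in> components U" "hyp_isom f" for f A
    using connected_continuous_image[OF continuous_on_subset[OF hyp_isom_continuous[OF that(2)]]]
      in_components_connected[OF that(1)] in_components_subset[OF that(1)] UH by blast
  have gp: "\<gamma> p \<in> hspace" using i p by (rule hyp_isom_in)
  \<comment> \<open>\<open>A\<close> and \<open>D\<close> are components of a \<Gamma>-invariant set
    and isometries are continuous, so if \<open>inv \<gamma>\<close> carries part of
    \<open>A\<close> into \<open>D\<close>, then maximality in both directions gives equality of
    \<open>A\<close> with the image of \<open>D\<close>.\<close>
  have dich: "hfun x r (\<gamma> p) \<ge> 2 \<or> hfun x r (\<gamma> p) = 1"
    if A: "A \<in> components U" and Ar: "A = hball_at x r" "r > 0" and A12: "A = B1 \<or> A = B2" for A x r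
  proof (cases "inv \<gamma> ` A \<inter> B1 = {} \<and> inv \<gamma> ` A \<inter> B2 = {}")
    case True
    then show ?thesis using hfun_image_ge_2[OF i Ar(2) r(1,2) p tan] r(3,4) Ar(1) by blast
  next
    case False
    then obtain D where D: "D = B1 \<or> D = B2" "inv \<gamma> ` A \<inter> D \<noteq> {}" by blast
    have DU: "D \<in> components U" using D B by blast
    have "inv \<gamma> ` A \<subseteq> D"
      by (rule components_maximal[OF DU conn[OF A gi]]) (use D(2) inv1 in_components_subset[OF A] in \<open>auto simp: Int_commute\<close>)
    moreover have "\<gamma> ` D \<inter> A \<noteq> {}" using D(2) i by (auto simp: disjoint_iff) (metis hyp_isom_inv_apply(2) imageI)
    then have "\<gamma> ` D \<subseteq> A"
      by (intro components_maximal[OF A conn[OF DU i]]) (use inv1 in_components_subset[OF DU] in \<open>auto simp: Int_commute\<close>)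
    ultimately have gD: "\<gamma> ` D = A" using i by (force simp: image_subset_iff)
    have clo: "\<gamma> p \<in> closure (\<gamma> ` E)" if "E = B1 \<or> E = B2" for E
    proof -
      have E: "p \<in> closure E" "E \<subseteq> hspace" using that cl r by (auto simp: hball_at_def)
      have "isCont \<gamma> p"
        using hyp_isom_continuous[OF i] open_hspace p continuous_on_eq_continuous_at by blast
      then show ?thesis
        using E(1) unfolding closure_sequential continuous_at_sequentially o_def
        by (metis imageI)
    qed
    have "hfun x r (\<gamma> p) \<le> 1"
      using closure_hball_at[OF Ar(2) _ gp, of x] clo[OF D(1)] gD Ar(1) by simp
    \<comment> \<open>If \<open>\<gamma> p\<close> were inside the open set \<open>A\<close>, then
      \<open>A\<close> would meet the image of the other tangent horoball \<open>E\<close>, which is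
      disjoint from the image of \<open>D\<close>.\<close>
    moreover have "\<not> hfun x r (\<gamma> p) < 1"
    proof
      assume "hfun x r (\<gamma> p) < 1"
      then have "\<gamma> p \<in> A" using gp Ar by (simp add: hball_at_def)
      moreover obtain E where E: "E = B1 \<or> E = B2" "E \<inter> D = {}" using D(1) disj by blast
      moreover have "open A" using Ar open_hball_at by simp
      ultimately have "\<gamma> ` E \<inter> A \<noteq> {}"
        using clo[OF E(1)] by (metis Int_commute closure_iff_nhds_not_empty subset_refl)
      then have "\<gamma> ` E \<inter> \<gamma> ` D \<noteq> {}" using gD by simp
      then show False using E(2) hyp_isom_bij[OF i] by (auto dest!: bij_is_inj simp: inj_eq)
    qed
    ultimately show ?thesis by simp
  qed
  have "coshd p (\<gamma> p) \<noteq> 1"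
    using F g p gp coshd_eq_1_iff[OF p gp] unfolding acts_freely_def by metis
  then show ?thesis
    using dich[OF B(1) r(3,1) disjI1[OF refl]] dich[OF B(2) r(4,2) disjI2[OF refl]] tan[OF gp] by linarith
qed

section \<open>Volume bound on embedded balls\<close>

text \<open>Countable subadditivity for any countable index set, so that group elements and integer
  triples can index the pieces without an enumeration.\<close>

lemma emeasure_UN_le_count_space:
  assumes I: "countable I" and X: "\<And>i. i \<in> I \<Longrightarrow> X i \<in> sets M"
  shows "emeasure M (\<Union>i\<in>I. X i) \<le> (\<integral>\<^sup>+ i. emeasure M (X i) \<partial>count_space I)"
proof -
  have "(\<Union>i\<in>I. X i) \<in> sets M" using X by (intro sets.countable_UN'[OF I]) auto
  then have "emeasure M (\<Union>i\<in>I. X i) = (\<integral>\<^sup>+ x. indicator (\<Union>i\<in>I. X i) x \<partial>M)"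
    by simp
  also have "\<dots> \<le> (\<integral>\<^sup>+ x. \<integral>\<^sup>+ i. indicator (X i) x \<partial>count_space I \<partial>M)"
  proof (rule nn_integral_mono)
    fix x
    show "(indicator (\<Union>i\<in>I. X i) x :: ennreal) \<le> (\<integral>\<^sup>+ i. indicator (X i) x \<partial>count_space I)"
    proof (cases "x \<in> (\<Union>i\<in>I. X i)")
      case True
      then obtain j where j: "j \<in> I" "x \<in> X j" by blast
      have "(1::ennreal) = (\<integral>\<^sup>+ i. indicator {j} i \<partial>count_space I)"
        using j by simp
      also have "\<dots> \<le> (\<integral>\<^sup>+ i. indicator (X i) x \<partial>count_space I)"
        using j by (intro nn_integral_mono) (auto simp: indicator_def)
      finally show ?thesis using True by simp
    qed simp
  qed
  also have "\<dots> = (\<integral>\<^sup>+ i. \<integral>\<^sup>+ x. indicator (X i) x \<partial>M \<partial>count_space I)"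
    using I X by (intro nn_integral_count_space_nn_integral) auto
  also have "\<dots> = (\<integral>\<^sup>+ i. emeasure M (X i) \<partial>count_space I)"
    using X by (intro nn_integral_cong) simp
  finally show ?thesis .
qed

lemma emeasure_lborel_cube:
  fixes u :: "'a::euclidean_space"
  assumes "h \<ge> 0" "\<And>i. i \<in> Basis \<Longrightarrow> (v - u) \<bullet> i = h"
  shows "emeasure lborel (box u v) = ennreal (h ^ DIM('a))" "emeasure lborel (cbox u v) = ennreal (h ^ DIM('a))"
proof -
  have le: "u \<bullet> i \<le> v \<bullet> i" if "i \<in> Basis" for i
    using assms that by (metis diff_ge_0_iff_ge inner_diff_left)
  show "emeasure lborel (box u v) = ennreal (h ^ DIM('a))"
    using assms le by (subst emeasure_lborel_box) auto
  show "emeasure lborel (cbox u v) = ennreal (h ^ DIM('a))"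
    using assms le by (subst emeasure_lborel_cbox) auto
qed

text \<open>Cover \<open>A\<close>, with small excess, by cubes with disjoint interiors. A cube of
  side \<open>h\<close> has l1-diameter at most \<open>DIM('a) * h\<close>, so the image of its part
  in \<open>A\<close> fits into a cube of side \<open>2 * L * DIM('a) * h\<close>.\<close>

lemma emeasure_lipschitz_image_le:
  fixes f :: "'a::euclidean_space \<Rightarrow> 'a"
  assumes A: "A \<in> sets borel" "bounded A" and L: "L \<ge> 0"
    and lip: "\<And>x y. x \<in> A \<Longrightarrow> y \<in> A \<Longrightarrow> dist (f x) (f y) \<le> L * dist x y"
  shows "emeasure lborel (f ` A) \<le> ennreal ((2 * L * DIM('a)) ^ DIM('a)) * emeasure lborel A"
proof -
  define C where "C = (2 * L * DIM('a)) ^ DIM('a)"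
  obtain B0 where B0: "\<And>x. x \<in> A \<Longrightarrow> norm x \<le> B0" using A(2) by (auto simp: bounded_iff)
  define B where "B = max B0 1"
  have B: "B > 0" "\<And>x. x \<in> A \<Longrightarrow> norm x \<le> B" using B0 by (auto simp: B_def max.coboundedI1)
  define a b where "a = (- B) *\<^sub>R (One :: 'a)" and "b = B *\<^sub>R (One :: 'a)"
  have ab: "a \<bullet> i = - B" "b \<bullet> i = B" if "i \<in> Basis" for i
    using that by (auto simp: a_def b_def)
  have sub: "A \<subseteq> cbox a b"
  proof
    fix x assume "x \<in> A"
    then have "\<bar>x \<bullet> i\<bar> \<le> B" if "i \<in> Basis" for i
      using Basis_le_norm[OF that, of x] B(2)[of x] by simp
    then show "x \<in> cbox a b" by (auto simp: mem_box ab abs_le_iff minus_le_iff)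
  qed
  have ne: "box a b \<noteq> {}" using B(1) by (simp add: box_ne_empty ab)
  have main: "emeasure lborel (f ` A) \<le> ennreal C * (emeasure lborel A + ennreal e)" if e: "e > 0" for e
  proof -
    have "A \<in> sets lebesgue" using A(1) by simp
    then obtain U where U: "open U" "A \<subseteq> U" "U - A \<in> lmeasurable" "emeasure lebesgue (U - A) < ennreal e"
      using sets_lebesgue_outer_open e by metis
    \<comment> \<open>Every covering cube is subordinate to a tag in \<open>A\<close>, hence in
      \<open>U\<close>; this gauge therefore confines all cubes to \<open>U\<close>.\<close>
    define g where "g = (\<lambda>x. if x \<in> U then U else UNIV)"
    have "gauge g" using U(1) by (auto simp: gauge_def g_def)
    then obtain \<D> where D: "countable \<D>" "\<And>K. K \<in> \<D> \<Longrightarrow> interior K \<noteq> {} \<and> (\<exists>c d. K = cbox c d)"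
      "pairwise (\<lambda>A B. interior A \<inter> interior B = {}) \<D>"
      "\<And>K. K \<in> \<D> \<Longrightarrow> \<exists>x \<in> A \<inter> K. K \<subseteq> g x"
      "\<And>u v. cbox u v \<in> \<D> \<Longrightarrow> \<exists>n. \<forall>i \<in> Basis. v \<bullet> i - u \<bullet> i = (b \<bullet> i - a \<bullet> i) / 2^n"
      "A \<subseteq> \<Union>\<D>"
      using covering_lemma[OF sub ne \<open>gauge g\<close>] by metis
    have piece: "\<exists>Y. Y \<in> sets borel \<and> f ` (A \<inter> K) \<subseteq> Y \<and> emeasure lborel Y \<le> ennreal C * emeasure lborel (interior K)"
      if K: "K \<in> \<D>" for K
    proof -
      obtain u v where uv: "K = cbox u v" using D(2)[OF K] by blast
      obtain n where n: "\<And>i. i \<in> Basis \<Longrightarrow> v \<bullet> i - u \<bullet> i = (b \<bullet> i - a \<bullet> i) / 2^n"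
        using D(5) K uv by blast
      define h where "h = 2 * B / 2 ^ n"
      have h: "h \<ge> 0" using B(1) by (simp add: h_def)
      have side: "v \<bullet> i - u \<bullet> i = h" if "i \<in> Basis" for i
        using n[OF that] that by (simp add: ab h_def)
      obtain x where x: "x \<in> A" "x \<in> K" using D(4)[OF K] by blast
      define R where "R = L * (DIM('a) * h)"
      define Y where "Y = cbox (f x - R *\<^sub>R One) (f x + R *\<^sub>R One)"
      have R: "R \<ge> 0" using L h by (simp add: R_def)
      have "f y \<in> Y" if y: "y \<in> A" "y \<in> K" for y
      proof -
        have "dist x y \<le> (\<Sum>i\<in>Basis. \<bar>(x - y) \<bullet> i\<bar>)" unfolding dist_norm by (rule norm_le_l1)
        also have "\<dots> \<le> (\<Sum>i\<in>(Basis::'a set). h)"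
        proof (rule sum_mono)
          fix i :: 'a assume i: "i \<in> Basis"
          then have "u \<bullet> i \<le> x \<bullet> i" "x \<bullet> i \<le> v \<bullet> i" "u \<bullet> i \<le> y \<bullet> i" "y \<bullet> i \<le> v \<bullet> i"
            using x(2) y(2) by (auto simp: uv mem_box)
          then show "\<bar>(x - y) \<bullet> i\<bar> \<le> h" using side[OF i] by (simp add: inner_diff_left abs_le_iff)
        qed
        finally have "L * dist x y \<le> R" using L by (simp add: R_def mult_left_mono)
        then have d: "dist (f x) (f y) \<le> R" using lip[OF x(1) y(1)] by simp
        have "\<bar>(f x - f y) \<bullet> i\<bar> \<le> R" if "i \<in> Basis" for i
          using Basis_le_norm[OF that, of "f x - f y"] d by (simp add: dist_norm)
        then have "f x \<bullet> i - R \<le> f y \<bullet> i \<and> f y \<bullet> i \<le> f x \<bullet> i + R" if "i \<in> Basis" for i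
          using that by (fastforce simp: inner_diff_left abs_le_iff)
        then show ?thesis by (simp add: Y_def mem_box inner_diff_left inner_add_left)
      qed
      moreover have "emeasure lborel Y = ennreal C * emeasure lborel (interior K)"
      proof -
        have "emeasure lborel Y = ennreal ((2 * R) ^ DIM('a))"
          unfolding Y_def using R by (intro emeasure_lborel_cube(2)) (auto simp: inner_diff_left inner_add_left)
        also have "\<dots> = ennreal (C * h ^ DIM('a))"
          by (simp add: C_def R_def power_mult_distrib[symmetric] ac_simps)
        also have "\<dots> = ennreal C * ennreal (h ^ DIM('a))"
          using h L by (intro ennreal_mult) (auto simp: C_def)
        also have "ennreal (h ^ DIM('a)) = emeasure lborel (interior K)"
          using emeasure_lborel_cube(1)[OF h, of v u] side by (simp add: uv inner_diff_left)
        finally show ?thesis .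
      qed
      ultimately show ?thesis by (intro exI[of _ Y]) (auto simp: Y_def)
    qed
    obtain Y where Y: "\<And>K. K \<in> \<D> \<Longrightarrow> Y K \<in> sets borel \<and> f ` (A \<inter> K) \<subseteq> Y K
        \<and> emeasure lborel (Y K) \<le> ennreal C * emeasure lborel (interior K)"
      using piece by metis
    have "f ` A \<subseteq> (\<Union>K\<in>\<D>. Y K)"
    proof
      fix z assume "z \<in> f ` A"
      then obtain x where x: "x \<in> A" "z = f x" by blast
      then obtain K where K: "K \<in> \<D>" "x \<in> K" using D(6) by blast
      then show "z \<in> (\<Union>K\<in>\<D>. Y K)" using Y[OF K(1)] x by auto
    qed
    then have "emeasure lborel (f ` A) \<le> emeasure lborel (\<Union>K\<in>\<D>. Y K)"
      using D(1) Y by (intro emeasure_mono) auto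
    also have "\<dots> \<le> (\<integral>\<^sup>+ K. emeasure lborel (Y K) \<partial>count_space \<D>)"
      using D(1) Y by (intro emeasure_UN_le_count_space) auto
    also have "\<dots> \<le> (\<integral>\<^sup>+ K. ennreal C * emeasure lborel (interior K) \<partial>count_space \<D>)"
      using Y by (intro nn_integral_mono) simp
    also have "\<dots> = ennreal C * (\<integral>\<^sup>+ K. emeasure lborel (interior K) \<partial>count_space \<D>)"
      by (intro nn_integral_cmult) simp
    also have "(\<integral>\<^sup>+ K. emeasure lborel (interior K) \<partial>count_space \<D>) = emeasure lborel (\<Union>K\<in>\<D>. interior K)"
    proof (rule emeasure_UN_countable[symmetric])
      show "disjoint_family_on interior \<D>"
        using D(3) unfolding disjoint_family_on_def pairwise_def by blast
    qed (use D(1) in simp_all)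
    also have "\<dots> \<le> emeasure lborel U"
    proof (intro emeasure_mono UN_least)
      fix K assume "K \<in> \<D>"
      then obtain x where "x \<in> A" "K \<subseteq> g x" using D(4) by blast
      then show "interior K \<subseteq> U" using U(2) interior_subset[of K] by (auto simp: g_def split: if_splits)
    qed (use U in simp)
    also have "emeasure lborel U = emeasure lborel A + emeasure lborel (U - A)"
      using U A by (subst plus_emeasure) (auto intro!: arg_cong[where f = "emeasure lborel"])
    also have "\<dots> \<le> emeasure lborel A + ennreal e"
      using U A by (intro add_left_mono less_imp_le) (simp add: emeasure_completion)
    finally show ?thesis by (simp add: mult_left_mono)
  qed
  have fin: "emeasure lborel A < \<infinity>" using A(2) by (rule emeasure_bounded_finite)
  define m where "m = measure lborel A"
  have m: "emeasure lborel A = ennreal m" "m \<ge> 0" using fin by (auto simp: m_def emeasure_eq_ennreal_measure)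
  have C: "C \<ge> 0" using L by (simp add: C_def)
  have approx: "emeasure lborel (f ` A) \<le> ennreal (C * m) + ennreal \<epsilon>" if "\<epsilon> > 0" for \<epsilon>
  proof -
    \<comment> \<open>The summand 1 keeps the denominator positive when \<open>C\<close> is
      0.\<close>
    define e where "e = \<epsilon> / (C + 1)"
    have e: "e > 0" "C * e \<le> \<epsilon>" using that C by (auto simp: e_def field_simps)
    have "emeasure lborel (f ` A) \<le> ennreal C * (ennreal m + ennreal e)" using main[OF e(1)] m by simp
    also have "\<dots> = ennreal (C * m + C * e)"
      using C m e by (simp add: ennreal_mult'[symmetric] distrib_left flip: ennreal_plus)
    also have "\<dots> \<le> ennreal (C * m + \<epsilon>)" using e by (intro ennreal_leI) simp
    also have "\<dots> = ennreal (C * m) + ennreal \<epsilon>" using C m that by (simp add: ennreal_plus)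
    finally show ?thesis .
  qed
  have "emeasure lborel (f ` A) \<le> ennreal (C * m)" by (rule ennreal_le_epsilon) (rule approx)
  then show ?thesis using C m by (simp add: C_def[symmetric] ennreal_mult)
qed


section \<open>Hyperbolic volume under isometries\<close>

lemma borel_measurable_snd [measurable]: "(snd :: 'a::euclidean_space \<times> real \<Rightarrow> real) \<in> borel_measurable borel"
  by (intro borel_measurable_continuous_onI continuous_intros)

lemma borel_hspace [measurable]: "hspace \<in> sets borel"
  by (rule borel_open[OF open_hspace])

lemma hyp_isom_measurable:
  assumes "hyp_isom (f :: 'a::euclidean_space \<times> real \<Rightarrow> _)" shows "f \<in> borel_measurable borel"
proof -
  have "(\<lambda>p. if p \<in> hspace then f p else p) \<in> borel_measurable borel"
    using hyp_isom_continuous[OF assms]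
    by (intro borel_measurable_continuous_on_if borel_hspace continuous_intros)
  also have "(\<lambda>p. if p \<in> hspace then f p else p) = f"
    using hyp_isom_notin[OF assms] by auto
  finally show ?thesis .
qed

lemma hyp_isom_image_borel:
  assumes f: "hyp_isom f" and A: "A \<in> sets borel" shows "f ` A \<in> sets borel"
proof -
  have "f ` A = inv f -` A"
    using bij_vimage_eq_inv_image[OF bij_imp_bij_inv[OF hyp_isom_bij[OF f]], of A]
    by (simp add: inv_inv_eq hyp_isom_bij f)
  then show ?thesis
    using measurable_sets[OF hyp_isom_measurable[OF hyp_isom_inv[OF f]] A] by simp
qed

definition hyp_measure :: "('a::euclidean_space \<times> real) measure" where
  "hyp_measure = density lborel (\<lambda>p. ennreal (1 / snd p ^ (DIM('a) + 1)))"

lemma sets_hyp_measure [measurable_cong, simp]: "sets hyp_measure = sets borel"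
  by (simp add: hyp_measure_def)

lemma hyp_weight_measurable [measurable]:
  "(\<lambda>p::'a::euclidean_space \<times> real. ennreal (1 / snd p ^ n)) \<in> borel_measurable borel"
  by measurable

lemma hyp_vol_emeasure: "A \<in> sets borel \<Longrightarrow> hyp_vol A = emeasure hyp_measure A"
  unfolding hyp_vol_def hyp_measure_def
  by (subst emeasure_density) (use hyp_weight_measurable in \<open>auto simp: mult.commute simp del: power_Suc\<close>)

lemma hyp_measure_bounds:
  fixes A :: "('a::euclidean_space \<times> real) set"
  assumes A: "A \<in> sets borel" and a: "a > 0" and ge: "\<And>p. p \<in> A \<Longrightarrow> a \<le> snd p \<and> snd p \<le> 2 * a"
  shows "emeasure hyp_measure A \<le> ennreal (1 / a ^ (DIM('a) + 1)) * emeasure lborel A"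
    and "emeasure hyp_measure A \<ge> ennreal (1 / (2 * a) ^ (DIM('a) + 1)) * emeasure lborel A"
proof -
  have e: "emeasure hyp_measure A = (\<integral>\<^sup>+ p. ennreal (1 / snd p ^ (DIM('a) + 1)) * indicator A p \<partial>lborel)"
    using A hyp_weight_measurable unfolding hyp_measure_def by (subst emeasure_density) (auto simp del: power_Suc)
  have c: "(\<integral>\<^sup>+ p. c * indicator A p \<partial>lborel) = c * emeasure lborel A" for c
    using A by (subst nn_integral_cmult_indicator) auto
  show "emeasure hyp_measure A \<le> ennreal (1 / a ^ (DIM('a) + 1)) * emeasure lborel A"
    unfolding e c[symmetric]
  proof (intro nn_integral_mono)
    fix p :: "'a \<times> real"
    have "1 / snd p ^ (DIM('a) + 1) \<le> 1 / a ^ (DIM('a) + 1)" if "p \<in> A"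
      using ge[OF that] a by (intro divide_left_mono power_mono mult_pos_pos zero_less_power) auto
    then show "ennreal (1 / snd p ^ (DIM('a) + 1)) * indicator A p \<le> ennreal (1 / a ^ (DIM('a) + 1)) * indicator A p"
      by (auto simp: indicator_def intro!: ennreal_leI)
  qed
  show "emeasure hyp_measure A \<ge> ennreal (1 / (2 * a) ^ (DIM('a) + 1)) * emeasure lborel A"
    unfolding e c[symmetric]
  proof (intro nn_integral_mono)
    fix p :: "'a \<times> real"
    have "1 / (2 * a) ^ (DIM('a) + 1) \<le> 1 / snd p ^ (DIM('a) + 1)" if "p \<in> A"
      using ge[OF that] a by (intro divide_left_mono power_mono mult_pos_pos zero_less_power) auto
    then show "ennreal (1 / (2 * a) ^ (DIM('a) + 1)) * indicator A p \<le> ennreal (1 / snd p ^ (DIM('a) + 1)) * indicator A p"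
      by (auto simp: indicator_def intro!: ennreal_leI)
  qed
qed

lemma dist_eq_ch:
  assumes "p \<in> hspace" "q \<in> hspace"
  shows "(dist p q)\<^sup>2 = 2 * snd p * snd q * (coshd p q - 1)"
  using assms by (simp add: dist_prod_def dist_norm coshd_def hspace_def)

text \<open>With n the dimension, the Lipschitz bound contributes \<open>(2 * L * n) ^ n\<close> for
  \<open>L = 2 * b / a\<close>, and the density changes by at most \<open>(2 * a / b) ^ n\<close>;
  the product is \<open>(8 * n) ^ n\<close>.\<close>

definition distortion :: "'a::euclidean_space itself \<Rightarrow> real" where
  "distortion _ = (8 * DIM('a \<times> real)) ^ DIM('a \<times> real)"

text \<open>The squared Euclidean distance is \<open>coshd - 1\<close>, which \<open>f\<close>
  preserves, times twice the product of the heights. Hence \<open>f\<close> is Lipschitz with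
  constant \<open>2 * b / a\<close> on the cell.\<close>

lemma hyp_measure_image_cell:
  fixes f :: "'a::euclidean_space \<times> real \<Rightarrow> 'a \<times> real"
  assumes f: "hyp_isom f" and A: "A \<in> sets borel" "A \<subseteq> hspace" "bounded A"
    and ab: "a > 0" "b > 0" and cell: "\<And>p. p \<in> A \<Longrightarrow> a \<le> snd p \<and> snd p \<le> 2 * a"
      "\<And>p. p \<in> A \<Longrightarrow> b \<le> snd (f p) \<and> snd (f p) \<le> 2 * b"
  shows "emeasure hyp_measure (f ` A) \<le> ennreal (distortion TYPE('a)) * emeasure hyp_measure A"
proof -
  define n where "n = DIM('a) + 1"
  have n: "DIM('a \<times> real) = n" by (simp add: n_def)
  define L where "L = 2 * b / a"
  have L: "L \<ge> 0" using ab by (simp add: L_def)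
  have fA: "f ` A \<in> sets borel" using f A(1) by (rule hyp_isom_image_borel)
  have lip: "dist (f x) (f y) \<le> L * dist x y" if "x \<in> A" "y \<in> A" for x y
  proof -
    have h: "x \<in> hspace" "y \<in> hspace" using that A by auto
    have c: "coshd x y \<ge> 1" using coshd_ge_1 h by blast
    have "(dist (f x) (f y))\<^sup>2 = 2 * (snd (f x) * snd (f y)) * (coshd x y - 1)"
      using h f by (simp add: dist_eq_ch hyp_isom_in hyp_isom_ch)
    also have "\<dots> \<le> 2 * ((2 * b) * (2 * b)) * (coshd x y - 1)"
      using cell(2)[OF that(1)] cell(2)[OF that(2)] ab c by (intro mult_right_mono mult_left_mono mult_mono) auto
    also have "\<dots> = L\<^sup>2 * (2 * (a * a) * (coshd x y - 1))"
      using ab by (simp add: L_def field_simps power2_eq_square)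
    also have "\<dots> \<le> L\<^sup>2 * (2 * (snd x * snd y) * (coshd x y - 1))"
      using cell(1)[OF that(1)] cell(1)[OF that(2)] ab c by (intro mult_right_mono mult_left_mono mult_mono) auto
    also have "\<dots> = (L * dist x y)\<^sup>2" using h by (simp add: dist_eq_ch power_mult_distrib)
    finally show ?thesis using L by (simp add: power2_le_iff_abs_le)
  qed
  have "emeasure hyp_measure (f ` A) \<le> ennreal (1 / b ^ n) * emeasure lborel (f ` A)"
    unfolding n_def by (rule hyp_measure_bounds(1)[OF fA ab(2)]) (use cell(2) in blast)
  also have "\<dots> \<le> ennreal (1 / b ^ n) * (ennreal ((2 * L * n) ^ n) * emeasure lborel A)"
    using emeasure_lipschitz_image_le[OF A(1,3) L lip] unfolding n by (intro mult_left_mono) auto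
  also have "\<dots> = ennreal (distortion TYPE('a)) * (ennreal (1 / (2 * a) ^ n) * emeasure lborel A)"
  proof -
    have "1 / b ^ n * (2 * L * n) ^ n = distortion TYPE('a) * (1 / (2 * a) ^ n)"
    proof -
      have "1 / b ^ n * (2 * L * n) ^ n = (1 / b * (2 * L * n)) ^ n"
        by (simp only: power_mult_distrib power_one_over)
      also have "1 / b * (2 * L * n) = 8 * n * (1 / (2 * a))" using ab by (simp add: L_def)
      also have "(8 * n * (1 / (2 * a))) ^ n = (8 * n) ^ n * (1 / (2 * a) ^ n)"
        by (simp only: power_mult_distrib power_one_over of_nat_mult of_nat_power of_nat_numeral)
      finally show ?thesis unfolding distortion_def n by simp
    qed
    then have "ennreal (1 / b ^ n) * ennreal ((2 * L * n) ^ n) = ennreal (distortion TYPE('a)) * ennreal (1 / (2 * a) ^ n)"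
      using ab L by (simp add: ennreal_mult[symmetric] distortion_def)
    then show ?thesis by (simp add: mult.assoc[symmetric])
  qed
  also have "\<dots> \<le> ennreal (distortion TYPE('a)) * emeasure hyp_measure A"
    using hyp_measure_bounds(2)[OF A(1) ab(1)] cell(1) by (intro mult_left_mono) (auto simp: n_def)
  finally show ?thesis .
qed

lemma dyadic_bracket:
  assumes "t > 0"
  shows "2 powr \<lfloor>log 2 t\<rfloor> \<le> t" "t \<le> 2 * 2 powr \<lfloor>log 2 t\<rfloor>"
proof -
  have "2 powr \<lfloor>log 2 t\<rfloor> \<le> 2 powr (log 2 t)" by (intro powr_mono) auto
  then show "2 powr \<lfloor>log 2 t\<rfloor> \<le> t" using assms by simp
  have "2 powr (log 2 t) \<le> 2 powr (1 + \<lfloor>log 2 t\<rfloor>)" by (intro powr_mono) linarith+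
  then show "t \<le> 2 * 2 powr \<lfloor>log 2 t\<rfloor>" using assms by (simp add: powr_add)
qed

text \<open>Isometries in fact preserve the volume; the constant factor is all that is needed and
  avoids derivatives: on pieces where the heights of \<open>p\<close> and \<open>f p\<close> are nearly constant, \<open>f\<close> is
  Lipschitz with the right constant.\<close>
lemma hyp_measure_image_le:
  fixes f :: "'a::euclidean_space \<times> real \<Rightarrow> 'a \<times> real"
  assumes f: "hyp_isom f" and A: "A \<in> sets borel" "A \<subseteq> hspace"
  shows "emeasure hyp_measure (f ` A) \<le> ennreal (distortion TYPE('a)) * emeasure hyp_measure A"
proof -
  \<comment> \<open>Two entries fix the heights of \<open>p\<close> and \<open>f p\<close> up to a
    factor 2; the third makes the pieces bounded, as the Lipschitz estimate requires.\<close>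
  define key :: "'a \<times> real \<Rightarrow> int \<times> int \<times> int" where
    "key = (\<lambda>p. (\<lfloor>log 2 (snd p)\<rfloor>, \<lfloor>log 2 (snd (f p))\<rfloor>, \<lfloor>norm p\<rfloor>))"
  define D where "D = (\<lambda>k. A \<inter> key -` {k})"
  note hyp_isom_measurable[OF f, measurable]
  have Dm: "D k \<in> sets borel" for k
  proof -
    obtain i j l where k: "k = (i, j, l)" by (cases k)
    have [measurable]: "A \<in> sets borel" by (rule A)
    have "{p \<in> space borel. p \<in> A \<and> \<lfloor>log 2 (snd p)\<rfloor> = i \<and> \<lfloor>log 2 (snd (f p))\<rfloor> = j \<and> \<lfloor>norm p\<rfloor> = l} \<in> sets borel"
      by measurable
    also have "{p \<in> space borel. p \<in> A \<and> \<lfloor>log 2 (snd p)\<rfloor> = i \<and> \<lfloor>log 2 (snd (f p))\<rfloor> = j \<and> \<lfloor>norm p\<rfloor> = l} = D k"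
      by (auto simp: D_def key_def k)
    finally show ?thesis .
  qed
  have AD: "A = (\<Union>k. D k)" by (auto simp: D_def)
  have "emeasure hyp_measure (f ` A) = emeasure hyp_measure (\<Union>k\<in>UNIV. f ` D k)"
    unfolding AD by (simp add: image_UN)
  also have "\<dots> \<le> (\<integral>\<^sup>+ k. emeasure hyp_measure (f ` D k) \<partial>count_space UNIV)"
    using hyp_isom_image_borel[OF f Dm] by (intro emeasure_UN_le_count_space) auto
  also have "\<dots> \<le> (\<integral>\<^sup>+ k. ennreal (distortion TYPE('a)) * emeasure hyp_measure (D k) \<partial>count_space UNIV)"
  proof (intro nn_integral_mono)
    fix k :: "int \<times> int \<times> int"
    obtain i j l where k: "k = (i, j, l)" by (cases k)
    have b: "bounded (D k)"
    proof (rule boundedI)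
      fix p assume "p \<in> D k"
      then have "\<lfloor>norm p\<rfloor> = l" by (simp add: D_def key_def k)
      then show "norm p \<le> of_int l + 1" by linarith
    qed
    show "emeasure hyp_measure (f ` D k) \<le> ennreal (distortion TYPE('a)) * emeasure hyp_measure (D k)"
    proof (rule hyp_measure_image_cell[OF f Dm _ b])
      show "D k \<subseteq> hspace" using A(2) by (auto simp: D_def)
      fix p assume p: "p \<in> D k"
      then have h: "p \<in> hspace" using A(2) by (auto simp: D_def)
      then have t: "snd p > 0" "snd (f p) > 0" using hyp_isom_in[OF f h] by (auto simp: hspace_def)
      show "2 powr i \<le> snd p \<and> snd p \<le> 2 * 2 powr i"
        using dyadic_bracket[OF t(1)] p by (simp add: D_def key_def k)
      show "2 powr j \<le> snd (f p) \<and> snd (f p) \<le> 2 * 2 powr j"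
        using dyadic_bracket[OF t(2)] p by (simp add: D_def key_def k)
    qed auto
  qed
  also have "\<dots> = ennreal (distortion TYPE('a)) * (\<integral>\<^sup>+ k. emeasure hyp_measure (D k) \<partial>count_space UNIV)"
    by (intro nn_integral_cmult) simp
  also have "(\<integral>\<^sup>+ k. emeasure hyp_measure (D k) \<partial>count_space UNIV) = emeasure hyp_measure A"
    unfolding AD using Dm by (intro emeasure_UN_countable[symmetric]) (auto simp: disjoint_family_on_def D_def)
  finally show ?thesis .
qed

lemma discrete_group_countable:
  assumes "discrete_group \<Gamma>" shows "countable (\<Gamma> :: ('a::euclidean_space \<times> real \<Rightarrow> 'a \<times> real) set)"
proof -
  define p :: "'a \<times> real" where "p = (0, 1)"
  have "p \<in> hspace" by (simp add: p_def hspace_def)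
  then have "finite {\<gamma>\<in>\<Gamma>. hdist p (\<gamma> p) \<le> real n}" for n
    using assms by (simp add: discrete_group_def)
  then have "countable (\<Union>n. {\<gamma>\<in>\<Gamma>. hdist p (\<gamma> p) \<le> real n})"
    by (intro countable_UN[OF countableI_type] countable_finite)
  also have "(\<Union>n. {\<gamma>\<in>\<Gamma>. hdist p (\<gamma> p) \<le> real n}) = \<Gamma>"
    using real_arch_simple by auto
  finally show ?thesis .
qed

text \<open>The pieces \<open>X \<gamma>\<close> are disjoint inside \<open>F\<close>, and their
  pullbacks cover \<open>B\<close> because \<open>F\<close> meets every orbit. Each pullback costs
  at most the factor \<open>distortion\<close>.\<close>

lemma hyp_measure_embedded_le:
  fixes \<Gamma> :: "('a::euclidean_space \<times> real \<Rightarrow> 'a \<times> real) set"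
  assumes G: "isom_group \<Gamma>" and D: "discrete_group \<Gamma>"
    and F: "F \<in> sets borel" "F \<subseteq> hspace" "\<And>p. p \<in> hspace \<Longrightarrow> \<exists>q. q \<in> F \<and> q \<in> orbit \<Gamma> p"
    and B: "B \<in> sets borel" "B \<subseteq> hspace" "\<And>\<gamma>. \<gamma> \<in> \<Gamma> \<Longrightarrow> \<gamma> \<noteq> id \<Longrightarrow> \<gamma> ` B \<inter> B = {}"
  shows "emeasure hyp_measure B \<le> ennreal (distortion TYPE('a)) * emeasure hyp_measure F"
proof -
  note iso = isom_groupD(1)[OF G]
  define X where "X = (\<lambda>\<gamma>. \<gamma> ` B \<inter> F)"
  have cnt: "countable \<Gamma>" using D by (rule discrete_group_countable)
  have X: "X \<gamma> \<in> sets borel" if "\<gamma> \<in> \<Gamma>" for \<gamma>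
    using hyp_isom_image_borel[OF iso[OF that] B(1)] F(1) by (auto simp: X_def)
  have cov: "B \<subseteq> (\<Union>\<gamma>\<in>\<Gamma>. inv \<gamma> ` X \<gamma>)"
  proof
    fix p assume p: "p \<in> B"
    then obtain q where "q \<in> F" "q \<in> orbit \<Gamma> p" using F(3) B(2) by blast
    then obtain \<gamma> where g: "\<gamma> \<in> \<Gamma>" "\<gamma> p \<in> F" by (auto simp: orbit_def)
    then have "\<gamma> p \<in> X \<gamma>" using p by (auto simp: X_def)
    then have "inv \<gamma> (\<gamma> p) \<in> inv \<gamma> ` X \<gamma>" by blast
    then show "p \<in> (\<Union>\<gamma>\<in>\<Gamma>. inv \<gamma> ` X \<gamma>)" using g iso[OF g(1)] by auto
  qed
  have disj: "disjoint_family_on X \<Gamma>"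
  proof -
    have False if gh: "\<gamma> \<in> \<Gamma>" "\<delta> \<in> \<Gamma>" "\<gamma> \<noteq> \<delta>" and x: "x \<in> X \<gamma>" "x \<in> X \<delta>" for \<gamma> \<delta> x
    proof -
      obtain p q where pq: "p \<in> B" "q \<in> B" "x = \<gamma> p" "x = \<delta> q" using x by (auto simp: X_def)
      have "(inv \<delta> \<circ> \<gamma>) p = q" using pq iso[OF gh(2)] by (metis comp_apply hyp_isom_inv_apply(1))
      then have "(inv \<delta> \<circ> \<gamma>) ` B \<inter> B \<noteq> {}" using pq by blast
      then have "inv \<delta> \<circ> \<gamma> = id" using B(3) isom_groupD(3,4)[OF G] gh by blast
      then have "\<gamma> = \<delta>" using iso[OF gh(2)] by (metis comp_apply eq_id_iff ext hyp_isom_inv_apply(2))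
      then show False using gh by simp
    qed
    then show ?thesis by (auto simp: disjoint_family_on_def)
  qed
  have iX: "inv \<gamma> ` X \<gamma> \<in> sets borel" if "\<gamma> \<in> \<Gamma>" for \<gamma>
    using hyp_isom_image_borel[OF hyp_isom_inv[OF iso[OF that]] X[OF that]] .
  have "emeasure hyp_measure B \<le> emeasure hyp_measure (\<Union>\<gamma>\<in>\<Gamma>. inv \<gamma> ` X \<gamma>)"
    using cov cnt iX by (intro emeasure_mono) (auto intro!: sets.countable_UN')
  also have "\<dots> \<le> (\<integral>\<^sup>+ \<gamma>. emeasure hyp_measure (inv \<gamma> ` X \<gamma>) \<partial>count_space \<Gamma>)"
    using cnt iX by (intro emeasure_UN_le_count_space) auto
  also have "\<dots> \<le> (\<integral>\<^sup>+ \<gamma>. ennreal (distortion TYPE('a)) * emeasure hyp_measure (X \<gamma>) \<partial>count_space \<Gamma>)"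
    using hyp_measure_image_le[OF hyp_isom_inv[OF iso] X] F(2)
    by (intro nn_integral_mono) (auto simp: X_def)
  also have "\<dots> = ennreal (distortion TYPE('a)) * (\<integral>\<^sup>+ \<gamma>. emeasure hyp_measure (X \<gamma>) \<partial>count_space \<Gamma>)"
    by (intro nn_integral_cmult) simp
  also have "(\<integral>\<^sup>+ \<gamma>. emeasure hyp_measure (X \<gamma>) \<partial>count_space \<Gamma>) = emeasure hyp_measure (\<Union>\<gamma>\<in>\<Gamma>. X \<gamma>)"
    using X cnt disj by (intro emeasure_UN_countable[symmetric]) auto
  also have "\<dots> \<le> emeasure hyp_measure F"
    using F(1) by (intro emeasure_mono) (auto simp: X_def)
  finally show ?thesis by (simp add: mult_left_mono)
qed

lemma hball_borel: "p \<in> hspace \<Longrightarrow> r \<ge> 0 \<Longrightarrow> hball p r \<in> sets borel"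
proof -
  assume p: "p \<in> hspace" and r: "r \<ge> 0"
  have "hball p r = hspace \<inter> coshd p -` {..<cosh r}"
    using p r by (auto simp: hball_def hdist_less_iff)
  then show ?thesis
    using continuous_open_preimage[OF continuous_on_ch[OF p] open_hspace open_lessThan, of "cosh r"] by simp
qed

text \<open>The ball contains \<open>N\<close> disjoint cubes of comparable volume, stacked above its centre.\<close>
lemma hyp_measure_hball_ge:
  fixes p :: "'a::euclidean_space \<times> real"
  assumes p: "p \<in> hspace"
  shows "emeasure hyp_measure (hball p (arcosh (2 + ((DIM('a))\<^sup>2 + 4) * 2 ^ N)))
    \<ge> ennreal (N / 2 ^ (DIM('a) + 1))"
proof -
  define t where "t = snd p"
  have t: "t > 0" using p by (simp add: t_def hspace_def)
  \<comment> \<open>Relative to \<open>p\<close>, a point of cube \<open>k\<close> has horizontal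
    offset at most \<open>DIM('a) * h k\<close> and vertical offset at most \<open>2 * h k\<close>;
    this gives the squared dimension plus 4. The leading 2 makes the inequality strict.\<close>
  define c :: real where "c = 2 + ((DIM('a))\<^sup>2 + 4) * 2 ^ N"
  have c: "c \<ge> 1" by (simp add: c_def add_increasing2)
  define h where "h = (\<lambda>k::nat. 2 ^ k * t)"
  have h: "h k > 0" for k using t by (simp add: h_def)
  \<comment> \<open>The side equals the height of the base, so all cubes satisfy one lower volume
    bound, and doubling the height keeps them disjoint.\<close>
  define E where "E = (\<lambda>k. box (fst p, h k) ((fst p, h k) + h k *\<^sub>R One))"
  have one: "snd (One :: 'a \<times> real) = 1" "fst (One :: 'a \<times> real) = One"
  proof -
    have "snd (One :: 'a \<times> real) = One \<bullet> (0 :: 'a, 1::real)" by (simp add: inner_prod_def)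
    also have "\<dots> = 1"
    proof -
      have "(0 :: 'a, 1::real) \<in> Basis" by (simp add: Basis_prod_def)
      then show ?thesis by simp
    qed
    finally show "snd (One :: 'a \<times> real) = 1" .
    show "fst (One :: 'a \<times> real) = One"
    proof (rule euclidean_eqI)
      fix i :: 'a assume i: "i \<in> Basis"
      have "fst (One :: 'a \<times> real) \<bullet> i = One \<bullet> (i, 0 :: real)" by (simp add: inner_prod_def)
      also have "\<dots> = 1"
      proof -
        have "(i, 0::real) \<in> Basis" using i by (simp add: Basis_prod_def)
        then show ?thesis by simp
      qed
      finally show "fst (One :: 'a \<times> real) \<bullet> i = One \<bullet> i" using i by simp
    qed
  qed
  have E: "h k < snd q \<and> snd q < 2 * h k \<and> norm (fst q - fst p) \<le> DIM('a) * h k" if "q \<in> E k" for q k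
  proof -
    have b: "(fst p, h k) \<bullet> i < q \<bullet> i \<and> q \<bullet> i < (fst p, h k) \<bullet> i + h k" if "i \<in> Basis" for i
      using \<open>q \<in> E k\<close> that by (simp add: E_def mem_box inner_add_left)
    have "(0 :: 'a, 1::real) \<in> Basis" by (simp add: Basis_prod_def)
    from b[OF this] have s: "h k < snd q" "snd q < 2 * h k" by (auto simp: inner_prod_def)
    have "norm (fst q - fst p) \<le> (\<Sum>i\<in>Basis. \<bar>(fst q - fst p) \<bullet> i\<bar>)" by (rule norm_le_l1)
    also have "\<dots> \<le> (\<Sum>i\<in>(Basis :: 'a set). h k)"
    proof (rule sum_mono)
      fix i :: 'a assume "i \<in> Basis"
      then have "(i, 0::real) \<in> Basis" by (simp add: Basis_prod_def)
      from b[OF this] show "\<bar>(fst q - fst p) \<bullet> i\<bar> \<le> h k" by (auto simp: inner_prod_def inner_diff_left)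
    qed
    finally show ?thesis using s by simp
  qed
  have sub: "E k \<subseteq> hball p (arcosh c)" if k: "k < N" for k
  proof
    fix q assume "q \<in> E k"
    note q = E[OF this]
    have q0: "snd q > 0" using q h[of k] by linarith
    have qh: "q \<in> hspace" using q0 by (simp add: hspace_def)
    have tk: "t \<le> h k" using t by (simp add: h_def)
    have "(norm (fst p - fst q))\<^sup>2 \<le> (DIM('a) * h k)\<^sup>2"
      using q by (subst norm_minus_commute) (auto intro: power_mono)
    moreover have "(snd p - snd q)\<^sup>2 \<le> (2 * h k)\<^sup>2"
      using q tk t h[of k] by (intro power2_le_iff_abs_le[THEN iffD2]) (auto simp: t_def)
    ultimately have "(norm (fst p - fst q))\<^sup>2 + (snd p - snd q)\<^sup>2 \<le> ((DIM('a))\<^sup>2 + 4) * (h k)\<^sup>2"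
      by (simp add: power_mult_distrib distrib_right)
    moreover have "2 * t * h k \<le> 2 * snd p * snd q" using q t by (simp add: t_def)
    ultimately have "((norm (fst p - fst q))\<^sup>2 + (snd p - snd q)\<^sup>2) / (2 * snd p * snd q)
       \<le> (((DIM('a))\<^sup>2 + 4) * (h k)\<^sup>2) / (2 * t * h k)"
      using t h[of k] by (intro frac_le) auto
    also have "\<dots> = ((DIM('a))\<^sup>2 + 4) * 2 ^ k / 2"
      using t by (simp add: h_def power2_eq_square)
    also have "\<dots> \<le> ((DIM('a))\<^sup>2 + 4) * 2 ^ N"
    proof -
      have "(2::real) ^ k \<le> 2 ^ N" using k by (intro power_increasing) auto
      then have "(2::real) ^ k / 2 \<le> 2 ^ N" using zero_less_power[of "2::real" k] by linarith
      then have "real ((DIM('a))\<^sup>2 + 4) * ((2::real) ^ k / 2) \<le> real ((DIM('a))\<^sup>2 + 4) * 2 ^ N"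
        by (intro mult_left_mono) auto
      then show ?thesis by simp
    qed
    finally have "coshd p q < c" by (simp add: coshd_def c_def)
    then show "q \<in> hball p (arcosh c)" using qh p c by (simp add: hball_def hdist_less_iff)
  qed
  have vol: "emeasure hyp_measure (E k) \<ge> ennreal (1 / 2 ^ (DIM('a) + 1))" for k
  proof -
    have "ennreal (1 / 2 ^ (DIM('a) + 1)) = ennreal (1 / (2 * h k) ^ (DIM('a) + 1)) * ennreal (h k ^ (DIM('a) + 1))"
      using h[of k] by (subst ennreal_mult[symmetric]) (auto simp: power_mult_distrib)
    also have "ennreal (h k ^ (DIM('a) + 1)) = emeasure lborel (E k)"
      unfolding E_def using h[of k] by (subst emeasure_lborel_cube(1)[of "h k"]) auto
    also have "ennreal (1 / (2 * h k) ^ (DIM('a) + 1)) * emeasure lborel (E k) \<le> emeasure hyp_measure (E k)"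
      using E[of _ k] by (intro hyp_measure_bounds(2) h) (auto simp: E_def intro: less_imp_le)
    finally show ?thesis .
  qed
  have dj: "disjoint_family_on E {..<N}"
  proof -
    have False if "i < j" "q \<in> E i" "q \<in> E j" for i j q
    proof -
      have "2 * h i \<le> h j"
      proof -
        have "(2::real) ^ Suc i \<le> 2 ^ j" using that by (intro power_increasing) auto
        then show ?thesis using t by (simp add: h_def)
      qed
      then show False using E[OF that(2)] E[OF that(3)] by linarith
    qed
    then show ?thesis unfolding disjoint_family_on_def by (metis disjoint_iff linorder_neqE_nat)
  qed
  have "ennreal (N / 2 ^ (DIM('a) + 1)) = (\<Sum>k<N. ennreal (1 / 2 ^ (DIM('a) + 1)))"
    by (simp add: ennreal_of_nat_eq_real_of_nat ennreal_mult[symmetric])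
  also have "\<dots> \<le> (\<Sum>k<N. emeasure hyp_measure (E k))" by (intro sum_mono vol)
  also have "\<dots> = emeasure hyp_measure (\<Union>k<N. E k)"
    using dj by (intro sum_emeasure) (auto simp: E_def)
  also have "\<dots> \<le> emeasure hyp_measure (hball p (arcosh c))"
    using sub hball_borel[OF p, of "arcosh c"] c by (intro emeasure_mono) auto
  finally show ?thesis by (simp add: c_def)
qed

lemma embedded_radii_bounded:
  fixes \<Gamma> :: "('a::euclidean_space \<times> real \<Rightarrow> 'a \<times> real) set"
  assumes G: "isom_group \<Gamma>" and D: "discrete_group \<Gamma>" and V: "finite_volume \<Gamma>"
  obtains R where "\<And>p r. p \<in> hspace \<Longrightarrow> r \<in> embedded_radii \<Gamma> p \<Longrightarrow> r \<le> R"
proof -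
  obtain F where F: "F \<in> sets borel" "F \<subseteq> hspace" "\<And>p. p \<in> hspace \<Longrightarrow> \<exists>q. q \<in> F \<and> q \<in> orbit \<Gamma> p"
    "hyp_vol F < \<infinity>"
    using V unfolding finite_volume_def by (metis sets_lborel)
  define K where "K = ennreal (distortion TYPE('a)) * emeasure hyp_measure F"
  have "K < \<infinity>" using F(4) hyp_vol_emeasure[OF F(1)] by (simp add: K_def ennreal_mult_less_top)
  then obtain k where k: "K = ennreal k" "k \<ge> 0" by (metis ennreal_cases infinity_ennreal_def less_irrefl)
  \<comment> \<open>So many cubes that their total volume exceeds \<open>K\<close>, the largest
    volume of an embedded ball.\<close>
  obtain N :: nat where N: "k * 2 ^ (DIM('a) + 1) < N" using reals_Archimedean2 by blast
  define R where "R = arcosh (2 + ((DIM('a))\<^sup>2 + 4) * 2 ^ N :: real)"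
  have "(0::real) \<le> ((DIM('a))\<^sup>2 + 4) * 2 ^ N" by simp
  then have R: "R \<ge> 0" unfolding R_def by (intro arcosh_nonneg_real) linarith
  show ?thesis
  proof (rule that[of R], rule ccontr)
    fix p r assume p: "p \<in> hspace" and r: "r \<in> embedded_radii \<Gamma> p" and "\<not> r \<le> R"
    then have sub: "hball p R \<subseteq> hball p r" by (auto simp: hball_def)
    have 1: "emeasure hyp_measure (hball p R) \<le> K" unfolding K_def
    proof (rule hyp_measure_embedded_le[OF G D F(1-3)])
      show "hball p R \<in> sets borel" using p R by (rule hball_borel)
      show "\<gamma> ` hball p R \<inter> hball p R = {}" if "\<gamma> \<in> \<Gamma>" "\<gamma> \<noteq> id" for \<gamma>
        using r that sub unfolding embedded_radii_def by blast
    qed (auto simp: hball_def)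
    have 2: "emeasure hyp_measure (hball p R) \<ge> ennreal (N / 2 ^ (DIM('a) + 1))"
      using hyp_measure_hball_ge[OF p, of N] by (simp add: R_def)
    have "ennreal (N / 2 ^ (DIM('a) + 1)) \<le> ennreal k" using order_trans[OF 2 1] k(1) by (simp only:)
    then have "N / 2 ^ (DIM('a) + 1) \<le> k" using k(2) by (subst (asm) ennreal_le_iff)
    then show False using N by (simp add: divide_le_eq)
  qed
qed

section \<open>Matrices over the Eisenstein integers\<close>

type_synonym eis = "int \<times> int"
type_synonym eis_mat = "eis \<times> eis \<times> eis \<times> eis"

text \<open>The pair \<open>(x, y)\<close> stands for the Eisenstein integer \<open>x + y \<omega>\<close> (where \<open>\<omega>\<^sup>2 = \<omega> - 1\<close>), and
  \<open>(a, b, c, d)\<close> for the matrix with rows \<open>(a, b)\<close> and \<open>(c, d)\<close>.\<close>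

fun eadd :: "eis \<Rightarrow> eis \<Rightarrow> eis" where "eadd (x, y) (z, w) = (x + z, y + w)"
fun eneg :: "eis \<Rightarrow> eis" where "eneg (x, y) = (- x, - y)"
fun emul :: "eis \<Rightarrow> eis \<Rightarrow> eis" where "emul (x, y) (z, w) = (x * z - y * w, x * w + y * z + y * w)"
fun ecnj :: "eis \<Rightarrow> eis" where "ecnj (x, y) = (x + y, - y)"
fun enorm :: "eis \<Rightarrow> int" where "enorm (x, y) = x * x + x * y + y * y"
fun ered :: "int \<Rightarrow> eis \<Rightarrow> eis" where "ered n (x, y) = (x mod n, y mod n)"

fun mmul :: "eis_mat \<Rightarrow> eis_mat \<Rightarrow> eis_mat" where
  "mmul (a, b, c, d) (e, f, g, h) =
    (eadd (emul a e) (emul b g), eadd (emul a f) (emul b h), eadd (emul c e) (emul d g), eadd (emul c f) (emul d h))"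
fun mcnj :: "eis_mat \<Rightarrow> eis_mat" where "mcnj (a, b, c, d) = (ecnj a, ecnj b, ecnj c, ecnj d)"
fun mstar :: "eis_mat \<Rightarrow> eis_mat" where "mstar (a, b, c, d) = (ecnj a, ecnj c, ecnj b, ecnj d)"
fun mred :: "int \<Rightarrow> eis_mat \<Rightarrow> eis_mat" where "mred n (a, b, c, d) = (ered n a, ered n b, ered n c, ered n d)"
fun mdet :: "eis_mat \<Rightarrow> eis" where "mdet (a, b, c, d) = eadd (emul a d) (eneg (emul b c))"
fun mtr :: "eis_mat \<Rightarrow> eis" where "mtr (a, b, c, d) = eadd a d"
fun madj :: "eis_mat \<Rightarrow> eis_mat" where "madj (a, b, c, d) = (d, eneg b, eneg c, a)"

text \<open>The flag marks orientation-reversing elements, which apply the matrix after complex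
  conjugation; moving the conjugation past a second matrix conjugates its entries.\<close>

definition twist :: "bool \<Rightarrow> eis_mat \<Rightarrow> eis_mat" where "twist e X = (if e then mcnj X else X)"

definition conj_act :: "int \<Rightarrow> eis_mat \<Rightarrow> bool \<Rightarrow> eis_mat \<Rightarrow> eis_mat" where
  "conj_act n M e X = mred n (mmul (mmul M (twist e X)) (mstar M))"

text \<open>The orbit of one matrix \<open>X\<close> modulo \<open>4\<close> under \<open>X \<mapsto> M X M\<^sup>*\<close> (with \<open>X\<close> conjugated for
  orientation-reversing elements). Preserving it is the congruence condition that excludes torsion.\<close>
definition gies_orbit :: "eis_mat list" where
  "gies_orbit = [((0, 0), (1, 0), (3, 0), (0, 3)),  ((3, 1), (3, 2), (3, 1), (3, 1)),  ((3, 1), (0, 1), (0, 0), (0, 3)),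
    ((0, 3), (2, 1), (3, 3), (0, 0)),  ((2, 1), (0, 2), (3, 0), (3, 1)),  ((0, 3), (2, 2), (3, 0), (3, 3)),
    ((2, 1), (2, 3), (1, 1), (0, 0)),  ((3, 1), (2, 3), (2, 2), (0, 1)),  ((2, 0), (3, 2), (1, 0), (0, 3)),
    ((3, 3), (3, 0), (1, 1), (3, 3)),  ((2, 0), (1, 2), (3, 0), (2, 1)),  ((3, 3), (2, 3), (0, 0), (2, 3)),
    ((0, 3), (2, 0), (3, 2), (1, 3)),  ((3, 3), (1, 2), (3, 3), (3, 1)),  ((2, 0), (1, 0), (3, 2), (0, 1)),
    ((3, 3), (0, 1), (2, 2), (2, 1)),  ((3, 1), (1, 0), (1, 3), (3, 3)),  ((2, 0), (3, 0), (1, 2), (2, 3)),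
    ((2, 1), (0, 0), (3, 2), (1, 1)),  ((0, 0), (3, 2), (1, 2), (0, 1)),  ((1, 1), (2, 3), (2, 0), (0, 3)),
    ((2, 1), (2, 1), (1, 3), (2, 0)),  ((1, 1), (3, 0), (3, 1), (1, 3)),  ((1, 3), (2, 3), (0, 2), (2, 1)),
    ((0, 3), (2, 3), (3, 1), (2, 0)),  ((1, 3), (3, 2), (1, 1), (1, 1)),  ((0, 0), (1, 2), (3, 2), (2, 3)),
    ((1, 3), (1, 0), (3, 3), (1, 3)),  ((2, 3), (2, 2), (3, 2), (3, 1)),  ((2, 3), (0, 1), (1, 1), (2, 0)),
    ((0, 1), (0, 2), (3, 2), (3, 3)),  ((0, 1), (0, 3), (3, 3), (2, 0)),  ((1, 1), (1, 2), (1, 3), (1, 1)),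
    ((1, 1), (0, 1), (0, 2), (0, 1)),  ((0, 1), (0, 1), (3, 1), (0, 0)),  ((0, 0), (3, 0), (1, 0), (2, 1)),
    ((1, 3), (0, 1), (2, 0), (2, 3)),  ((2, 3), (0, 3), (1, 3), (0, 0)),  ((0, 1), (0, 0), (3, 0), (1, 3)),
    ((2, 3), (2, 0), (3, 0), (1, 1))]"

definition gies_orbit_mod2 :: "eis_mat list" where
  "gies_orbit_mod2 = [((0, 0), (1, 0), (1, 0), (0, 1)),  ((0, 1), (0, 0), (1, 0), (1, 1)),  ((0, 1), (0, 1), (1, 1), (0, 0)),
    ((1, 1), (0, 1), (0, 0), (0, 1)),  ((1, 1), (1, 0), (1, 1), (1, 1))]"

text \<open>Scaled to determinant one: since \<open>-1/\<omega> = \<omega>\<^sup>2\<close>, the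
  first generator at \<open>w = cnj z\<close> is
  \<open>(\<omega> w - \<omega>) / (1 - \<omega>)\<close>.\<close>

definition gies_matrix1 :: eis_mat where "gies_matrix1 = ((0, 1), (0, -1), (0, 0), (1, -1))"
definition gies_matrix2 :: eis_mat where "gies_matrix2 = ((1, 0), (0, 0), (1, -1), (1, 0))"

definition preserves :: "eis_mat \<Rightarrow> bool \<Rightarrow> bool" where
  "preserves M e \<longleftrightarrow> (\<forall>X\<in>set gies_orbit. conj_act 4 M e X \<in> set gies_orbit)"

text \<open>The inverses are tested too, so that composition alone extends the invariant to the
  whole group.\<close>

lemma preserves_generators:
  "preserves gies_matrix1 True" "preserves gies_matrix2 True"
  "preserves (mcnj (madj gies_matrix1)) True" "preserves (mcnj (madj gies_matrix2)) True"
  by code_simp+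

definition residues2 :: "eis list" where "residues2 = [(0,0),(1,0),(0,1),(1,1)]"

text \<open>Aimed at traces 1 and -1, the elements of order three modulo sign. Both are 1 modulo 2,
  which determines the last entry from \<open>a\<close>.\<close>

lemma residues2_trace:
  "\<forall>a\<in>set residues2. \<forall>b\<in>set residues2. \<forall>c\<in>set residues2.
     (let M = (a, b, c, eadd (1, 0) a) in ered 2 (mdet M) = (1, 0) \<longrightarrow>
       \<not> (\<forall>X\<in>set gies_orbit_mod2. conj_act 2 M False X \<in> set gies_orbit_mod2))"
  by code_simp

text \<open>Aimed at orientation-reversing elements whose square is plus or minus the identity; the
  two signs agree modulo 2.\<close>

lemma residues2_square:
  "\<forall>a\<in>set residues2. \<forall>b\<in>set residues2. \<forall>c\<in>set residues2. \<forall>d\<in>set residues2.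
     (let M = (a, b, c, d) in mred 2 (mmul M (mcnj M)) = ((1,0),(0,0),(0,0),(1,0)) \<longrightarrow>
       \<not> (\<forall>X\<in>set gies_orbit_mod2. conj_act 2 M True X \<in> set gies_orbit_mod2))"
  by code_simp

definition residues4 :: "eis list" where "residues4 = List.product [0,1,2,3] [0,1,2,3]"

text \<open>Aimed at trace 0. For a unit \<open>c\<close> the determinant condition determines
  \<open>b\<close> from \<open>a\<close> and \<open>c\<close>, leaving sixteen residues times six
  units; a single orbit element detects all of them.\<close>

lemma residues4_involution:
  "\<forall>a\<in>set residues4. \<forall>c\<in>set [(1,0),(0,1),(-1,1),(-1,0),(0,-1),(1,-1)].
     (let M = (a, eneg (emul (ecnj c) (eadd (1, 0) (emul a a))), c, eneg a) in
       conj_act 4 M False ((0, 0), (1, 0), (3, 0), (0, 3)) \<notin> set gies_orbit)"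
  by code_simp

lemma eis_ring_simps:
  "eadd (eadd x y) z = eadd x (eadd y z)" "eadd x y = eadd y x" "eadd x (eadd y z) = eadd y (eadd x z)"
  "emul (emul x y) z = emul x (emul y z)" "emul x y = emul y x" "emul x (emul y z) = emul y (emul x z)"
  "emul x (eadd y z) = eadd (emul x y) (emul x z)" "emul (eadd x y) z = eadd (emul x z) (emul y z)"
  "ecnj (eadd x y) = eadd (ecnj x) (ecnj y)" "ecnj (emul x y) = emul (ecnj x) (ecnj y)" "ecnj (ecnj x) = x"
  by (cases x; cases y; cases z; simp add: algebra_simps)+

lemma ered_simps:
  "ered n (eadd (ered n x) y) = ered n (eadd x y)" "ered n (eadd x (ered n y)) = ered n (eadd x y)"
  "ered n (emul (ered n x) y) = ered n (emul x y)" "ered n (emul x (ered n y)) = ered n (emul x y)"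
  "ered n (ecnj (ered n x)) = ered n (ecnj x)" "ered n (ered n x) = ered n x" "ered n (eneg (ered n x)) = ered n (eneg x)"
proof -
  obtain p q r s where [simp]: "x = (p, q)" "y = (r, s)" by (cases x; cases y)
  have [simp]: "[p mod n = p] (mod n)" "[q mod n = q] (mod n)" "[r mod n = r] (mod n)" "[s mod n = s] (mod n)"
    by (auto simp: cong_def)
  note I = cong_add cong_diff cong_mult cong_minus_minus_iff[THEN iffD2] cong_refl
  show "ered n (eadd (ered n x) y) = ered n (eadd x y)" "ered n (eadd x (ered n y)) = ered n (eadd x y)"
    "ered n (emul (ered n x) y) = ered n (emul x y)" "ered n (emul x (ered n y)) = ered n (emul x y)"
    "ered n (ecnj (ered n x)) = ered n (ecnj x)" "ered n (ered n x) = ered n x" "ered n (eneg (ered n x)) = ered n (eneg x)"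
    unfolding \<open>x = (p, q)\<close> \<open>y = (r, s)\<close> ered.simps eadd.simps emul.simps ecnj.simps eneg.simps prod.inject cong_def[symmetric]
    by (intro conjI I; simp)+
qed

lemma ered_eadd_cong: "ered n x = ered n x' \<Longrightarrow> ered n y = ered n y' \<Longrightarrow> ered n (eadd x y) = ered n (eadd x' y')"
  by (metis ered_simps(1,2))

lemma ered_emul_cong: "ered n x = ered n x' \<Longrightarrow> ered n y = ered n y' \<Longrightarrow> ered n (emul x y) = ered n (emul x' y')"
  by (metis ered_simps(3,4))

lemma ered_ecnj_cong: "ered n x = ered n x' \<Longrightarrow> ered n (ecnj x) = ered n (ecnj x')"
  by (metis ered_simps(5))

lemma ered_eneg_cong: "ered n x = ered n x' \<Longrightarrow> ered n (eneg x) = ered n (eneg x')"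
  by (metis ered_simps(7))

lemma mmul_assoc: "mmul (mmul M N) P = mmul M (mmul N P)"
  by (cases M rule: prod_cases4; cases N rule: prod_cases4; cases P rule: prod_cases4) (simp add: eis_ring_simps)

lemma mcnj_mmul: "mcnj (mmul M N) = mmul (mcnj M) (mcnj N)"
  by (cases M rule: prod_cases4; cases N rule: prod_cases4) (simp add: eis_ring_simps)

lemma mstar_mmul: "mstar (mmul M N) = mmul (mstar N) (mstar M)"
  by (cases M rule: prod_cases4; cases N rule: prod_cases4) (simp add: eis_ring_simps)

lemma mcnj_mstar: "mcnj (mstar M) = mstar (mcnj M)"
  by (cases M rule: prod_cases4) simp

lemma mcnj_mcnj: "mcnj (mcnj M) = M"
  by (cases M rule: prod_cases4) (simp add: eis_ring_simps)

lemma twist_mmul: "twist e (mmul M N) = mmul (twist e M) (twist e N)"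
  and twist_mstar: "twist e (mstar M) = mstar (twist e M)"
  and twist_twist: "twist e (twist f M) = twist (e \<noteq> f) M"
  by (auto simp: twist_def mcnj_mmul mcnj_mstar mcnj_mcnj)

lemma mred_mmul_cong:
  "mred n M = mred n M' \<Longrightarrow> mred n N = mred n N' \<Longrightarrow> mred n (mmul M N) = mred n (mmul M' N')"
  by (cases M rule: prod_cases4; cases N rule: prod_cases4; cases M' rule: prod_cases4; cases N' rule: prod_cases4) (auto intro!: ered_eadd_cong ered_emul_cong)

lemma mred_mcnj_cong: "mred n M = mred n M' \<Longrightarrow> mred n (mcnj M) = mred n (mcnj M')"
  by (cases M rule: prod_cases4; cases M' rule: prod_cases4) (auto intro!: ered_ecnj_cong)

lemma mred_mstar_cong: "mred n M = mred n M' \<Longrightarrow> mred n (mstar M) = mred n (mstar M')"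
  by (cases M rule: prod_cases4; cases M' rule: prod_cases4) (auto intro!: ered_ecnj_cong)

lemma mred_twist_cong: "mred n M = mred n M' \<Longrightarrow> mred n (twist e M) = mred n (twist e M')"
  by (cases e) (auto simp: twist_def intro: mred_mcnj_cong)

lemma mred_mred: "mred n (mred n M) = mred n M"
  by (cases M rule: prod_cases4) (simp add: ered_simps)

lemma conj_act_cong:
  "mred n M = mred n M' \<Longrightarrow> mred n X = mred n X' \<Longrightarrow> conj_act n M e X = conj_act n M' e X'"
  unfolding conj_act_def by (intro mred_mmul_cong mred_twist_cong mred_mstar_cong)

text \<open>Pairs \<open>(M, e)\<close> multiply as in a semidirect product with conjugation, and
  \<open>conj_act\<close> is an action of it. Hence \<open>preserves\<close> is stable under
  composition.\<close>

lemma conj_act_conj_act: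
  "conj_act n M e (conj_act n N f X) = conj_act n (mmul M (twist e N)) (e \<noteq> f) X"
proof -
  have "conj_act n M e (conj_act n N f X) = conj_act n M e (mmul (mmul N (twist f X)) (mstar N))"
    by (intro conj_act_cong) (auto simp: conj_act_def mred_mred)
  also have "\<dots> = conj_act n (mmul M (twist e N)) (e \<noteq> f) X"
    by (simp add: conj_act_def twist_mmul mmul_assoc mstar_mmul twist_twist twist_mstar)
  finally show ?thesis .
qed

lemma preserves_iff: "preserves M e \<longleftrightarrow> (\<forall>X\<in>set gies_orbit. conj_act 4 M e X \<in> set gies_orbit)"
  by (rule preserves_def)

lemma preserves_comp: "preserves M e \<Longrightarrow> preserves N f \<Longrightarrow> preserves (mmul M (twist e N)) (e \<noteq> f)"
  unfolding preserves_iff conj_act_conj_act[symmetric] by blast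

lemma gies_orbit_mod2: "set gies_orbit_mod2 = mred 2 ` set gies_orbit"
  by code_simp

lemma preserves_mod2:
  assumes "preserves M e" "X \<in> set gies_orbit_mod2" "mred 2 M = mred 2 M'"
  shows "conj_act 2 M' e X \<in> set gies_orbit_mod2"
proof -
  obtain Y where Y: "Y \<in> set gies_orbit" "X = mred 2 Y" using assms(2) by (auto simp: gies_orbit_mod2)
  have "conj_act 2 M' e X = conj_act 2 M e Y"
    using assms(3) Y by (intro conj_act_cong) (auto simp: mred_mred)
  also have "\<dots> = mred 2 (conj_act 4 M e Y)"
  proof -
    have "ered 2 (ered 4 x) = ered 2 x" for x by (cases x) (simp add: mod_mod_cancel)
    then have "mred 2 (mred 4 Z) = mred 2 Z" for Z by (cases Z rule: prod_cases4) simp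
    then show ?thesis by (simp add: conj_act_def)
  qed
  finally show ?thesis using assms(1) Y by (auto simp: preserves_iff gies_orbit_mod2)
qed

lemma ered2_residues: "ered 2 x \<in> set residues2"
  by (cases x) (auto simp: residues2_def)

lemma preserves_trace:
  assumes "preserves M False" "mdet M = (1, 0)"
  shows "ered 2 (mtr M) \<noteq> (1, 0)"
proof
  assume tr: "ered 2 (mtr M) = (1, 0)"
  obtain a b c d where M: "M = (a, b, c, d)" by (cases M rule: prod_cases4)
  define M' where "M' = (ered 2 a, ered 2 b, ered 2 c, eadd (1, 0) (ered 2 a))"
  have d: "ered 2 (eadd (1, 0) (ered 2 a)) = ered 2 d"
    using tr by (cases a; cases d) (auto simp: M mod_simps; presburger)
  have MM: "mred 2 M = mred 2 M'" using d by (simp add: M M'_def ered_simps)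
  have "ered 2 (mdet M') = ered 2 (mdet M)"
    using d unfolding M M'_def mdet.simps
    by (intro ered_eadd_cong ered_emul_cong ered_eneg_cong) (auto simp: ered_simps)
  then have "ered 2 (mdet M') = (1, 0)" using assms(2) by simp
  then have "\<not> (\<forall>X\<in>set gies_orbit_mod2. conj_act 2 M' False X \<in> set gies_orbit_mod2)"
    using residues2_trace ered2_residues[of a] ered2_residues[of b] ered2_residues[of c]
    unfolding M'_def Let_def by blast
  then show False using preserves_mod2[OF assms(1) _ MM] by blast
qed

lemma preserves_square:
  assumes "preserves M True"
  shows "mred 2 (mmul M (mcnj M)) \<noteq> ((1, 0), (0, 0), (0, 0), (1, 0))"
proof
  assume sq: "mred 2 (mmul M (mcnj M)) = ((1, 0), (0, 0), (0, 0), (1, 0))"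
  obtain a b c d where M: "M = (a, b, c, d)" by (cases M rule: prod_cases4)
  define M' where "M' = (ered 2 a, ered 2 b, ered 2 c, ered 2 d)"
  have MM: "mred 2 M = mred 2 M'" by (simp add: M M'_def ered_simps)
  then have "mred 2 (mmul M' (mcnj M')) = ((1, 0), (0, 0), (0, 0), (1, 0))"
    using sq mred_mmul_cong[OF MM mred_mcnj_cong[OF MM]] by simp
  then have "\<not> (\<forall>X\<in>set gies_orbit_mod2. conj_act 2 M' True X \<in> set gies_orbit_mod2)"
    using residues2_square ered2_residues[of a] ered2_residues[of b] ered2_residues[of c] ered2_residues[of d]
    unfolding M'_def Let_def by blast
  then show False using preserves_mod2[OF assms(1) _ MM] by blast
qed

lemma enorm_1_cases:
  assumes "enorm c = 1" shows "c \<in> {(1,0),(0,1),(-1,1),(-1,0),(0,-1),(1,-1)}"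
proof -
  obtain x y where c: "c = (x, y)" by (cases c)
  have e: "x * x + x * y + y * y = 1" using assms by (simp add: c)
  have "3 * (y * y) + (2 * x + y) * (2 * x + y) = 4" using e by (simp add: algebra_simps)
  then have "y * y \<le> 1" by (smt (verit) zero_le_square)
  then have y: "- 1 \<le> y \<and> y \<le> 1" by (smt (verit) mult_le_cancel_left1 mult_minus_left mult_minus_right)
  have "3 * (x * x) + (2 * y + x) * (2 * y + x) = 4" using e by (simp add: algebra_simps)
  then have "x * x \<le> 1" by (smt (verit) zero_le_square)
  then have x: "- 1 \<le> x \<and> x \<le> 1" by (smt (verit) mult_le_cancel_left1 mult_minus_left mult_minus_right)
  have "x = -1 \<or> x = 0 \<or> x = 1" "y = -1 \<or> y = 0 \<or> y = 1" using x y by presburger+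
  then show ?thesis using e by (auto simp: c)
qed

lemma preserves_not_involution:
  assumes "preserves (a, b, c, d) False" "mdet (a, b, c, d) = (1, 0)" "eadd a d = (0, 0)" "enorm c = 1"
  shows False
proof -
  have d: "d = eneg a" using assms(3) by (cases a; cases d) auto
  have cc: "emul (ecnj c) c = (1, 0)"
    using assms(4) by (cases c) (simp add: algebra_simps)
  have bc: "emul c b = eneg (eadd (1, 0) (emul a a))"
    using assms(2) by (cases a; cases b; cases c) (simp add: d algebra_simps)
  have "b = emul (emul (ecnj c) c) b" using cc by (cases b) simp
  also have "\<dots> = emul (ecnj c) (emul c b)" by (simp add: eis_ring_simps)
  also have "\<dots> = eneg (emul (ecnj c) (eadd (1, 0) (emul a a)))"
    unfolding bc by (cases c; cases "eadd (1, 0) (emul a a)") (simp add: algebra_simps)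
  finally have b: "b = eneg (emul (ecnj c) (eadd (1, 0) (emul a a)))" .
  define a' where "a' = ered 4 a"
  define M' where "M' = (a', eneg (emul (ecnj c) (eadd (1, 0) (emul a' a'))), c, eneg a')"
  have aa: "ered 4 a' = ered 4 a" by (simp add: a'_def ered_simps)
  have MM: "mred 4 (a, b, c, d) = mred 4 M'"
    unfolding M'_def b d mred.simps
    by (intro arg_cong2[where f = Pair] ered_eneg_cong ered_emul_cong ered_eadd_cong aa[symmetric] refl)
  have "a' \<in> set residues4"
  proof -
    have "x mod 4 \<in> {0, 1, 2, 3}" for x :: int by (simp, presburger)
    then have "(x mod 4, y mod 4) \<in> {0, 1, 2, 3} \<times> {0, 1, 2, 3}" for x y :: int by blast
    moreover have "set residues4 = {0, 1, 2, 3} \<times> {0, 1, 2, 3}" by (simp only: residues4_def set_product list.set)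
    ultimately show ?thesis by (cases a) (simp only: a'_def ered.simps)
  qed
  then have "conj_act 4 M' False ((0, 0), (1, 0), (3, 0), (0, 3)) \<notin> set gies_orbit"
    using residues4_involution enorm_1_cases[OF assms(4)]
    unfolding M'_def Let_def by auto
  moreover have "((0, 0), (1, 0), (3, 0), (0, 3)) \<in> set gies_orbit" by (simp add: gies_orbit_def)
  ultimately show False using assms(1) conj_act_cong[OF MM refl] by (metis preserves_iff)
qed

lemma no_square_root_of_minus_one: "emul a a \<noteq> (-1, 0)"
proof
  assume e: "emul a a = (-1, 0)"
  obtain x y where a: "a = (x, y)" by (cases a)
  have "x * x - y * y = -1" "y * (2 * x + y) = 0" using e by (auto simp: a algebra_simps)
  then have "y = 0 \<or> y = - 2 * x" by auto
  then have "x * x = - 1 \<or> 3 * (x * x) = 1" using \<open>x * x - y * y = -1\<close> by auto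
  moreover have "3 * (x * x) \<noteq> 1" by presburger
  ultimately show False using zero_le_square[of x] by simp
qed

lemma enorm_3_no_involution:
  assumes "mdet (a, b, c, d) = (1, 0)" "eadd a d = (0, 0)" shows "enorm c \<noteq> 3"
proof
  assume c3: "enorm c = 3"
  \<comment> \<open>Reduce modulo 3 along the ring homomorphism \<open>\<omega> \<mapsto> -1\<close>, which kills \<open>c\<close>.\<close>
  have not: "(1 + n * n) mod 3 \<noteq> 0" for n :: int
  proof -
    have "n mod 3 = 0 \<or> n mod 3 = 1 \<or> n mod 3 = 2" by presburger
    then have "(1 + (n mod 3) * (n mod 3)) mod 3 \<noteq> 0" by auto
    then show ?thesis by (metis mod_add_right_eq mod_mult_eq)
  qed
  have d: "d = eneg a" using assms(2) by (cases a; cases d) auto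
  obtain p q r s x y where v: "a = (p, q)" "b = (r, s)" "c = (x, y)" by (cases a; cases b; cases c)
  have "(x - y) * (x - y) = 3 * (1 - x * y)" using c3 by (simp add: v algebra_simps)
  then have z: "((x - y) * (x - y)) mod 3 = 0" by simp
  have "(x - y) mod 3 = 0"
  proof -
    have "(x - y) mod 3 = 0 \<or> (x - y) mod 3 = 1 \<or> (x - y) mod 3 = 2" by presburger
    moreover have "(((x - y) mod 3) * ((x - y) mod 3)) mod 3 = 0" using z by (simp only: mod_mult_eq)
    ultimately show ?thesis by auto
  qed
  then obtain m where m: "x - y = 3 * m" by (metis mod_0_imp_dvd dvdE)
  have e: "- (p * p - q * q) - (r * x - s * y) = 1" "- (p * q + q * p + q * q) - (r * y + s * x + s * y) = 0"
    using assms(1) by (auto simp: v d algebra_simps)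
  have "1 + (p - q) * (p - q) + (r - s) * (x - y) = 3 * (q * q + s * y) + (1 + (p * p - q * q) + (r * x - s * y))
      - (p * q + q * p + q * q) - (r * y + s * x + s * y)"
    by (simp add: algebra_simps)
  then have "1 + (p - q) * (p - q) = 3 * (q * q + s * y - (r - s) * m)"
    using e by (simp add: m algebra_simps)
  then show False using not[of "p - q"] by simp
qed


section \<open>Action on Hermitian matrices\<close>

definition rc :: "real \<Rightarrow> real \<Rightarrow> complex" where "rc u v = of_real u + of_real v * omega"

lemma omega_facts: "omega * omega = omega - 1" "cnj omega = 1 - omega" "Re omega = 1 / 2" "Im omega = sqrt 3 / 2"
proof -
  show r: "Re omega = 1 / 2" and i: "Im omega = sqrt 3 / 2"
    by (auto simp: omega_def cos_60 sin_60)
  show "omega * omega = omega - 1" "cnj omega = 1 - omega"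
    by (auto simp: complex_eq_iff r i)
qed

text \<open>In the real basis 1, \<omega> the coordinate computations become polynomial identities
  without \<open>sqrt 3\<close>.\<close>

lemma rc_simps:
  "rc u v + rc x y = rc (u + x) (v + y)" "rc u v - rc x y = rc (u - x) (v - y)" "- rc u v = rc (- u) (- v)"
  "rc u v * rc x y = rc (u * x - v * y) (u * y + v * x + v * y)" "cnj (rc u v) = rc (u + v) (- v)"
proof -
  show "rc u v * rc x y = rc (u * x - v * y) (u * y + v * x + v * y)"
  proof -
    have "rc u v * rc x y = of_real (u * x) + of_real (u * y + v * x) * omega + of_real (v * y) * (omega * omega)"
      by (simp add: rc_def algebra_simps)
    then show ?thesis unfolding omega_facts(1) by (simp add: rc_def algebra_simps)
  qed
qed (simp_all add: rc_def algebra_simps omega_facts(2))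

lemma rc_exhaust: obtains u v where "z = rc u v"
proof
  show "z = rc (Re z - Im z / sqrt 3) (2 * Im z / sqrt 3)"
    by (simp add: complex_eq_iff rc_def omega_facts)
qed

lemma rc_eq_iff: "rc u v = rc x y \<longleftrightarrow> u = x \<and> v = y"
  by (auto simp: complex_eq_iff rc_def omega_facts)

lemma rc_consts: "0 = rc 0 0" "1 = rc 1 0" "omega = rc 0 1" "of_real x = rc x 0"
  by (auto simp: rc_def)

lemma norm_rc: "(cmod (rc u v))\<^sup>2 = u * u + u * v + v * v"
proof -
  have "(cmod (rc u v))\<^sup>2 = (u + v / 2)\<^sup>2 + (v * sqrt 3 / 2)\<^sup>2"
    by (simp add: cmod_power2 rc_def omega_facts)
  also have "\<dots> = u * u + u * v + v * v" by (simp add: power2_eq_square algebra_simps)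
  finally show ?thesis .
qed

fun ez :: "eis \<Rightarrow> complex" where "ez (x, y) = rc (of_int x) (of_int y)"

lemma ez_simps:
  "ez (eadd x y) = ez x + ez y" "ez (emul x y) = ez x * ez y" "ez (eneg x) = - ez x" "ez (ecnj x) = cnj (ez x)"
  "(cmod (ez x))\<^sup>2 = of_int (enorm x)"
  by (cases x; cases y; simp add: rc_simps norm_rc)+

lemma ez_eq_iff: "ez x = ez y \<longleftrightarrow> x = y"
  by (cases x; cases y) (simp add: rc_eq_iff)

type_synonym cmat = "complex \<times> complex \<times> complex \<times> complex"

fun cz :: "eis_mat \<Rightarrow> cmat" where "cz (a, b, c, d) = (ez a, ez b, ez c, ez d)"

fun cmmul :: "cmat \<Rightarrow> cmat \<Rightarrow> cmat" where
  "cmmul (a, b, c, d) (e, f, g, h) = (a * e + b * g, a * f + b * h, c * e + d * g, c * f + d * h)"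

text \<open>Points of hyperbolic 3-space are the positive definite Hermitian matrices of determinant
  \<open>1\<close>: \<open>herm p\<close> lists the entries \<open>(1,1)\<close>, \<open>(1,2)\<close>, \<open>(2,2)\<close>, and \<open>cact M\<close> is \<open>H \<mapsto> M H M\<^sup>*\<close>, which for
  \<open>M\<close> of determinant \<open>1\<close> is the Poincare extension of the Moebius map of \<open>M\<close>.\<close>
definition herm :: "complex \<times> real \<Rightarrow> complex \<times> complex \<times> complex" where
  "herm p = (of_real (((cmod (fst p))\<^sup>2 + (snd p)\<^sup>2) / snd p), fst p / of_real (snd p), of_real (1 / snd p))"

fun cact :: "cmat \<Rightarrow> complex \<times> complex \<times> complex \<Rightarrow> complex \<times> complex \<times> complex" where
  "cact (a, b, c, d) (p, q, r) =
    (a * cnj a * p + a * cnj b * q + cnj a * b * cnj q + b * cnj b * r,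
     a * cnj c * p + a * cnj d * q + b * cnj c * cnj q + b * cnj d * r,
     c * cnj c * p + c * cnj d * q + cnj c * d * cnj q + d * cnj d * r)"

fun hcnj :: "bool \<Rightarrow> complex \<times> complex \<times> complex \<Rightarrow> complex \<times> complex \<times> complex" where
  "hcnj e (p, q, r) = (p, if e then cnj q else q, r)"

text \<open>A triple omits the entry (2,1), which is recovered as a conjugate; real diagonal entries
  are what makes \<open>cact\<close> compose.\<close>

fun hreal :: "complex \<times> complex \<times> complex \<Rightarrow> bool" where "hreal (p, q, r) \<longleftrightarrow> cnj p = p \<and> cnj r = r"

lemma hreal_herm: "hreal (herm p)" by (simp add: herm_def)
lemma hreal_hcnj: "hreal T \<Longrightarrow> hreal (hcnj e T)" by (cases T) auto

lemma cz_mmul: "cz (mmul M N) = cmmul (cz M) (cz N)"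
  by (cases M rule: prod_cases4; cases N rule: prod_cases4) (simp add: ez_simps)

lemma cact_cact:
  assumes "hreal T" shows "cact M (cact N T) = cact (cmmul M N) T"
proof -
  obtain p q r where T: "T = (p, q, r)" by (cases T)
  have "cnj p = p" "cnj r = r" using assms by (auto simp: T)
  then show ?thesis
    by (cases M rule: prod_cases4; cases N rule: prod_cases4) (simp add: T algebra_simps)
qed

lemma hcnj_cact: "hreal T \<Longrightarrow> hcnj e (cact (cz M) T) = cact (cz (twist e M)) (hcnj e T)"
  by (cases T; cases M rule: prod_cases4; cases e) (simp_all add: twist_def ez_simps)

lemma hcnj_hcnj: "hcnj e (hcnj f T) = hcnj (e \<noteq> f) T" by (cases T) auto

lemma herm_inj: "p \<in> hspace \<Longrightarrow> q \<in> hspace \<Longrightarrow> herm p = herm q \<Longrightarrow> p = q"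
  by (auto simp: herm_def hspace_def prod_eq_iff)

definition represents :: "(complex \<times> real \<Rightarrow> complex \<times> real) \<Rightarrow> eis_mat \<Rightarrow> bool \<Rightarrow> bool" where
  "represents \<gamma> M e \<longleftrightarrow> hyp_isom \<gamma> \<and> mdet M = (1, 0) \<and> preserves M e
     \<and> (\<forall>p\<in>hspace. herm (\<gamma> p) = cact (cz M) (hcnj e (herm p)))"

lemma mdet_mmul: "mdet (mmul M N) = emul (mdet M) (mdet N)"
proof -
  have "ez (mdet (mmul M N)) = ez (emul (mdet M) (mdet N))"
    by (cases M rule: prod_cases4; cases N rule: prod_cases4) (simp add: ez_simps algebra_simps)
  then show ?thesis by (simp add: ez_eq_iff)
qed

lemma mdet_twist: "mdet M = (1, 0) \<Longrightarrow> mdet (twist e M) = (1, 0)"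
proof -
  assume "mdet M = (1, 0)"
  then have "ez (mdet M) = 1" by (simp add: rc_def)
  moreover have "ez (mdet (mcnj M)) = cnj (ez (mdet M))"
    by (cases M rule: prod_cases4) (simp add: ez_simps)
  ultimately have "ez (mdet (mcnj M)) = ez (1, 0)" by (simp add: rc_def)
  then have "mdet (mcnj M) = (1, 0)" by (simp only: ez_eq_iff)
  then show ?thesis using \<open>mdet M = (1, 0)\<close> by (simp add: twist_def)
qed

lemma rep_comp:
  assumes "represents \<gamma> M e" "represents \<delta> N f"
  shows "represents (\<gamma> \<circ> \<delta>) (mmul M (twist e N)) (e \<noteq> f)"
proof -
  have "herm ((\<gamma> \<circ> \<delta>) p) = cact (cz (mmul M (twist e N))) (hcnj (e \<noteq> f) (herm p))" if p: "p \<in> hspace" for p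
  proof -
    have "\<delta> p \<in> hspace" using assms(2) p by (auto simp: represents_def hyp_isom_in)
    then have "herm ((\<gamma> \<circ> \<delta>) p) = cact (cz M) (hcnj e (cact (cz N) (hcnj f (herm p))))"
      using assms p by (simp add: represents_def)
    also have "\<dots> = cact (cz M) (cact (cz (twist e N)) (hcnj e (hcnj f (herm p))))"
      by (simp add: hcnj_cact hreal_hcnj hreal_herm)
    finally show ?thesis by (simp add: cact_cact hreal_hcnj hreal_herm hcnj_hcnj cz_mmul)
  qed
  moreover have "mdet (mmul M (twist e N)) = (1, 0)"
    using assms mdet_twist[of N e] by (simp add: mdet_mmul represents_def)
  ultimately show ?thesis
    using assms hyp_isom_comp[of \<gamma> \<delta>] preserves_comp[of M e N f] by (simp add: represents_def)
qed

lemma cact_id: "cact (1, 0, 0, 1) T = T" by (cases T) simp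

lemma cact_neg: "cact (- a, - b, - c, - d) T = cact (a, b, c, d) T" by (cases T) simp

text \<open>The adjugate inverts a determinant-one matrix; for a reversing element the conjugation
  then has to be moved back in front of it, which twists it.\<close>

lemma rep_inv:
  assumes r: "represents \<gamma> M e" and p: "preserves (twist e (madj M)) e"
  shows "represents (inv \<gamma>) (twist e (madj M)) e"
proof -
  have i: "hyp_isom \<gamma>" and d: "mdet M = (1, 0)" using r by (auto simp: represents_def)
  obtain a b c d where M: "M = (a, b, c, d)" by (cases M rule: prod_cases4)
  have dd: "ez a * ez d - ez b * ez c = 1"
    using arg_cong[OF d, of ez] by (simp add: M ez_simps rc_def)
  have "cmmul (cz (madj M)) (cz M) = (1, 0, 0, 1)"
    using dd by (simp add: M ez_simps algebra_simps)
  then have inverse: "cact (cz (madj M)) (cact (cz M) T) = T" if "hreal T" for T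
    using that by (simp add: cact_cact cact_id)
  have "herm (inv \<gamma> q) = cact (cz (twist e (madj M))) (hcnj e (herm q))" if q: "q \<in> hspace" for q
  proof -
    have iq: "inv \<gamma> q \<in> hspace" using hyp_isom_in[OF hyp_isom_inv[OF i] q] .
    have "herm q = cact (cz M) (hcnj e (herm (inv \<gamma> q)))"
      using r iq i by (auto simp: represents_def)
    then have "cact (cz (madj M)) (herm q) = hcnj e (herm (inv \<gamma> q))"
      by (simp add: inverse hreal_hcnj hreal_herm)
    then have "hcnj e (cact (cz (madj M)) (herm q)) = herm (inv \<gamma> q)"
      by (simp add: hcnj_hcnj) (cases "herm (inv \<gamma> q)", simp)
    then show ?thesis by (simp add: hcnj_cact hreal_herm)
  qed
  moreover have "mdet (twist e (madj M)) = (1, 0)"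
  proof (rule mdet_twist)
    have "ez (mdet (madj M)) = ez (1, 0)" using dd by (simp add: M ez_simps rc_def algebra_simps)
    then show "mdet (madj M) = (1, 0)" by (simp only: ez_eq_iff)
  qed
  ultimately show ?thesis using p hyp_isom_inv[OF i] by (simp add: represents_def)
qed

lemma rep_unique:
  assumes "represents \<gamma> M e" "represents \<delta> M e" shows "\<gamma> = \<delta>"
proof
  fix p show "\<gamma> p = \<delta> p"
  proof (cases "p \<in> hspace")
    case True
    then show ?thesis using assms by (intro herm_inj) (auto simp: represents_def hyp_isom_in)
  next
    case False
    then show ?thesis using assms by (simp add: represents_def hyp_isom_notin)
  qed
qed

text \<open>Twice the cosh of a distance is the polarised determinant of the two Hermitian matrices.
  Written as a sum of nonnegative terms, it bounds all matrix entries and, at a fixed point, the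
  trace.\<close>

lemma rep_ch:
  fixes z :: complex
  assumes r: "represents \<gamma> (a, b, c, d) e" and t: "t > 0"
  defines "w \<equiv> if e then cnj z else z"
  shows "2 * t\<^sup>2 * coshd (z, t) (\<gamma> (z, t)) = (cmod (z * (ez c * w + ez d) - (ez a * w + ez b)))\<^sup>2
     + t\<^sup>2 * ((cmod (ez c * z - ez a))\<^sup>2 + (cmod (ez c * w + ez d))\<^sup>2) + (cmod (ez c))\<^sup>2 * t ^ 4"
proof -
  define A B C D where "A = ez a" and "B = ez b" and "C = ez c" and "D = ez d"
  have p: "(z, t) \<in> hspace" using t by (simp add: hspace_def)
  then have "\<gamma> (z, t) \<in> hspace" using r by (auto simp: represents_def hyp_isom_in)
  then obtain z' t' where q: "\<gamma> (z, t) = (z', t')" "t' > 0" by (cases "\<gamma> (z, t)") (auto simp: hspace_def)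
  define T N where "T = complex_of_real t" and "N = z * cnj z + T * T"
  have N: "of_real ((cmod z)\<^sup>2 + t\<^sup>2) = N"
    by (simp add: N_def T_def complex_norm_square[symmetric] power2_eq_square flip: of_real_mult)
  have T: "T \<noteq> 0" "cnj T = T" using t by (auto simp: T_def)
  have H: "herm (\<gamma> (z, t)) = cact (A, B, C, D) (N / T, w / T, 1 / T)"
  proof -
    have "herm (\<gamma> (z, t)) = cact (cz (a, b, c, d)) (hcnj e (herm (z, t)))"
      using r p by (auto simp: represents_def)
    moreover have "hcnj e (herm (z, t)) = (N / T, w / T, 1 / T)"
      using N by (simp add: herm_def w_def T_def)
    ultimately show ?thesis by (simp add: A_def B_def C_def D_def)
  qed
  define \<alpha> \<beta> \<delta> where "\<alpha> = A * cnj A * N + A * cnj B * w + cnj A * B * cnj w + B * cnj B"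
    and "\<beta> = A * cnj C * N + A * cnj D * w + B * cnj C * cnj w + B * cnj D"
    and "\<delta> = C * cnj C * N + C * cnj D * w + cnj C * D * cnj w + D * cnj D"
  have e: "of_real (((cmod z')\<^sup>2 + t'\<^sup>2) / t') = \<alpha> / T" "z' / of_real t' = \<beta> / T" "of_real (1 / t') = \<delta> / T"
    using H T by (simp_all add: herm_def q \<alpha>_def \<beta>_def \<delta>_def add_divide_distrib)
  have "complex_of_real (2 * t\<^sup>2 * coshd (z, t) (\<gamma> (z, t))) = N * \<delta> + \<alpha> - cnj z * \<beta> - z * cnj \<beta>"
  proof -
    have "2 * t\<^sup>2 * coshd (z, t) (z', t') = t * (((cmod z)\<^sup>2 + t\<^sup>2) * (1 / t') + ((cmod z')\<^sup>2 + t'\<^sup>2) / t'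
        - 2 * Re (cnj z * (z' / of_real t')))"
    proof -
      have "(norm (z - z'))\<^sup>2 = (cmod z)\<^sup>2 + (cmod z')\<^sup>2 - 2 * Re (cnj z * z')"
        by (simp only: cmod_power2) (simp add: power2_eq_square algebra_simps)
      moreover have "Re (cnj z * (z' / of_real t')) = Re (cnj z * z') / t'"
        by (simp only: times_divide_eq_right Re_divide_of_real)
      moreover have "2 * t\<^sup>2 * ((n + m - 2 * R + t\<^sup>2 + t'\<^sup>2) / (2 * t * t'))
          = t * ((n + t\<^sup>2) * (1 / t') + (m + t'\<^sup>2) / t' - 2 * (R / t'))" for n m R :: real
        using t q(2) by (simp add: divide_simps power2_eq_square algebra_simps)
      ultimately show ?thesis using t q(2) by (simp only: coshd_eq fst_conv snd_conv)
    qed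
    then have "complex_of_real (2 * t\<^sup>2 * coshd (z, t) (z', t'))
        = of_real t * (of_real ((cmod z)\<^sup>2 + t\<^sup>2) * of_real (1 / t') + of_real (((cmod z')\<^sup>2 + t'\<^sup>2) / t')
          - of_real (2 * Re (cnj z * (z' / of_real t'))))"
      by (simp only: of_real_mult of_real_add of_real_diff)
    then have "complex_of_real (2 * t\<^sup>2 * coshd (z, t) (\<gamma> (z, t)))
        = T * (N * (\<delta> / T) + \<alpha> / T - (cnj z * (\<beta> / T) + cnj (cnj z * (\<beta> / T))))"
      unfolding q(1) e N T_def[symmetric] complex_add_cnj[symmetric] .
    then show ?thesis using T by (simp add: algebra_simps)
  qed
  also have "\<dots> = of_real ((cmod (z * (C * w + D) - (A * w + B)))\<^sup>2
     + t\<^sup>2 * ((cmod (C * z - A))\<^sup>2 + (cmod (C * w + D))\<^sup>2) + (cmod C)\<^sup>2 * t ^ 4)"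
  proof -
    have 4: "t ^ 4 = t\<^sup>2 * t\<^sup>2" by (simp add: power2_eq_square power4_eq_xxxx)
    show ?thesis
      unfolding of_real_add of_real_mult 4 complex_norm_square
      unfolding \<alpha>_def \<beta>_def \<delta>_def N_def w_def power2_eq_square of_real_mult T_def[symmetric]
      by (cases e) (simp_all add: algebra_simps T)
  qed
  finally show ?thesis unfolding A_def B_def C_def D_def of_real_eq_iff .
qed

section \<open>The Gieseking group\<close>

lemma hyp_isom_isometry:
  fixes f :: "complex \<Rightarrow> complex"
  assumes "\<And>z w. cmod (f z - f w) = cmod (z - w)" "\<And>z. g (f z) = z" "\<And>z. f (g z) = z"
  shows "hyp_isom (\<lambda>p. if snd p > 0 then (f (fst p), snd p) else p)"
  by (rule hyp_isomI[where g = "\<lambda>p. if snd p > 0 then (g (fst p), snd p) else p"])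
    (auto simp: hspace_def assms coshd_def)

lemma cmod_omega: "cmod omega = 1" "cmod (cnj omega) = 1"
  by (auto simp: omega_def)

lemma omega_cnj: "omega * cnj omega = 1" "cnj omega * omega = 1" "omega \<noteq> 0"
proof -
  have "omega * cnj omega = of_real ((cmod omega)\<^sup>2)" by (rule complex_norm_square[symmetric])
  then show "omega * cnj omega = 1" by (simp add: cmod_omega)
  then show "cnj omega * omega = 1" by (simp add: mult.commute)
  show "omega \<noteq> 0" using cmod_omega by auto
qed

lemma gies_g1_eq: "gies_g1 p = (if snd p > 0 then (cnj omega * (1 - cnj (fst p)), snd p) else p)"
proof -
  have "(cnj (fst p) - 1) / (- omega) = cnj omega * (1 - cnj (fst p))"
  proof -
    have "inverse omega = cnj omega" using omega_cnj(1) by (rule inverse_unique)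
    then show ?thesis by (simp add: divide_inverse algebra_simps)
  qed
  then show ?thesis by (simp add: gies_g1_def)
qed

lemma hyp_isom_gies_g1: "hyp_isom gies_g1"
proof -
  have "hyp_isom (\<lambda>p. if snd p > 0 then (cnj omega * (1 - cnj (fst p)), snd p) else p)"
  proof (rule hyp_isom_isometry[where g = "\<lambda>z. 1 - cnj omega * cnj z"])
    fix z w
    have "cnj omega * (1 - cnj z) - cnj omega * (1 - cnj w) = cnj omega * cnj (w - z)"
      by (simp add: algebra_simps)
    then show "cmod (cnj omega * (1 - cnj z) - cnj omega * (1 - cnj w)) = cmod (z - w)"
      by (simp only: norm_mult cmod_omega complex_mod_cnj norm_minus_commute)
    show "1 - cnj omega * cnj (cnj omega * (1 - cnj z)) = z" "cnj omega * (1 - cnj (1 - cnj omega * cnj z)) = z"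
      using omega_cnj by (simp_all add: mult.assoc[symmetric])
  qed
  then show ?thesis by (simp add: gies_g1_eq[abs_def])
qed

text \<open>On the boundary \<open>inversion 0\<close> is \<open>z \<mapsto> 1 / cnj z\<close>, and
  it conjugates the second generator to the Euclidean isometry
  \<open>z \<mapsto> cnj z + \<omega>\<close>.\<close>

lemma gies_g2_inversion:
  "gies_g2 = inversion 0 \<circ> (\<lambda>p. if snd p > 0 then (cnj (fst p) + omega, snd p) else p) \<circ> inversion 0"
proof
  fix p :: "complex \<times> real"
  show "gies_g2 p = (inversion 0 \<circ> (\<lambda>p. if snd p > 0 then (cnj (fst p) + omega, snd p) else p) \<circ> inversion 0) p"
  proof (cases "snd p > 0")
    case False
    then show ?thesis by (simp add: gies_g2_def inversion_def)
  next
    case True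
    obtain z t where p: "p = (z, t)" "t > 0" using True by (cases p) auto
    define N where "N = (cmod z)\<^sup>2 + t\<^sup>2"
    define d where "d = (cmod (cnj omega * cnj z + 1))\<^sup>2 + t\<^sup>2"
    have N: "N > 0" and d: "d > 0" using p(2) by (auto simp: N_def d_def intro!: add_nonneg_pos)
    define s where "s = cnj (of_real (inverse N) * z) + omega"
    define M where "M = (cmod s)\<^sup>2 + (t / N)\<^sup>2"
    have Ns: "of_real N * s = cnj z + of_real N * omega" using N by (simp add: s_def algebra_simps)
    have NM: "N * M = d"
    proof -
      \<comment> \<open>The cross term \<open>2 * Re (omega * z)\<close>, common to both squared
        moduli.\<close>
      define k where "k = Re z - sqrt 3 * Im z"
      have N': "(Re z)\<^sup>2 + (Im z)\<^sup>2 + t\<^sup>2 = N" by (simp add: N_def cmod_power2)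
      have "d = ((Re z)\<^sup>2 + (Im z)\<^sup>2 + t\<^sup>2) + 1 + k"
        by (simp only: d_def k_def cmod_power2) (simp add: omega_facts(3,4) power2_eq_square field_simps)
      then have d': "d = N + 1 + k" unfolding N' .
      have "(cmod (cnj z + of_real N * omega))\<^sup>2 + t\<^sup>2 = ((Re z)\<^sup>2 + (Im z)\<^sup>2 + t\<^sup>2) + N * N + N * k"
        by (simp only: k_def cmod_power2) (simp add: omega_facts(3,4) power2_eq_square field_simps)
      then have "(cmod (of_real N * s))\<^sup>2 + t\<^sup>2 = N * d" unfolding N' Ns d' by (simp add: algebra_simps)
      moreover have "N * (N * M) = (cmod (of_real N * s))\<^sup>2 + t\<^sup>2"
      proof -
        have "N * N * (t / N)\<^sup>2 = t\<^sup>2" using N by (simp add: power2_eq_square)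
        then show ?thesis using N by (simp add: M_def norm_mult power_mult_distrib power2_eq_square algebra_simps)
      qed
      ultimately have "N * (N * M) = N * d" by simp
      then show ?thesis using N by simp
    qed
    have M: "M > 0" using N d NM by (metis zero_less_mult_pos)
    have "inversion 0 (z, t) = (of_real (inverse N) * z, t / N)"
      using p(2) by (simp add: inversion_def N_def scaleR_conv_of_real)
    then have r: "(inversion 0 \<circ> (\<lambda>p. if snd p > 0 then (cnj (fst p) + omega, snd p) else p) \<circ> inversion 0) p
        = (of_real (inverse M) * s, t / N / M)"
      using p N by (simp add: inversion_def M_def s_def scaleR_conv_of_real)
    have num: "cnj z * cnj (cnj omega * cnj z + 1) + omega * complex_of_real (t\<^sup>2) = of_real N * s"

    proof -
      have "complex_of_real N = z * cnj z + of_real (t\<^sup>2)" by (simp only: N_def complex_norm_square of_real_add)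
      then show ?thesis unfolding Ns by (simp add: algebra_simps)
    qed
    have "gies_g2 p = (of_real N * s / of_real d, t / d)"
      unfolding num[symmetric] d_def using p by (simp add: gies_g2_def Let_def)
    moreover have "of_real N * s / of_real d = of_real (inverse M) * s"
      unfolding NM[symmetric] using N M by (simp add: divide_inverse)
    ultimately show ?thesis unfolding r NM[symmetric] by simp
  qed
qed

lemma hyp_isom_gies_g2: "hyp_isom gies_g2"
  unfolding gies_g2_inversion
proof (intro hyp_isom_comp hyp_isom_inversion, rule hyp_isom_isometry[where g = "\<lambda>z. cnj (z - omega)"])
  fix z w
  show "cmod (cnj z + omega - (cnj w + omega)) = cmod (z - w)"
    by (metis add_diff_cancel_right complex_cnj_diff complex_mod_cnj)
qed auto

lemma rc_divide: "rc a b / of_real d = rc (a / d) (b / d)"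
  by (simp add: rc_def add_divide_distrib)

lemma herm_rc:
  "t > 0 \<Longrightarrow> herm (rc u v, t) = (rc ((u * u + u * v + v * v + t\<^sup>2) / t) 0, rc (u / t) (v / t), rc (1 / t) 0)"
  by (simp only: herm_def fst_conv snd_conv norm_rc rc_divide) (simp add: rc_def)

lemma rep_gies_g1: "represents gies_g1 gies_matrix1 True"
proof -
  have "herm (gies_g1 p) = cact (cz gies_matrix1) (hcnj True (herm p))" if ph: "p \<in> hspace" for p
  proof -
    obtain z t where "p = (z, t)" "t > 0" using ph by (cases p) (auto simp: hspace_def)
    moreover obtain u v where "z = rc u v" by (rule rc_exhaust)
    ultimately have p: "p = (rc u v, t)" "t > 0" by auto
    have "gies_g1 p = (rc (1 - u) (u + v - 1), t)"
      using p by (simp add: gies_g1_eq rc_consts rc_simps) (simp add: rc_eq_iff)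
    then show ?thesis using p
      by (simp add: herm_rc gies_matrix1_def rc_simps) (simp add: rc_eq_iff field_simps)
  qed
  then show ?thesis using preserves_generators hyp_isom_gies_g1 by (simp add: represents_def gies_matrix1_def)
qed

lemma gies_g1_rc: "t > 0 \<Longrightarrow> gies_g1 (rc u v, t) = (rc (1 - u) (u + v - 1), t)"
proof -
  have "cnj omega * (1 - cnj (rc u v)) = rc (1 - u) (u + v - 1)"
    unfolding rc_consts(2,3) rc_simps by (simp add: rc_eq_iff)
  then show "t > 0 \<Longrightarrow> ?thesis" by (simp add: gies_g1_eq)
qed

lemma gies_g2_rc:
  fixes u v t :: real
  assumes t: "t > 0"
  defines "N \<equiv> u * u + u * v + v * v + t\<^sup>2"
  defines "d \<equiv> N + 1 + u - v"
  shows "gies_g2 (rc u v, t) = (rc ((u + v) / d) ((N - v) / d), t / d)"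
proof -
  have e: "cnj omega * cnj (rc u v) + 1 = rc (u + 1) (- u - v)"
    unfolding rc_consts(2,3) rc_simps by (simp add: rc_eq_iff)
  have d: "(cmod (rc (u + 1) (- u - v)))\<^sup>2 + t\<^sup>2 = d"
    by (simp add: norm_rc d_def N_def algebra_simps)
  have n: "cnj (rc u v) * cnj (rc (u + 1) (- u - v)) + omega * complex_of_real (t\<^sup>2) = rc (u + v) (N - v)"
    unfolding rc_consts(3,4) rc_simps by (simp add: rc_eq_iff N_def algebra_simps power2_eq_square)
  show ?thesis using t unfolding gies_g2_def Let_def fst_conv snd_conv e d n by (simp add: rc_divide)
qed

lemma gies_g2_denominator_pos:
  fixes u v t :: real
  assumes "t > 0" shows "u * u + u * v + v * v + t\<^sup>2 + 1 + u - v > 0"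
proof -
  have "u * u + u * v + v * v + 1 + u - v = (u + v / 2 + 1 / 2)\<^sup>2 + 3 / 4 * (v - 1)\<^sup>2"
    by (simp add: power2_eq_square field_simps)
  moreover have "\<dots> \<ge> 0" by simp
  moreover have "t\<^sup>2 > 0" using assms by simp
  ultimately show ?thesis by linarith
qed

lemma rep_gies_g2: "represents gies_g2 gies_matrix2 True"
proof -
  have "herm (gies_g2 p) = cact (cz gies_matrix2) (hcnj True (herm p))" if ph: "p \<in> hspace" for p
  proof -
    obtain z t where "p = (z, t)" "t > 0" using ph by (cases p) (auto simp: hspace_def)
    moreover obtain u v where "z = rc u v" by (rule rc_exhaust)
    ultimately have p: "p = (rc u v, t)" and t: "t > 0" by auto
    define N d where "N = u * u + u * v + v * v + t\<^sup>2" and "d = N + 1 + u - v"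
    have d: "d > 0" using gies_g2_denominator_pos[OF t, of u v] by (simp add: d_def N_def)
    have "herm (gies_g2 p) = herm (rc ((u + v) / d) ((N - v) / d), t / d)"
      unfolding p gies_g2_rc[OF t] N_def d_def by simp
    also have "\<dots> = (rc (N / t) 0, rc ((u + v) / t) ((N - v) / t), rc (d / t) 0)"
    proof -
      have "(u + v) * (u + v) + (u + v) * (N - v) + (N - v) * (N - v) + t\<^sup>2 = N * d"
        unfolding d_def by (simp add: N_def algebra_simps)
      then have "((u + v) / d * ((u + v) / d) + (u + v) / d * ((N - v) / d) + (N - v) / d * ((N - v) / d) + (t / d)\<^sup>2) / (t / d) = N / t"
      proof -
        have "x / d * (x / d) + x / d * (y / d) + y / d * (y / d) + (t / d)\<^sup>2 = (x * x + x * y + y * y + t\<^sup>2) / (d * d)" for x y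
          by (simp add: add_divide_distrib power2_eq_square)
        then have "((u + v) / d * ((u + v) / d) + (u + v) / d * ((N - v) / d) + (N - v) / d * ((N - v) / d) + (t / d)\<^sup>2) / (t / d)
          = N * d / (d * d) / (t / d)"
          using \<open>_ = N * d\<close> by simp
        then show ?thesis using d t by simp
      qed
      then show ?thesis using d t by (simp add: herm_rc)
    qed
    also have "\<dots> = cact (cz gies_matrix2) (hcnj True (herm p))"
      using t unfolding p herm_rc[OF t] N_def[symmetric]
      by (simp add: gies_matrix2_def rc_simps) (simp add: rc_eq_iff d_def field_simps)
    finally show ?thesis .
  qed
  then show ?thesis using preserves_generators hyp_isom_gies_g2 by (simp add: represents_def gies_matrix2_def)
qed

text \<open>The inverse rule applies to arbitrary words. Carrying the property for \<open>f\<close>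
  and \<open>inv f\<close> together reduces it to inverses of generators.\<close>

lemma generated_group_induct_inv:
  assumes f: "f \<in> generated_group G"
    and gen: "\<And>g. g \<in> G \<Longrightarrow> P g \<and> P (inv g)" and id: "P id"
    and comp: "\<And>f g. P f \<Longrightarrow> P g \<Longrightarrow> P (f \<circ> g)" and bij: "\<And>f. P f \<Longrightarrow> bij f"
  shows "P f"
proof -
  have "P f \<and> P (inv f)" using f
  proof induction
    case (comp f g)
    then have "inv (f \<circ> g) = inv g \<circ> inv f" using bij by (intro o_inv_distrib) auto
    then show ?case using comp.IH assms(4)[of f g] assms(4)[of "inv g" "inv f"] by metis
  next
    case (inverse f)
    then have "inv (inv f) = f" using bij by (intro inv_inv_eq) auto
    then show ?case using inverse.IH by simp
  next
    case ident
    show ?case using id by (metis inv_id)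
  qed (use gen in blast)
  then show ?thesis ..
qed

lemma rep_id: "represents id ((1, 0), (0, 0), (0, 0), (1, 0)) False"
proof -
  have "conj_act 4 ((1, 0), (0, 0), (0, 0), (1, 0)) False X = X" if "X \<in> set gies_orbit" for X
  proof -
    have "\<forall>X\<in>set gies_orbit. conj_act 4 ((1, 0), (0, 0), (0, 0), (1, 0)) False X = X" by code_simp
    then show ?thesis using that by blast
  qed
  then have "preserves ((1, 0), (0, 0), (0, 0), (1, 0)) False" by (simp add: preserves_iff)
  moreover have "hcnj False T = T" for T by (cases T) simp
  ultimately show ?thesis
    using cact_id by (simp add: represents_def hyp_isom_id rc_def)
qed

lemma rep_gies_inv: "represents (inv gies_g1) (mcnj (madj gies_matrix1)) True" "represents (inv gies_g2) (mcnj (madj gies_matrix2)) True"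
  using rep_inv[OF rep_gies_g1] rep_inv[OF rep_gies_g2] preserves_generators by (simp_all add: twist_def)

lemma gies_rep:
  assumes "\<gamma> \<in> Gieseking" shows "\<exists>M e. represents \<gamma> M e"
proof (rule generated_group_induct_inv[OF assms[unfolded Gieseking_def]])
  fix g assume "g \<in> {gies_g1, gies_g2}"
  then show "(\<exists>M e. represents g M e) \<and> (\<exists>M e. represents (inv g) M e)"
    using rep_gies_g1 rep_gies_g2 rep_gies_inv by blast
next
  show "bij f" if "\<exists>M e. represents f M e" for f using that hyp_isom_bij unfolding represents_def by blast
qed (use rep_id rep_comp in blast)+

lemma gies_isom_group: "isom_group Gieseking"
  using gies_rep unfolding isom_group_def Gieseking_def represents_def
  by (blast intro: generated_group.intros)

lemma gies_gens: "gies_g1 \<in> Gieseking" "gies_g2 \<in> Gieseking"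
  by (auto simp: Gieseking_def intro: generated_group.intros)

section \<open>Discreteness of the Gieseking group\<close>

lemma finite_bounded_eis: "finite {x. cmod (ez x) \<le> K}"
proof -
  define k where "k = \<lfloor>K\<^sup>2\<rfloor>"
  have "x \<in> {-(2*k)..2*k} \<times> {-(2*k)..2*k}" if "cmod (ez x) \<le> K" for x
  proof -
    obtain a b where x: "x = (a, b)" by (cases x)
    have "(cmod (ez x))\<^sup>2 \<le> K\<^sup>2" using that by (intro power_mono) auto
    then have k: "enorm x \<le> k" unfolding ez_simps(5) k_def by (simp add: le_floor_iff)
    have sq: "\<bar>m\<bar> \<le> m * m" for m :: int
    proof (cases "m = 0")
      case False
      then have "\<bar>m\<bar> * 1 \<le> \<bar>m\<bar> * \<bar>m\<bar>" by (intro mult_left_mono) auto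
      then show ?thesis by (simp add: abs_mult_self_eq)
    qed simp
    have "4 * enorm x = (2 * a + b) * (2 * a + b) + 3 * (b * b)" "4 * enorm x = (2 * b + a) * (2 * b + a) + 3 * (a * a)"
      by (simp_all add: x algebra_simps)
    then have "3 * (a * a) \<le> 4 * k" "3 * (b * b) \<le> 4 * k"
      using k zero_le_square[of "2 * a + b"] zero_le_square[of "2 * b + a"] by linarith+
    moreover have "a * a \<ge> 0" "b * b \<ge> 0" by auto
    ultimately have "\<bar>a\<bar> \<le> 2 * k" "\<bar>b\<bar> \<le> 2 * k" using sq[of a] sq[of b] by linarith+
    then show ?thesis by (auto simp: x abs_le_iff minus_le_iff)
  qed
  then have "{x. cmod (ez x) \<le> K} \<subseteq> {-(2*k)..2*k} \<times> {-(2*k)..2*k}" by blast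
  then show ?thesis by (rule finite_subset) simp
qed

text \<open>Each summand in \<open>rep_ch\<close> is at most \<open>Q\<^sup>2\<close>. This bounds
  \<open>c\<close>, then \<open>a\<close> and \<open>d\<close> by the triangle inequality, and
  finally \<open>b\<close>.\<close>

lemma rep_entries_bounded:
  assumes t: "t > 0" and D: "D \<ge> 0"
  obtains K where "\<And>\<gamma> a b c d e. represents \<gamma> (a, b, c, d) e \<Longrightarrow> coshd (z, t) (\<gamma> (z, t)) \<le> D
    \<Longrightarrow> cmod (ez a) \<le> K \<and> cmod (ez b) \<le> K \<and> cmod (ez c) \<le> K \<and> cmod (ez d) \<le> K"
proof -
  define Q where "Q = sqrt (2 * t\<^sup>2 * D)"
  define K1 where "K1 = Q / t\<^sup>2"
  define K2 where "K2 = K1 * cmod z + Q / t"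
  define K3 where "K3 = cmod z * (Q / t) + K2 * cmod z + Q"
  have Q: "Q \<ge> 0" using D by (simp add: Q_def)
  have K: "K1 \<ge> 0" "K2 \<ge> 0" "K3 \<ge> 0" using Q t by (auto simp: K1_def K2_def K3_def)
  show ?thesis
  proof (rule that[of "K1 + K2 + K3"])
    fix \<gamma> a b c d e assume r: "represents \<gamma> (a, b, c, d) e" and le: "coshd (z, t) (\<gamma> (z, t)) \<le> D"
    define w where "w = (if e then cnj z else z)"
    have wz: "cmod w = cmod z" by (simp add: w_def)
    define x1 x2 x3 where "x1 = cmod (z * (ez c * w + ez d) - (ez a * w + ez b))"
      and "x2 = cmod (ez c * z - ez a)" and "x3 = cmod (ez c * w + ez d)"
    have "x1\<^sup>2 + t\<^sup>2 * (x2\<^sup>2 + x3\<^sup>2) + (cmod (ez c))\<^sup>2 * t ^ 4 = 2 * t\<^sup>2 * coshd (z, t) (\<gamma> (z, t))"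
      using rep_ch[OF r t, of z] unfolding w_def[symmetric] x1_def x2_def x3_def by simp
    also have "\<dots> \<le> 2 * t\<^sup>2 * D" using le by (intro mult_left_mono) auto
    also have "\<dots> = Q\<^sup>2" using D by (simp add: Q_def)
    finally have "x1\<^sup>2 + (t * x2)\<^sup>2 + (t * x3)\<^sup>2 + (cmod (ez c) * t\<^sup>2)\<^sup>2 \<le> Q\<^sup>2"
      by (simp add: power_mult_distrib distrib_left)
    then have "x1\<^sup>2 \<le> Q\<^sup>2" "(t * x2)\<^sup>2 \<le> Q\<^sup>2" "(t * x3)\<^sup>2 \<le> Q\<^sup>2" "(cmod (ez c) * t\<^sup>2)\<^sup>2 \<le> Q\<^sup>2"
      by (smt (verit) zero_le_power2)+
    then have "x1 \<le> Q" "t * x2 \<le> Q" "t * x3 \<le> Q" "cmod (ez c) * t\<^sup>2 \<le> Q"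
      using Q by (auto intro: power2_le_imp_le)
    then have x: "x1 \<le> Q" "x2 \<le> Q / t" "x3 \<le> Q / t" and c: "cmod (ez c) \<le> K1"
      using t by (auto simp: K1_def field_simps)
    have cz: "cmod (ez c) * cmod z \<le> K1 * cmod z" using c by (intro mult_right_mono) auto
    have "cmod (ez a) \<le> cmod (ez c * z) + x2"
      unfolding x2_def by (metis norm_triangle_sub norm_minus_commute add.commute)
    then have a: "cmod (ez a) \<le> K2" using cz x by (simp add: K2_def norm_mult)
    have "cmod (ez d) \<le> x3 + cmod (ez c * w)"
      unfolding x3_def using norm_triangle_ineq4[of "ez c * w + ez d" "ez c * w"] by simp
    then have d: "cmod (ez d) \<le> K2" using cz x by (simp add: K2_def norm_mult wz)
    define Z W where "Z = z * (ez c * w + ez d)" and "W = ez a * w"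
    have "ez b = Z - W - (Z - (W + ez b))" by simp
    then have "cmod (ez b) \<le> cmod (Z - W) + cmod (Z - (W + ez b))"
      by (metis norm_triangle_ineq4)
    also have "\<dots> \<le> cmod Z + cmod W + x1"
      using norm_triangle_ineq4[of Z W] by (simp add: x1_def Z_def W_def)
    also have "\<dots> \<le> K3"
      unfolding K3_def Z_def W_def norm_mult wz x3_def[symmetric]
      using x a by (intro add_mono mult_left_mono mult_right_mono) auto
    finally have b: "cmod (ez b) \<le> K3" .
    show "cmod (ez a) \<le> K1 + K2 + K3 \<and> cmod (ez b) \<le> K1 + K2 + K3 \<and> cmod (ez c) \<le> K1 + K2 + K3 \<and> cmod (ez d) \<le> K1 + K2 + K3"
      using a b c d K by linarith
  qed
qed

lemma gies_discrete: "discrete_group Gieseking"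
  unfolding discrete_group_def
proof (intro ballI allI)
  fix p :: "complex \<times> real" and r :: real assume p: "p \<in> hspace"
  obtain z t where zt: "p = (z, t)" "t > 0" using p by (cases p) (auto simp: hspace_def)
  define D where "D = cosh (max r 0)"
  have D: "D \<ge> 0" using cosh_real_pos[of "max r 0"] by (simp add: D_def)
  obtain K where K: "\<And>\<gamma> a b c d e. represents \<gamma> (a, b, c, d) e \<Longrightarrow> coshd (z, t) (\<gamma> (z, t)) \<le> D
    \<Longrightarrow> cmod (ez a) \<le> K \<and> cmod (ez b) \<le> K \<and> cmod (ez c) \<le> K \<and> cmod (ez d) \<le> K"
    using rep_entries_bounded[OF zt(2) D, of z] by metis
  obtain M e where Me: "\<And>\<gamma>. \<gamma> \<in> Gieseking \<Longrightarrow> represents \<gamma> (M \<gamma>) (e \<gamma>)"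
    using gies_rep by metis
  define S where "S = {\<gamma>\<in>Gieseking. hdist p (\<gamma> p) \<le> r}"
  define B where "B = {x. cmod (ez x) \<le> K}"
  have "(\<lambda>\<gamma>. (M \<gamma>, e \<gamma>)) ` S \<subseteq> (B \<times> B \<times> B \<times> B) \<times> UNIV"
  proof (rule image_subsetI)
    fix \<gamma> assume "\<gamma> \<in> S"
    then have g: "\<gamma> \<in> Gieseking" "hdist p (\<gamma> p) \<le> max r 0" by (auto simp: S_def)
    have gp: "\<gamma> p \<in> hspace" using isom_groupD(1)[OF gies_isom_group g(1)] p by (rule hyp_isom_in)
    have "coshd p (\<gamma> p) \<le> D" using g(2) hdist_le_iff[OF p gp] by (simp add: D_def)
    moreover obtain a b c d where abcd: "M \<gamma> = (a, b, c, d)" by (cases "M \<gamma>" rule: prod_cases4)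
    ultimately show "(M \<gamma>, e \<gamma>) \<in> (B \<times> B \<times> B \<times> B) \<times> UNIV"
      using K[of \<gamma> a b c d "e \<gamma>"] Me[OF g(1)] by (auto simp: zt B_def)
  qed
  moreover have "finite ((B \<times> B \<times> B \<times> B) \<times> (UNIV :: bool set))"
    unfolding B_def by (intro finite_cartesian_product finite_bounded_eis) auto
  ultimately have "finite ((\<lambda>\<gamma>. (M \<gamma>, e \<gamma>)) ` S)" by (rule finite_subset)
  moreover have "inj_on (\<lambda>\<gamma>. (M \<gamma>, e \<gamma>)) S"
  proof (rule inj_onI)
    fix \<gamma> \<delta> assume "\<gamma> \<in> S" "\<delta> \<in> S" and eq: "(M \<gamma>, e \<gamma>) = (M \<delta>, e \<delta>)"
    then have "represents \<gamma> (M \<gamma>) (e \<gamma>)" "represents \<delta> (M \<delta>) (e \<delta>)" using Me unfolding S_def by blast+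
    moreover have "M \<gamma> = M \<delta> \<and> e \<gamma> = e \<delta>" using eq by (simp only: prod.inject)
    ultimately have "represents \<gamma> (M \<gamma>) (e \<gamma>)" "represents \<delta> (M \<gamma>) (e \<gamma>)" by (simp_all only:)
    then show "\<gamma> = \<delta>" by (rule rep_unique)
  qed
  ultimately show "finite {\<gamma>\<in>Gieseking. hdist p (\<gamma> p) \<le> r}" using finite_imageD unfolding S_def by blast
qed

section \<open>The maximal injectivity radius of the Gieseking manifold\<close>

lemma coshd_rc:
  assumes "t > 0" "s > 0"
  shows "coshd (rc u v, t) (rc x y, s)
    = ((u - x) * (u - x) + (u - x) * (v - y) + (v - y) * (v - y) + t\<^sup>2 + s\<^sup>2) / (2 * t * s)"
  using assms by (simp add: coshd_eq rc_simps norm_rc)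

text \<open>The regular ideal tetrahedron with vertices \<open>\<infinity>, 0, 1, \<omega>\<close>.\<close>
definition tetra :: "complex \<times> real \<Rightarrow> bool" where
  "tetra p \<longleftrightarrow> (\<exists>u v t. p = (rc u v, t) \<and> t > 0 \<and> u \<ge> 0 \<and> v \<ge> 0 \<and> u + v \<le> 1
     \<and> u + v \<le> u * u + u * v + v * v + t\<^sup>2)"

text \<open>The bisectors between the centre of the tetrahedron and its images under the four face
  pairings are the faces, so the Dirichlet domain of the centre lies in the tetrahedron.\<close>
lemma gies_to_tetra:
  assumes p: "p \<in> hspace"
  obtains \<gamma> where "\<gamma> \<in> Gieseking" "tetra (\<gamma> p)"
proof -
  note G = gies_isom_group
  \<comment> \<open>Above the centroid of 0, 1, \<omega>, this height makes the point equidistant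
    from the four faces.\<close>
  define \<tau> where "\<tau> = sqrt (2 / 3 :: real)"
  have \<tau>: "\<tau> > 0" "\<tau>\<^sup>2 = 2 / 3" by (auto simp: \<tau>_def)
  define c where "c = (rc (1/3) (1/3), \<tau>)"
  have c: "c \<in> hspace" using \<tau> by (simp add: c_def hspace_def)
  define f where "f = (\<lambda>\<gamma>. hdist (\<gamma> p) c)"
  define S where "S = {\<gamma>\<in>Gieseking. f \<gamma> \<le> f id}"
  have gp: "\<gamma> p \<in> hspace" if "\<gamma> \<in> Gieseking" for \<gamma>
    using isom_groupD(1)[OF G that] p by (rule hyp_isom_in)
  have "S \<subseteq> {\<gamma>\<in>Gieseking. hdist p (\<gamma> p) \<le> hdist p c + hdist p c}"
  proof
    fix \<gamma> assume "\<gamma> \<in> S"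
    then have g: "\<gamma> \<in> Gieseking" "hdist (\<gamma> p) c \<le> hdist p c" by (auto simp: S_def f_def)
    then show "\<gamma> \<in> {\<gamma>\<in>Gieseking. hdist p (\<gamma> p) \<le> hdist p c + hdist p c}"
      using hdist_triangle[OF p c gp[OF g(1)]] by (simp add: hdist_commute)
  qed
  moreover have "finite {\<gamma>\<in>Gieseking. hdist p (\<gamma> p) \<le> hdist p c + hdist p c}"
    using gies_discrete p by (simp add: discrete_group_def)
  ultimately have "finite S" by (rule finite_subset)
  moreover have "id \<in> S" using isom_groupD(2)[OF G] by (simp add: S_def)
  ultimately obtain \<gamma> where g: "\<gamma> \<in> S" "\<And>\<delta>. \<delta> \<in> S \<Longrightarrow> f \<gamma> \<le> f \<delta>"
    using arg_min_if_finite[of S f] by (metis empty_iff not_le_imp_less)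
  then have gG: "\<gamma> \<in> Gieseking" by (simp add: S_def)
  have least: "f \<gamma> \<le> f \<delta>" if "\<delta> \<in> Gieseking" for \<delta>
    using g that by (cases "\<delta> \<in> S") (auto simp: S_def)
  define q where "q = \<gamma> p"
  have q: "q \<in> hspace" using gp[OF gG] by (simp add: q_def)
  have D: "coshd q c \<le> coshd q (g c)" if "g \<in> Gieseking" for g
  proof -
    have i: "hyp_isom g" using isom_groupD(1)[OF G that] .
    have gc: "g c \<in> hspace" using i c by (rule hyp_isom_in)
    have iq: "inv g q \<in> hspace" using hyp_isom_in[OF hyp_isom_inv[OF i] q] .
    have "hdist q c \<le> hdist (inv g q) c"
      using least[of "inv g \<circ> \<gamma>"] isom_groupD(3,4)[OF G] that gG by (simp add: f_def q_def)
    also have "\<dots> = hdist q (g c)" using hyp_isom_hdist[OF i iq c] i by simp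
    finally show ?thesis
      using hdist_le_iff[OF q c hdist_nonneg[OF q gc]] by (simp add: cosh_hdist q gc)
  qed
  obtain z t where zt: "q = (z, t)" "t > 0" using q by (cases q) (auto simp: hspace_def)
  obtain u v where z: "z = rc u v" by (rule rc_exhaust)
  have dd: "u * u + u * v + v * v + 2 / 3 + 1 + u - v > 0" for u v :: real
    using gies_g2_denominator_pos[OF \<tau>(1)] by (simp add: \<tau>)
  have i1: "gies_g1 c = (rc (2/3) (-1/3), \<tau>)"
    using \<tau>(1) by (simp add: c_def gies_g1_rc)
  have i2: "inv gies_g1 c = (rc (2/3) (2/3), \<tau>)"
  proof -
    have "gies_g1 (rc (2/3) (2/3), \<tau>) = c" using \<tau>(1) by (simp add: c_def gies_g1_rc)
    then show ?thesis using hyp_isom_gies_g1 by (metis hyp_isom_inv_apply(1))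
  qed
  have i3: "gies_g2 c = (rc (1/3) (1/3), \<tau> / 2)"
    using \<tau>(1) by (simp add: c_def gies_g2_rc \<tau>(2))
  have i4: "inv gies_g2 c = (rc (-1/3) (2/3), \<tau>)"
  proof -
    have "gies_g2 (rc (-1/3) (2/3), \<tau>) = c" using \<tau>(1) by (simp add: c_def gies_g2_rc \<tau>(2))
    then show ?thesis using hyp_isom_gies_g2 by (metis hyp_isom_inv_apply(1))
  qed
  note gi = gies_gens isom_groupD(4)[OF G gies_gens(1)] isom_groupD(4)[OF G gies_gens(2)]
  have frac: "x \<le> y" if "x / (2 * t * \<tau>) \<le> y / (2 * t * \<tau>)" for x y
    using that zt(2) \<tau> by (simp add: divide_le_cancel)
  have E: "coshd (rc u v, t) (rc (1/3) (1/3), \<tau>) \<le> coshd (rc u v, t) (g c)" if "g \<in> Gieseking" for g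
    using D[OF that] by (simp only: zt(1) z c_def)
  have "v \<ge> 0"
    using frac[OF E[OF gi(1), unfolded i1 coshd_rc[OF zt(2) \<tau>(1)]]] by (simp add: field_simps)
  moreover have "u + v \<le> 1"
    using frac[OF E[OF gi(3), unfolded i2 coshd_rc[OF zt(2) \<tau>(1)]]] by (simp add: algebra_simps)
  moreover have "u \<ge> 0"
    using frac[OF E[OF gi(4), unfolded i4 coshd_rc[OF zt(2) \<tau>(1)]]] by (simp add: field_simps)
  moreover have "u + v \<le> u * u + u * v + v * v + t\<^sup>2"
  proof -
    define n where "n = (u - 1/3) * (u - 1/3) + (u - 1/3) * (v - 1/3) + (v - 1/3) * (v - 1/3)"
    have "\<tau> / 2 > 0" using \<tau> by simp
    have "(n + t\<^sup>2 + \<tau>\<^sup>2) / (2 * t * \<tau>) \<le> (n + t\<^sup>2 + (\<tau> / 2)\<^sup>2) / (2 * t * (\<tau> / 2))"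
      using E[OF gi(2), unfolded i3 coshd_rc[OF zt(2) \<tau>(1)] coshd_rc[OF zt(2) \<open>\<tau> / 2 > 0\<close>]]
      by (simp only: n_def)
    also have "(n + t\<^sup>2 + (\<tau> / 2)\<^sup>2) / (2 * t * (\<tau> / 2)) = 2 * (n + t\<^sup>2 + (\<tau> / 2)\<^sup>2) / (2 * t * \<tau>)"
    proof -
      have "X / (2 * t * (\<tau> / 2)) = 2 * X / (2 * t * \<tau>)" for X by simp
      then show ?thesis .
    qed
    finally have "n + t\<^sup>2 + \<tau>\<^sup>2 \<le> 2 * (n + t\<^sup>2 + (\<tau> / 2)\<^sup>2)" by (rule frac)
    then have "1 / 3 \<le> n + t\<^sup>2" by (simp add: \<tau> power_divide)
    then show ?thesis by (simp add: n_def algebra_simps)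
  qed
  ultimately have "tetra (\<gamma> p)"
    using zt unfolding q_def[symmetric] tetra_def z by blast
  then show ?thesis using that gG by blast
qed

section \<open>Fixed points in the Gieseking group\<close>

lemma enorm_small:
  assumes "enorm c < 3" "enorm c \<noteq> 1" shows "c = (0, 0)"
proof -
  obtain x y where c: "c = (x, y)" by (cases c)
  have e: "x * x + x * y + y * y \<le> 2" using assms by (simp add: c)
  have sq: "n = -1 \<or> n = 0 \<or> n = 1" if "3 * (n * n) \<le> 8" for n :: int
  proof -
    have "\<not> \<bar>n\<bar> \<ge> 2"
    proof
      assume "\<bar>n\<bar> \<ge> 2"
      then have "2 * 2 \<le> \<bar>n\<bar> * \<bar>n\<bar>" by (intro mult_mono) auto
      then show False using that by (simp add: abs_mult_self_eq)
    qed
    then show ?thesis by linarith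
  qed
  have "(2 * x + y) * (2 * x + y) + 3 * (y * y) \<le> 8" "(2 * y + x) * (2 * y + x) + 3 * (x * x) \<le> 8"
    using e by (simp_all add: algebra_simps)
  then have "x = -1 \<or> x = 0 \<or> x = 1" "y = -1 \<or> y = 0 \<or> y = 1"
    using zero_le_square[of "2 * x + y"] zero_le_square[of "2 * y + x"] by (intro sq; linarith)+
  then show ?thesis using assms by (auto simp: c)
qed

text \<open>The (2,2) entry of the Hermitian matrix of a point is the reciprocal of its
  height.\<close>

lemma rep_height:
  fixes z :: complex
  assumes r: "represents \<gamma> (a, b, c, d) e" and t: "t > 0"
  defines "w \<equiv> if e then cnj z else z"
  shows "snd (\<gamma> (z, t)) = t / ((cmod (ez c * w + ez d))\<^sup>2 + (cmod (ez c))\<^sup>2 * t\<^sup>2)"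
proof -
  define C D T where "C = ez c" and "D = ez d" and "T = complex_of_real t"
  have T: "T \<noteq> 0" using t by (simp add: T_def)
  have p: "(z, t) \<in> hspace" using t by (simp add: hspace_def)
  define t' where "t' = snd (\<gamma> (z, t))"
  have "herm (\<gamma> (z, t)) = cact (cz (a, b, c, d)) (hcnj e (herm (z, t)))"
    using r p unfolding represents_def by blast
  moreover define X where "X = complex_of_real ((cmod z)\<^sup>2 + t\<^sup>2)"
  moreover have "hcnj e (herm (z, t)) = (X / T, w / T, 1 / T)"
    by (simp add: herm_def w_def T_def X_def)
  moreover have "fst (snd (herm q)) = fst q / of_real (snd q)" "snd (snd (herm q)) = of_real (1 / snd q)" for q
    by (simp_all add: herm_def)
  ultimately have "complex_of_real (1 / t') = snd (snd (cact (ez a, ez b, C, D) (X / T, w / T, 1 / T)))"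
    by (metis C_def D_def cz.simps t'_def)
  also have "\<dots> = (C * cnj C * X + C * cnj D * w + cnj C * D * cnj w + D * cnj D) / T"
    by (simp add: add_divide_distrib) (simp add: T_def)
  finally have "complex_of_real (1 / t') = (C * cnj C * of_real ((cmod z)\<^sup>2 + t\<^sup>2) + C * cnj D * w + cnj C * D * cnj w + D * cnj D) / T"
    by (simp only: X_def)
  also have "C * cnj C * of_real ((cmod z)\<^sup>2 + t\<^sup>2) + C * cnj D * w + cnj C * D * cnj w + D * cnj D
     = of_real ((cmod (C * w + D))\<^sup>2 + (cmod C)\<^sup>2 * t\<^sup>2)"
    unfolding of_real_add of_real_mult complex_norm_square by (cases e) (simp_all add: w_def algebra_simps)
  finally have "complex_of_real (1 / t') = of_real (((cmod (C * w + D))\<^sup>2 + (cmod C)\<^sup>2 * t\<^sup>2) / t)"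
    by (simp add: T_def)
  then have "1 / t' = ((cmod (C * w + D))\<^sup>2 + (cmod C)\<^sup>2 * t\<^sup>2) / t" by (simp only: of_real_eq_iff)
  then have "t' = t / ((cmod (C * w + D))\<^sup>2 + (cmod C)\<^sup>2 * t\<^sup>2)" by (metis inverse_divide inverse_inverse_eq divide_inverse mult_1)
  then show ?thesis by (simp add: t'_def C_def D_def)
qed

text \<open>Move the ideal vertex nearest to \<open>p\<close> to \<open>\<infinity>\<close>.\<close>
lemma gies_to_high:
  assumes p: "p \<in> hspace"
  obtains \<gamma> where "\<gamma> \<in> Gieseking" "(snd (\<gamma> p))\<^sup>2 \<ge> 1 / 3"
proof -
  obtain \<delta> where d: "\<delta> \<in> Gieseking" "tetra (\<delta> p)" using gies_to_tetra[OF p] .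
  obtain u v t where zt: "\<delta> p = (rc u v, t)" "t > 0" and uv: "u \<ge> 0" "v \<ge> 0" "u + v \<le> 1"
      "u + v \<le> u * u + u * v + v * v + t\<^sup>2"
    using d(2) unfolding tetra_def by blast
  \<comment> \<open>One coordinate per face, vanishing on it and nonnegative in the tetrahedron; the
    indices 0, 1, 2, 3 stand for the opposite vertices \<infinity>, \<omega>, 1, 0. The height with
    a vertex moved to infinity is \<open>t\<close> over the sum of the other three coordinates, and
    \<open>t\<^sup>2\<close> is their second elementary symmetric polynomial.\<close>
  define c0 c1 c2 c3 where "c0 = u * u + u * v + v * v + t\<^sup>2 - u - v" and "c1 = v" and "c2 = u" and "c3 = 1 - u - v"
  have c: "c0 \<ge> 0" "c1 \<ge> 0" "c2 \<ge> 0" "c3 \<ge> 0" using uv by (auto simp: c0_def c1_def c2_def c3_def)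
  have e2: "t\<^sup>2 = c0 * (c1 + c2 + c3) + c1 * c2 + c1 * c3 + c2 * c3"
    by (simp add: c0_def c1_def c2_def c3_def algebra_simps power2_eq_square)
  \<comment> \<open>If \<open>x0\<close> is largest, the squared sum of the others is at most
    \<open>3 * x0\<close> times that sum, which is part of three times the symmetric
    polynomial.\<close>
  have big: "(x1 + x2 + x3)\<^sup>2 \<le> 3 * t\<^sup>2" if "x0 \<ge> 0" "x1 \<ge> 0" "x2 \<ge> 0" "x3 \<ge> 0" "x1 \<le> x0" "x2 \<le> x0" "x3 \<le> x0"
    and e: "t\<^sup>2 = x0 * (x1 + x2 + x3) + x1 * x2 + x1 * x3 + x2 * x3" for x0 x1 x2 x3
  proof -
    have "(x1 + x2 + x3) * (x1 + x2 + x3) \<le> (3 * x0) * (x1 + x2 + x3)" using that by (intro mult_right_mono) auto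
    moreover have "x1 * x2 \<ge> 0" "x1 * x3 \<ge> 0" "x2 * x3 \<ge> 0" using that by auto
    ultimately show ?thesis using e by (simp add: power2_eq_square)
  qed
  have high: "(t / B)\<^sup>2 \<ge> 1 / 3" if "B\<^sup>2 \<le> 3 * t\<^sup>2" "B \<noteq> 0" for B
    using that by (simp add: power_divide field_simps)
  have "represents (inv gies_g2) ((1, 0), (0, 0), (0, -1), (1, 0)) True"
    using rep_gies_inv(2) by (simp add: gies_matrix2_def)
  note r1 = this
  have r2: "represents (inv gies_g2 \<circ> inv gies_g2) ((1, 0), (0, 0), (-1, 0), (1, 0)) False"
    using rep_comp[OF r1 r1] by (simp add: twist_def)
  have r3: "represents (inv gies_g2 \<circ> inv gies_g2 \<circ> inv gies_g1) ((0, 1), (1, -1), (0, -1), (0, 0)) True"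
    using rep_comp[OF r2 rep_gies_inv(1)] by (simp add: twist_def gies_matrix1_def)
  note ds = ez.simps rc_simps norm_rc if_True if_False
  have h1: "snd (inv gies_g2 (rc u v, t)) = t / (c0 + c2 + c3)"
    unfolding rep_height[OF r1 zt(2)] ds by (simp add: c0_def c2_def c3_def algebra_simps)
  have h2: "snd ((inv gies_g2 \<circ> inv gies_g2) (rc u v, t)) = t / (c0 + c1 + c3)"
    unfolding rep_height[OF r2 zt(2)] ds by (simp add: c0_def c1_def c3_def algebra_simps)
  have h3: "snd ((inv gies_g2 \<circ> inv gies_g2 \<circ> inv gies_g1) (rc u v, t)) = t / (c0 + c1 + c2)"
    unfolding rep_height[OF r3 zt(2)] ds by (simp add: c0_def c1_def c2_def algebra_simps)
  have pos: "c0 + c2 + c3 > 0" "c0 + c1 + c3 > 0" "c0 + c1 + c2 > 0"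
  proof -
    have "(rc u v, t) \<in> hspace" using zt(2) by (simp add: hspace_def)
    moreover have "hyp_isom (inv gies_g2)" "hyp_isom (inv gies_g2 \<circ> inv gies_g2)"
      "hyp_isom (inv gies_g2 \<circ> inv gies_g2 \<circ> inv gies_g1)"
      using r1 r2 r3 unfolding represents_def by blast+
    ultimately have "inv gies_g2 (rc u v, t) \<in> hspace" "(inv gies_g2 \<circ> inv gies_g2) (rc u v, t) \<in> hspace"
      "(inv gies_g2 \<circ> inv gies_g2 \<circ> inv gies_g1) (rc u v, t) \<in> hspace"
      using hyp_isom_in by blast+
    then show "c0 + c2 + c3 > 0" "c0 + c1 + c3 > 0" "c0 + c1 + c2 > 0"
      using zt(2) unfolding hspace_def mem_Collect_eq h1 h2 h3 by (simp_all add: zero_less_divide_iff)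
  qed
  have mem: "inv gies_g2 \<circ> \<delta> \<in> Gieseking" "inv gies_g2 \<circ> inv gies_g2 \<circ> \<delta> \<in> Gieseking"
    "inv gies_g2 \<circ> inv gies_g2 \<circ> inv gies_g1 \<circ> \<delta> \<in> Gieseking"
    by (intro isom_groupD(3)[OF gies_isom_group] isom_groupD(4)[OF gies_isom_group] gies_gens d(1))+
  consider "c1 \<le> c0" "c2 \<le> c0" "c3 \<le> c0" | "c0 \<le> c1" "c2 \<le> c1" "c3 \<le> c1"
    | "c0 \<le> c2" "c1 \<le> c2" "c3 \<le> c2" | "c0 \<le> c3" "c1 \<le> c3" "c2 \<le> c3" by linarith
  then show ?thesis
  proof cases
    case 1
    have "(c1 + c2 + c3)\<^sup>2 \<le> 3 * t\<^sup>2" by (rule big[OF c 1 e2])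
    then have "(snd (\<delta> p))\<^sup>2 \<ge> 1 / 3" by (simp add: zt c1_def c2_def c3_def)
    then show ?thesis using that d(1) by blast
  next
    case 2
    have "(c0 + c2 + c3)\<^sup>2 \<le> 3 * t\<^sup>2" by (rule big[OF c(2,1,3,4) 2]) (simp add: e2 algebra_simps)
    then show ?thesis using that[OF mem(1)] high[of "c0 + c2 + c3"] pos by (simp add: zt h1)
  next
    case 3
    have "(c0 + c1 + c3)\<^sup>2 \<le> 3 * t\<^sup>2" by (rule big[OF c(3,1,2,4) 3]) (simp add: e2 algebra_simps)
    then show ?thesis using that[OF mem(2)] high[of "c0 + c1 + c3"] pos h2 by (simp add: zt)
  next
    case 4
    have "(c0 + c1 + c2)\<^sup>2 \<le> 3 * t\<^sup>2" by (rule big[OF c(4,1,2,3) 4]) (simp add: e2 algebra_simps)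
    then show ?thesis using that[OF mem(3)] high[of "c0 + c1 + c2"] pos h3 by (simp add: zt)
  qed
qed

text \<open>A fixed point makes the trace a rational integer of modulus at most 2. The values 1 and
  -1 fail modulo 2, the value 0 is excluded through the size of \<open>c\<close>, and 2 or -2 force
  equality throughout the displacement formula.\<close>

lemma rep_fixes_high_point:
  assumes r: "represents \<gamma> M False" and p: "p \<in> hspace" and high: "(snd p)\<^sup>2 \<ge> 1 / 3" and fx: "\<gamma> p = p"
  shows "M = ((1, 0), (0, 0), (0, 0), (1, 0)) \<or> M = ((-1, 0), (0, 0), (0, 0), (-1, 0))"
proof -
  obtain a b c d where M: "M = (a, b, c, d)" by (cases M rule: prod_cases4)
  obtain u v t where zt: "p = (rc u v, t)" "t > 0"
  proof -
    obtain z t where "p = (z, t)" by (cases p)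
    moreover obtain u v where "z = rc u v" by (rule rc_exhaust)
    ultimately show ?thesis using that p by (simp add: hspace_def)
  qed
  have t3: "t\<^sup>2 \<ge> 1 / 3" using high by (simp add: zt)
  define z A B C D T where "z = rc u v" and "A = ez a" and "B = ez b" and "C = ez c" and "D = ez d" and "T = complex_of_real t"
  have T: "T \<noteq> 0" "cnj T = T" using zt by (auto simp: T_def)
  define n where "n = (cmod z)\<^sup>2 + t\<^sup>2"
  have n: "n > 0" using zt(2) by (auto simp: n_def intro!: add_nonneg_pos)
  have det: "A * D - B * C = 1"
  proof -
    have "mdet M = (1, 0)" using r by (simp only: represents_def)
    from arg_cong[OF this, of ez] show ?thesis by (simp add: M ez_simps A_def B_def C_def D_def rc_def)
  qed
  have "\<forall>q\<in>hspace. herm (\<gamma> q) = cact (cz M) (hcnj False (herm q))" using r unfolding represents_def by blast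
  from bspec[OF this p] have "herm p = cact (cz M) (hcnj False (herm p))" by (simp only: fx)
  moreover have hp: "herm p = (of_real n / T, z / T, 1 / T)"
    by (simp add: zt herm_def z_def n_def T_def)
  moreover have "hcnj False X = X" for X by (cases X) simp
  moreover have "cz M = (A, B, C, D)" by (simp add: M A_def B_def C_def D_def)
  ultimately have "(of_real n / T, z / T, 1 / T) = cact (A, B, C, D) (of_real n / T, z / T, 1 / T)"
    by (simp only:)
  then have "of_real n / T = (A * cnj A * of_real n + A * cnj B * z + cnj A * B * cnj z + B * cnj B) / T"
    "z / T = (A * cnj C * of_real n + A * cnj D * z + B * cnj C * cnj z + B * cnj D) / T"
    using T by (simp_all add: add_divide_distrib)
  then have H: "of_real n = A * cnj A * of_real n + A * cnj B * z + cnj A * B * cnj z + B * cnj B"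
    "z = A * cnj C * of_real n + A * cnj D * z + B * cnj C * cnj z + B * cnj D"
    using T by (simp_all only: divide_cancel_right, auto)
  have E: "2 * t\<^sup>2 = (cmod (z * (C * z + D) - (A * z + B)))\<^sup>2
     + t\<^sup>2 * ((cmod (C * z - A))\<^sup>2 + (cmod (C * z + D))\<^sup>2) + (cmod C)\<^sup>2 * t ^ 4"
    using rep_ch[OF r[unfolded M] zt(2), of z] fx by (simp add: zt z_def A_def B_def C_def D_def)
  \<comment> \<open>Eliminating from the invariance of the Hermitian matrix expresses
    \<open>(D - cnj A) * n\<close> as a sum of conjugates, so it is real.\<close>
  have tr_im: "Im (A + D) = 0"
  proof -
    have Hc: "cnj z = cnj A * C * of_real n + cnj A * D * cnj z + cnj B * C * z + cnj B * D"
      using arg_cong[OF H(2), of cnj] by simp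
    have "D * of_real n - B * cnj z
       = D * (A * cnj A * of_real n + A * cnj B * z + cnj A * B * cnj z + B * cnj B)
         - B * (cnj A * C * of_real n + cnj A * D * cnj z + cnj B * C * z + cnj B * D)"
      using H(1) Hc by simp
    also have "\<dots> = (A * D - B * C) * (cnj A * of_real n + cnj B * z)" by (simp add: algebra_simps)
    finally have "(D - cnj A) * of_real n = B * cnj z + cnj (B * cnj z)" by (simp add: det algebra_simps)
    then have "Im ((D - cnj A) * of_real n) = 0" by simp
    then show ?thesis using n by simp
  qed
  obtain x y where xy: "eadd a d = (x, y)" by (cases "eadd a d")
  have AD: "A + D = rc x y" using ez_simps(1)[of a d] by (simp add: A_def D_def xy)
  have y: "y = 0" using tr_im unfolding AD by (simp add: rc_def omega_facts)
  have nAD: "(cmod (A + D))\<^sup>2 = x * x" unfolding AD by (simp add: norm_rc y)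
  \<comment> \<open>Parallelogram law for \<open>C * z + D\<close> and \<open>A - C * z\<close>,
    whose sum is the trace and whose squared norms occur in the displacement formula.\<close>
  have par: "(cmod (A + D))\<^sup>2 + (cmod (C * z + D - (A - C * z)))\<^sup>2 = 2 * ((cmod (C * z - A))\<^sup>2 + (cmod (C * z + D))\<^sup>2)"
    by (simp only: cmod_power2) (simp add: power2_eq_square algebra_simps)
  define m where "m = (cmod (C * z - A))\<^sup>2 + (cmod (C * z + D))\<^sup>2"
  have mx: "x * x \<le> 2 * m" using par nAD by (simp add: m_def) (smt (verit) zero_le_power2)
  have t2: "t\<^sup>2 > 0" using zt(2) by simp
  have nn: "(cmod (z * (C * z + D) - (A * z + B)))\<^sup>2 \<ge> 0" "(cmod C)\<^sup>2 * t ^ 4 \<ge> 0" by auto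
  have "t\<^sup>2 * m \<le> t\<^sup>2 * 2" using E nn unfolding m_def[symmetric] by linarith
  then have m2: "m \<le> 2" using t2 by simp
  have x2: "\<bar>x\<bar> \<le> 2"
  proof (rule ccontr)
    assume "\<not> ?thesis"
    then have "3 * 3 \<le> \<bar>x\<bar> * \<bar>x\<bar>" by (intro mult_mono) auto
    then have "9 \<le> x * x" by (simp add: abs_mult_self_eq)
    then have "9 \<le> real_of_int x * real_of_int x" by (metis of_int_le_iff of_int_mult of_int_numeral)
    then show False using mx m2 unfolding of_int_mult by linarith
  qed
  have tr: "mtr M = (x, 0)" by (simp add: M xy y)
  have pM: "preserves M False" "mdet M = (1, 0)" using r by (auto simp: represents_def)
  have "x \<noteq> 1" "x \<noteq> - 1" using preserves_trace[OF pM] by (auto simp: tr)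
  moreover have "x \<noteq> 0"
  proof
    assume x0: "x = 0"
    then have ad: "eadd a d = (0, 0)" using xy y by simp
    \<comment> \<open>The height is unchanged, so \<open>t\<^sup>2 \<ge> 1/3\<close> gives
      \<open>enorm c \<le> 3\<close>. As 2 is not an Eisenstein norm, excluding 1 and 3 leaves
      \<open>c = 0\<close>, where \<open>a\<close> would be a square root of -1.\<close>
    have "t = t / ((cmod (C * z + D))\<^sup>2 + (cmod C)\<^sup>2 * t\<^sup>2)"
      using rep_height[OF r[unfolded M] zt(2), of z] fx by (simp add: zt z_def C_def D_def)
    then have "(cmod (C * z + D))\<^sup>2 + (cmod C)\<^sup>2 * t\<^sup>2 = 1"
      using zt(2) by (metis divide_eq_eq div_by_0 less_irrefl mult_cancel_left2)
    then have "(cmod C)\<^sup>2 * t\<^sup>2 \<le> 1" using zero_le_power2[of "cmod (C * z + D)"] by linarith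
    moreover have "(cmod C)\<^sup>2 * (1 / 3) \<le> (cmod C)\<^sup>2 * t\<^sup>2" using t3 by (intro mult_left_mono) auto
    ultimately have "(cmod C)\<^sup>2 \<le> 3" by simp
    then have "enorm c \<le> 3" unfolding C_def ez_simps(5) by simp
    moreover have "enorm c \<noteq> 3" using enorm_3_no_involution pM(2) ad by (simp add: M del: mdet.simps enorm.simps)
    moreover have "enorm c \<noteq> 1" using preserves_not_involution pM ad unfolding M by blast
    ultimately have c0: "c = (0, 0)" by (intro enorm_small) auto
    have "d = eneg a" using ad by (cases a; cases d) auto
    then have "emul a a = (-1, 0)" using pM(2) by (cases a; cases b) (simp add: M c0 algebra_simps)
    then show False using no_square_root_of_minus_one by blast
  qed
  ultimately have x2': "x = 2 \<or> x = -2" using x2 by linarith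
  then have x4: "real_of_int x * real_of_int x = 4" by auto
  have m: "m = 2" using x4 mx m2 unfolding of_int_mult by linarith
  \<comment> \<open>The middle term now exhausts the left side, so the other two vanish.\<close>
  have "2 * t\<^sup>2 = (cmod (z * (C * z + D) - (A * z + B)))\<^sup>2 + t\<^sup>2 * 2 + (cmod C)\<^sup>2 * t ^ 4"
    using E unfolding m_def[symmetric] m .
  then have "(cmod (z * (C * z + D) - (A * z + B)))\<^sup>2 = 0" "(cmod C)\<^sup>2 * t ^ 4 = 0"
    using nn by linarith+
  then have C0: "C = 0" and B: "z * (C * z + D) - (A * z + B) = 0" using zt(2) by auto
  have "(cmod (A + D))\<^sup>2 + (cmod (D - A))\<^sup>2 = 2 * m" using par unfolding m_def[symmetric] by (simp add: C0)
  then have "(cmod (D - A))\<^sup>2 = 0" using nAD x4 m unfolding of_int_mult by linarith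
  then have DA: "D = A" by simp
  have B0: "B = 0" using B by (simp add: C0 DA)
  have "2 * A = of_int x" using AD DA y by (simp add: rc_def)
  then have "A = 1 \<or> A = -1" using x2' by auto
  then have "ez a = ez (1, 0) \<and> ez d = ez (1, 0) \<or> ez a = ez (-1, 0) \<and> ez d = ez (-1, 0)"
    using DA by (auto simp: A_def D_def rc_def)
  moreover have "ez b = ez (0, 0)" "ez c = ez (0, 0)" using B0 C0 by (auto simp: B_def C_def rc_def)
  ultimately show ?thesis unfolding ez_eq_iff M by blast
qed

text \<open>An orientation-reversing element is treated through its square, which fixes the same
  point and so is plus or minus the identity; modulo 2 this contradicts
  \<open>preserves_square\<close>.\<close>

lemma gies_fixes_high_point:
  assumes g: "\<gamma> \<in> Gieseking" and p: "p \<in> hspace" "(snd p)\<^sup>2 \<ge> 1 / 3" and fx: "\<gamma> p = p"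
  shows "\<gamma> = id"
proof -
  obtain M e where r: "represents \<gamma> M e" using gies_rep[OF g] by blast
  show ?thesis
  proof (cases e)
    case False
    then have "represents \<gamma> M False" using r by simp
    have "cact (cz M) T = T" for T
      using rep_fixes_high_point[OF \<open>represents \<gamma> M False\<close> p fx] cact_neg[of 1 0 0 1 T] cact_id[of T]
      by (auto simp: rc_def)
    moreover have "hcnj False T = T" for T by (cases T) simp
    ultimately have "herm (\<gamma> q) = herm q" if "q \<in> hspace" for q
      using \<open>represents \<gamma> M False\<close> that by (simp add: represents_def)
    moreover have "hyp_isom \<gamma>" using r by (simp add: represents_def)
    ultimately show ?thesis
      using herm_inj hyp_isom_in hyp_isom_notin by (metis eq_id_iff)
  next
    case True
    have r2: "represents (\<gamma> \<circ> \<gamma>) (mmul M (mcnj M)) False"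
      using rep_comp[OF r r] True by (simp add: twist_def)
    have "mred 2 (mmul M (mcnj M)) = ((1, 0), (0, 0), (0, 0), (1, 0))"
      using rep_fixes_high_point[OF r2 p] fx by auto
    then show ?thesis using preserves_square r True by (simp add: represents_def)
  qed
qed

lemma gies_acts_freely: "acts_freely Gieseking"
  unfolding acts_freely_def
proof (intro ballI impI)
  fix \<gamma> p assume g: "\<gamma> \<in> Gieseking" and p: "p \<in> hspace" and fx: "\<gamma> p = p"
  obtain \<delta> where d: "\<delta> \<in> Gieseking" "(snd (\<delta> p))\<^sup>2 \<ge> 1 / 3" using gies_to_high[OF p] .
  have i: "hyp_isom \<delta>" using isom_groupD(1)[OF gies_isom_group d(1)] .
  have "\<delta> \<circ> \<gamma> \<circ> inv \<delta> \<in> Gieseking"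
    using isom_groupD(3,4)[OF gies_isom_group] g d(1) by blast
  moreover have "(\<delta> \<circ> \<gamma> \<circ> inv \<delta>) (\<delta> p) = \<delta> p" using fx i by simp
  ultimately have "\<delta> \<circ> \<gamma> \<circ> inv \<delta> = id" using gies_fixes_high_point[OF _ hyp_isom_in[OF i p] d(2)] by blast
  then have "\<delta> (\<gamma> (inv \<delta> (\<delta> q))) = \<delta> q" for q by (metis comp_apply id_apply)
  then have "\<gamma> q = q" for q using i by (metis hyp_isom_inv_apply(1))
  then show "\<gamma> = id" by auto
qed

text \<open>The hypotheses say that all four candidate displacements exceed the threshold, and
  reversing the indices exchanges them in pairs. \<open>side\<close> makes
  \<open>c1 - c2 + c3\<close> and \<open>c2 - c1 + c0\<close> positive; \<open>key\<close> raises
  this to more than \<open>c0\<close> and more than \<open>c3\<close>. But the two add up to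
  \<open>c0 + c3\<close>.\<close>

lemma tetra_cover:
  fixes c0 c1 c2 c3 :: real
  assumes c: "c0 \<ge> 0" "c1 \<ge> 0" "c2 \<ge> 0" "c3 \<ge> 0"
    and a: "(c1 - c2 + c3)\<^sup>2 > c1 * c3 + c0 * (c1 + c2 + c3)"
    and b: "(c2 - c1 + c0)\<^sup>2 > c2 * c0 + c3 * (c2 + c1 + c0)"
    and ab: "c0\<^sup>2 + c1\<^sup>2 + c3\<^sup>2 + c0 * c1 + c0 * c3 + c1 * c3 > c2 * (c0 + c1 + c3)"
    and ba: "c3\<^sup>2 + c2\<^sup>2 + c0\<^sup>2 + c3 * c2 + c3 * c0 + c2 * c0 > c1 * (c3 + c2 + c0)"
  shows False
proof -
  have key: "E > x0" if c: "x0 \<ge> 0" "x1 \<ge> 0" "x2 \<ge> 0" "x3 \<ge> 0" and E: "E > 0" "E \<le> x1 + x2 + x3"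
    and sq: "E * E > x1 * x3 + x0 * (x1 + x2 + x3)" for E x0 x1 x2 x3 :: real
  proof -
    have "x0 * E \<le> x0 * (x1 + x2 + x3)" using c E by (intro mult_left_mono) auto
    moreover have "x1 * x3 \<ge> 0" using c by simp
    ultimately have "x0 * E < E * E" using sq by linarith
    then show ?thesis using E by simp
  qed
  have side: "x1 - x2 + x3 > 0"
    if c: "x0 \<ge> 0" "x1 \<ge> 0" "x2 \<ge> 0" "x3 \<ge> 0" and sq: "(x1 - x2 + x3)\<^sup>2 > x1 * x3 + x0 * (x1 + x2 + x3)"
    and par: "x0\<^sup>2 + x1\<^sup>2 + x3\<^sup>2 + x0 * x1 + x0 * x3 + x1 * x3 > x2 * (x0 + x1 + x3)" for x0 x1 x2 x3 :: real
  proof (rule ccontr)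
    assume "\<not> ?thesis"
    moreover have "x1 - x2 + x3 \<noteq> 0"
    proof
      assume "x1 - x2 + x3 = 0"
      then have "x1 * x3 + x0 * (x1 + x2 + x3) < 0" using sq by simp
      moreover have "x1 * x3 + x0 * (x1 + x2 + x3) \<ge> 0" using c by simp
      ultimately show False by simp
    qed
    ultimately have D: "x2 - x1 - x3 > 0" by simp
    define D where "D = x2 - x1 - x3"
    have "(x1 - x2 + x3)\<^sup>2 = D * D" by (simp add: D_def power2_eq_square algebra_simps)
    then have "D > x0" using key[OF c, of D] sq c D by (simp add: D_def)
    then have "x0 * x0 \<le> D * (x0 + x1 + x3)" using c by (intro mult_mono) auto
    moreover have "x2 = D + x1 + x3" by (simp add: D_def)
    moreover have "x1 * x3 \<ge> 0" using c by simp
    ultimately show False using par by (simp add: power2_eq_square algebra_simps)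
  qed
  have E: "c1 - c2 + c3 > 0" using side[OF c a ab] .
  have F: "c2 - c1 + c0 > 0" using side[OF c(4,3,2,1) b ba] .
  have "c1 - c2 + c3 > c0" using key[OF c E] a c by (simp add: power2_eq_square)
  moreover have "c2 - c1 + c0 > c3" using key[OF c(4,3,2,1) F] b c by (simp add: power2_eq_square)
  ultimately show False by linarith
qed

lemma tetra_displacement:
  assumes p: "tetra p"
  obtains \<gamma> where "\<gamma> \<in> Gieseking" "\<gamma> \<noteq> id" "coshd p (\<gamma> p) \<le> 3/2"
proof -
  note G = gies_isom_group
  obtain u v t where zt: "p = (rc u v, t)" "t > 0" and uv: "u \<ge> 0" "v \<ge> 0" "u + v \<le> 1"
      "u + v \<le> u * u + u * v + v * v + t\<^sup>2"
    using p unfolding tetra_def by blast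
  define c0 c1 c2 c3 where "c0 = u * u + u * v + v * v + t\<^sup>2 - u - v" and "c1 = v" and "c2 = u" and "c3 = 1 - u - v"
  have c: "c0 \<ge> 0" "c1 \<ge> 0" "c2 \<ge> 0" "c3 \<ge> 0" using uv by (auto simp: c0_def c1_def c2_def c3_def)
  have le: "coshd p (\<gamma> p) \<le> 3/2" if "2 * t\<^sup>2 * coshd (rc u v, t) (\<gamma> (rc u v, t)) \<le> 3 * t\<^sup>2" for \<gamma>
    using that zt by (simp add: zt(1))
  have t4: "t ^ 4 = t\<^sup>2 * t\<^sup>2" by (simp add: power2_eq_square power4_eq_xxxx)
  have ra: "represents gies_g1 ((0, 1), (0, -1), (0, 0), (1, -1)) True" using rep_gies_g1 by (simp add: gies_matrix1_def)
  have rb: "represents gies_g2 ((1, 0), (0, 0), (1, -1), (1, 0)) True" using rep_gies_g2 by (simp add: gies_matrix2_def)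
  have rab: "represents (gies_g1 \<circ> inv gies_g2) ((1, 1), (0, -1), (0, 1), (1, -1)) False"
    using rep_comp[OF rep_gies_g1 rep_gies_inv(2)] by (simp add: gies_matrix1_def gies_matrix2_def twist_def)
  have rba: "represents (inv gies_g1 \<circ> gies_g2) ((1, 1), (1, -1), (1, 0), (1, -1)) False"
    using rep_comp[OF rep_gies_inv(1) rep_gies_g2] by (simp add: gies_matrix1_def gies_matrix2_def twist_def)
  note ds = ez.simps rc_simps norm_rc if_True if_False t4
  \<comment> \<open>Subtracting \<open>3 * t\<^sup>2\<close> puts the threshold 3/2 at zero; using
    \<open>c1 + c2 + c3 = 1\<close>, each difference is a quadratic form in the face
    coordinates.\<close>
  have da: "2 * t\<^sup>2 * coshd (rc u v, t) (gies_g1 (rc u v, t)) - 3 * t\<^sup>2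
      = (c1 - c2 + c3)\<^sup>2 - (c1 * c3 + c0 * (c1 + c2 + c3))"
    unfolding rep_ch[OF ra zt(2)] ds c0_def c1_def c2_def c3_def by (simp add: algebra_simps power2_eq_square)
  have db: "2 * t\<^sup>2 * coshd (rc u v, t) (gies_g2 (rc u v, t)) - 3 * t\<^sup>2
      = (c2 - c1 + c0)\<^sup>2 - (c2 * c0 + c3 * (c2 + c1 + c0))"
    unfolding rep_ch[OF rb zt(2)] ds c0_def c1_def c2_def c3_def by (simp add: algebra_simps power2_eq_square)
  have dab: "2 * t\<^sup>2 * coshd (rc u v, t) ((gies_g1 \<circ> inv gies_g2) (rc u v, t)) - 3 * t\<^sup>2
      = c0\<^sup>2 + c1\<^sup>2 + c3\<^sup>2 + c0 * c1 + c0 * c3 + c1 * c3 - c2 * (c0 + c1 + c3)"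
    unfolding rep_ch[OF rab zt(2)] ds c0_def c1_def c2_def c3_def by (simp add: algebra_simps power2_eq_square)
  have dba: "2 * t\<^sup>2 * coshd (rc u v, t) ((inv gies_g1 \<circ> gies_g2) (rc u v, t)) - 3 * t\<^sup>2
      = c3\<^sup>2 + c2\<^sup>2 + c0\<^sup>2 + c3 * c2 + c3 * c0 + c2 * c0 - c1 * (c3 + c2 + c0)"
    unfolding rep_ch[OF rba zt(2)] ds c0_def c1_def c2_def c3_def by (simp add: algebra_simps power2_eq_square)
  \<comment> \<open>One test point suffices: both generators move it, to different points, so the
    two mixed products are nontrivial as well.\<close>
  define base where "base = (rc 0 0, 1::real)"
  have g1: "gies_g1 base = (rc 1 (-1), 1)" by (simp add: base_def gies_g1_rc)
  have g2: "gies_g2 base = (rc 0 (1/2), 1/2)" by (simp add: base_def gies_g2_rc)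
  have ne: "gies_g1 base \<noteq> gies_g2 base" unfolding g1 g2 by simp
  have n1: "gies_g1 \<noteq> id" using g1 by (metis eq_id_iff base_def prod.inject rc_eq_iff zero_neq_one)
  have n2: "gies_g2 \<noteq> id"
  proof
    assume "gies_g2 = id"
    then have "snd (gies_g2 base) = snd base" by simp
    then show False unfolding g2 by (simp add: base_def)
  qed
  have n3: "gies_g1 \<circ> inv gies_g2 \<noteq> id"
  proof
    assume "gies_g1 \<circ> inv gies_g2 = id"
    then have "(gies_g1 \<circ> inv gies_g2) (gies_g2 base) = gies_g2 base" by simp
    then show False using ne hyp_isom_gies_g2 by simp
  qed
  have n4: "inv gies_g1 \<circ> gies_g2 \<noteq> id"
  proof
    assume "inv gies_g1 \<circ> gies_g2 = id"
    then have "gies_g1 ((inv gies_g1 \<circ> gies_g2) base) = gies_g1 base" by simp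
    then show False using ne hyp_isom_gies_g1 by simp
  qed
  have m: "gies_g1 \<circ> inv gies_g2 \<in> Gieseking" "inv gies_g1 \<circ> gies_g2 \<in> Gieseking"
    using gies_gens isom_groupD(3,4)[OF G] by blast+
  show ?thesis
    using tetra_cover[OF c] le that gies_gens m n1 n2 n3 n4 da db dab dba by (smt (verit))
qed

lemma gies_displacement:
  assumes p: "p \<in> hspace"
  obtains \<gamma> where "\<gamma> \<in> Gieseking" "\<gamma> \<noteq> id" "coshd p (\<gamma> p) \<le> 3/2"
proof -
  obtain \<delta> where d: "\<delta> \<in> Gieseking" "tetra (\<delta> p)" using gies_to_tetra[OF p] .
  obtain \<gamma> where g: "\<gamma> \<in> Gieseking" "\<gamma> \<noteq> id" "coshd (\<delta> p) (\<gamma> (\<delta> p)) \<le> 3/2" using tetra_displacement[OF d(2)] .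
  have i: "hyp_isom \<delta>" "hyp_isom \<gamma>" using isom_groupD(1)[OF gies_isom_group] d(1) g(1) by auto
  define \<beta> where "\<beta> = inv \<delta> \<circ> \<gamma> \<circ> \<delta>"
  have b: "\<beta> \<in> Gieseking" unfolding \<beta>_def using isom_groupD(3,4)[OF gies_isom_group] d(1) g(1) by blast
  have db: "\<delta> (\<beta> q) = \<gamma> (\<delta> q)" for q using i by (simp add: \<beta>_def)
  have "\<beta> \<noteq> id"
  proof
    assume "\<beta> = id"
    then have "\<gamma> (\<delta> (inv \<delta> q)) = \<delta> (inv \<delta> q)" for q using db[of "inv \<delta> q"] by simp
    then have "\<gamma> q = q" for q using i by simp
    then show False using g(2) by auto
  qed
  moreover have "coshd p (\<beta> p) \<le> 3/2"
  proof -
    have bp: "\<beta> p \<in> hspace" using isom_groupD(1)[OF gies_isom_group b] p by (rule hyp_isom_in)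
    have "coshd p (\<beta> p) = coshd (\<delta> p) (\<gamma> (\<delta> p))" using hyp_isom_ch[OF i(1) p bp] by (simp add: db)
    then show ?thesis using g(3) by simp
  qed
  ultimately show ?thesis using that b by blast
qed

lemma gies_embedded_radii_le:
  "p \<in> hspace \<Longrightarrow> r \<in> embedded_radii Gieseking p \<Longrightarrow> r \<le> arcosh (sqrt 5 / 2)"
  using gies_displacement embedded_radii_le_rho[OF gies_isom_group] by metis

lemma gies_r_inj_le: "p \<in> hspace \<Longrightarrow> r_inj Gieseking p \<le> arcosh (sqrt 5 / 2)"
  unfolding r_inj_eq
  using embedded_radii_nonempty[OF gies_isom_group gies_discrete gies_acts_freely] gies_embedded_radii_le
  by (intro cSup_least) auto

lemma gies_r_inj_eq:
  assumes p: "p \<in> hspace" and d: "\<And>\<gamma>. \<gamma> \<in> Gieseking \<Longrightarrow> \<gamma> \<noteq> id \<Longrightarrow> coshd p (\<gamma> p) \<ge> 3/2"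
  shows "r_inj Gieseking p = arcosh (sqrt 5 / 2)"
proof (rule antisym[OF gies_r_inj_le[OF p]])
  show "arcosh (sqrt 5 / 2) \<le> r_inj Gieseking p"
    unfolding r_inj_eq
  proof (rule cSup_upper)
    show "arcosh (sqrt 5 / 2) \<in> embedded_radii Gieseking p"
      using gies_isom_group p d by (rule rho_in_embedded_radii)
    show "bdd_above (embedded_radii Gieseking p)"
      using gies_embedded_radii_le[OF p] by (rule bdd_aboveI)
  qed
qed

text \<open>At height \<open>1\<close> above \<open>0\<close>, twice the hyperbolic cosine of a displacement is an integer.\<close>
lemma gies_base_displacement:
  assumes g: "\<gamma> \<in> Gieseking" "\<gamma> \<noteq> id"
  shows "coshd (0, 1) (\<gamma> (0, 1)) \<ge> 3/2"
proof -
  have p: "(0 :: complex, 1 :: real) \<in> hspace" by (simp add: hspace_def)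
  obtain M e where "represents \<gamma> M e" using gies_rep[OF g(1)] by blast
  moreover obtain a b c d where "M = (a, b, c, d)" by (cases M rule: prod_cases4)
  ultimately have r: "represents \<gamma> (a, b, c, d) e" by simp
  have "2 * coshd (0, 1) (\<gamma> (0, 1)) = (cmod (ez b))\<^sup>2 + ((cmod (ez a))\<^sup>2 + (cmod (ez d))\<^sup>2) + (cmod (ez c))\<^sup>2"
    using rep_ch[OF r, of 1 0] by simp
  then have i: "2 * coshd (0, 1) (\<gamma> (0, 1)) = of_int (enorm b + (enorm a + enorm d) + enorm c)"
    by (simp only: ez_simps(5) of_int_add)
  have gp: "\<gamma> (0, 1) \<in> hspace" using isom_groupD(1)[OF gies_isom_group g(1)] p by (rule hyp_isom_in)
  have "coshd (0, 1) (\<gamma> (0, 1)) \<noteq> 1"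
    using gies_acts_freely g p coshd_eq_1_iff[OF p gp] unfolding acts_freely_def by metis
  then have "2 * coshd (0, 1) (\<gamma> (0, 1)) > 2" using coshd_ge_1[OF p gp] by linarith
  then have "enorm b + (enorm a + enorm d) + enorm c > 2" unfolding i by linarith
  then have "enorm b + (enorm a + enorm d) + enorm c \<ge> 3" by simp
  then have "2 * coshd (0, 1) (\<gamma> (0, 1)) \<ge> 3" unfolding i by linarith
  then show ?thesis by simp
qed

text \<open>The maximum is realised at height 1 above 0, so this value is obtained without
  exhibiting a self-tangency.\<close>

lemma gies_R_max: "R_max Gieseking = arcosh (sqrt 5 / 2)"
proof -
  have p: "(0 :: complex, 1 :: real) \<in> hspace" by (simp add: hspace_def)
  have "r_inj Gieseking (0, 1) = arcosh (sqrt 5 / 2)"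
    using gies_r_inj_eq[OF p] gies_base_displacement by blast
  then show ?thesis unfolding R_max_def
    using gies_r_inj_le p by (intro cSup_eq_maximum) (auto intro: image_eqI[of _ _ "(0, 1)"])
qed

section \<open>Injectivity radius at self-tangencies\<close>

lemma self_tangency_hspace: "self_tangency \<Gamma> C p \<Longrightarrow> p \<in> hspace"
  by (simp add: self_tangency_def)

lemma gies_r_inj_self_tangency:
  assumes "self_tangency Gieseking C p"
  shows "r_inj Gieseking p = arcosh (sqrt 5 / 2)"
  using gies_r_inj_eq[OF self_tangency_hspace[OF assms]]
    self_tangency_displacement[OF gies_isom_group gies_acts_freely assms] by blast

lemma r_inj_self_tangency:
  fixes \<Gamma> :: "('a::euclidean_space \<times> real \<Rightarrow> 'a \<times> real) set"
  assumes H: "hyperbolic_group \<Gamma>" and st: "self_tangency \<Gamma> C p"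
  shows "R_max \<Gamma> \<ge> r_inj \<Gamma> p" "r_inj \<Gamma> p \<ge> arcosh (sqrt 5 / 2)"
proof -
  have G: "isom_group \<Gamma>" and D: "discrete_group \<Gamma>" and T: "torsion_free \<Gamma>" and V: "finite_volume \<Gamma>"
    using H by (auto simp: hyperbolic_group_def)
  have F: "acts_freely \<Gamma>" using G D T by (rule torsion_free_imp_acts_freely)
  have p: "p \<in> hspace" using st by (rule self_tangency_hspace)
  obtain R where R: "\<And>q r. q \<in> hspace \<Longrightarrow> r \<in> embedded_radii \<Gamma> q \<Longrightarrow> r \<le> R"
    using embedded_radii_bounded[OF G D V] by metis
  show "r_inj \<Gamma> p \<ge> arcosh (sqrt 5 / 2)"
    unfolding r_inj_eq
  proof (rule cSup_upper)
    show "arcosh (sqrt 5 / 2) \<in> embedded_radii \<Gamma> p"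
      using G p self_tangency_displacement[OF G F st] by (rule rho_in_embedded_radii)
    show "bdd_above (embedded_radii \<Gamma> p)" using R[OF p] by (rule bdd_aboveI)
  qed
  have "r_inj \<Gamma> q \<le> R" if "q \<in> hspace" for q
    unfolding r_inj_eq using embedded_radii_nonempty[OF G D F that] R[OF that] by (intro cSup_least) auto
  then show "R_max \<Gamma> \<ge> r_inj \<Gamma> p"
    unfolding R_max_def using p by (intro cSup_upper imageI bdd_aboveI2[of _ _ R])
qed

theorem theorem3:
  shows "(\<forall>(\<Gamma> :: ('a::euclidean_space \<times> real \<Rightarrow> 'a \<times> real) set) C p.
            hyperbolic_group \<Gamma> \<and> \<not> quotient_compact \<Gamma> \<and> max_cusp \<Gamma> C \<and> self_tangency \<Gamma> C p
            \<longrightarrow> R_max \<Gamma> \<ge> r_inj \<Gamma> p \<and> r_inj \<Gamma> p \<ge> arcosh (sqrt 5 / 2))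
       \<and> (R_max Gieseking = arcosh (sqrt 5 / 2)
          \<and> (\<forall>C p. max_cusp Gieseking C \<and> self_tangency Gieseking C p
                 \<longrightarrow> r_inj Gieseking p = arcosh (sqrt 5 / 2)))"
  using r_inj_self_tangency gies_R_max gies_r_inj_self_tangency by blast

end
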